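(* Let $A$ be an unoriented, symmetrizable generalized intersection matrix and $\mathbf c=(c_i)_{i\in I}\in(\mathbb K(q)^\times)^I$. There is a uniquely determined algebra isomorphism $\varphi:\mathcal G_q(A)_{\mathbf c}\to U_q(\mathcal L(A))_{\mathbf c}$ such that $$\varphi(L_i)=K_iK_{\bar i}^{-1},\qquad\varphi(G_i)=B_i,\qquad\varphi(\overline G_i)=B_{\bar i}\qquad\text{for all }i\in I.$$
   Context: $\mathbb K$ is an algebraically closed field of characteristic $0$, $q$ is an indeterminate, $[a,b]=ab-ba$, and $\left[{m\atop n}\right]_{v}$ denotes the (symmetric) $v$-binomial coefficient. Generalized intersection matrices (GIM). A GIM is an integral matrix $A=(a_{ij})_{i,j\in I}$, $I$ finite, with $a_{ii}=2$, $a_{ij}>0\Leftrightarrow a_{ji}>0$, $a_{ij}<0\Leftrightarrow a_{ji}<0$. It is symmetrizable if there are coprime $\epsilon_i\in\mathbb N$ with $(\epsilon_ia_{ij})$ symmetric. Let $\bar I=\{\bar i\mid i\in I\}$ be a copy of $I$, $\hat I=I\sqcup\bar I$. The generalized Cartan matrix $C(A)=(c_{ij})_{i,j\in\hat I}$ is given by $c_{ii}=c_{\bar i\bar i}=2$, and for $i\ne j$ in $I$: if $a_{ij}\le0$ then $c_{ij}=c_{\bar i\bar j}=a_{ij}$, $c_{i\bar j}=c_{\bar ij}=0$; if $a_{ij}>0$ then $c_{ij}=c_{\bar i\bar j}=0$, $c_{i\bar j}=c_{\bar ij}=-a_{ij}$; and $c_{i\bar i}=c_{\bar ii}=0$. $A$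 is unoriented if $C(A)$ is indecomposable. If $A$ is symmetrizable so is $C(A)$, with $\epsilon_{\bar i}=\epsilon_i$. Quantum GIM algebra $U_q(\mathcal L(A))_{\mathbf c}$. Put $q_i=q_{\bar i}=q^{\epsilon_i}$. $U_q(\mathfrak g(C(A))')$ is the $\mathbb K(q)$-algebra with generators $E_j,F_j,K_j^{\pm1}$ ($j\in\hat I$), commuting invertible $K_j$, and relations $K_iE_j=q_i^{c_{ij}}E_jK_i$, $K_iF_j=q_i^{-c_{ij}}F_jK_i$, $E_iF_j-F_jE_i=\delta_{ij}\frac{K_i-K_i^{-1}}{q_i-q_i^{-1}}$ and the quantum Serre relations $\sum_{n=0}^{1-c_{ij}}(-1)^n\left[{1-c_{ij}\atop n}\right]_{q_i}x_i^{1-c_{ij}-n}x_jx_i^n=0$ for $x=E$ and $x=F$, $i\ne j$ in $\hat I$. $U_q(\mathcal L(A))_{\mathbf c}$ is its subalgebra generated by $$B_i=F_i-c_iE_{\bar i}K_i^{-1},\quad B_{\bar i}=F_{\bar i}-c_iE_iK_{\bar i}^{-1},\quad K_iK_{\bar i}^{-1},\quad K_{\bar i}K_i^{-1}\qquad(i\in I).$$ The algebra $\mathcal G_q(A)_{\mathbf c}$. For $i\in I$, $k\in\mathbb N_0$ put ${}_{-k}F_i(x,y)=\sum_{n=0}^{1+k}(-1)^n\left[{1+k\atop n}\right]_{q_i}x^{1+k-n}yx^n$. $\mathcal G_q(A)_{\mathbf c}$ is the unital associative $\mathbb K(q)$-algebra with generators $G_i,\overline G_i,L_i,\overline L_i$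 ($i\in I$) and the following defining relations: (1) $L_i\overline L_i=1=\overline L_iL_i$ for $i\in I$; (2) $L_iG_j=q_i^{-a_{ij}}G_jL_i$, $L_i\overline G_j=q_i^{a_{ij}}\overline G_jL_i$ for all $i,j\in I$; (3) if $a_{ij}=0$ then $[G_i,G_j]=[\overline G_i,\overline G_j]=0$; and if $a_{ij}=0$ or $i=j$ then $[G_i,\overline G_j]=\delta_{ij}c_i\frac{L_i-\overline L_i}{q_i-q_i^{-1}}$; (4) if $a_{ij}<0$ then ${}_{a_{ij}}F_i(G_i,G_j)=0={}_{a_{ij}}F_i(\overline G_i,\overline G_j)$ and $[G_i,\overline G_j]=0$; (5) if $a_{ij}>0$ then ${}_{-a_{ij}}F_i(G_i,\overline G_j)=0={}_{-a_{ij}}F_i(\overline G_i,G_j)$ and $[G_i,G_j]=0=[\overline G_i,\overline G_j]$.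
   Formalization: The relations L_iL_j = L_jL_i for all i, j are added to the defining relations (1)–(5) of G_q(A)_c; without them the claim fails, since G_i, Ḡ_i ↦ 0 and L_i = L̄_i ↦ free involutions satisfies (1)–(5) with non-commuting L_i. *)

theory Defs
  imports
    "HOL-Algebra.QuotRing"
    "HOL-Algebra.Module"
    "HOL-Algebra.Subrings"
    "HOL-Library.FuncSet"
    "HOL-Library.Poly_Mapping"
    "HOL-Computational_Algebra.Polynomial"
    "HOL-Computational_Algebra.Fraction_Field"
begin

section \<open>Associative algebras given by generators and relations\<close>

text \<open>
  An associative unital algebra over a field is an object of the record type
  \<^typ>\<open>('f, 'a) module\<close>: a ring together with a scalar multiplication. The locale of
  algebras in the library is restricted to commutative algebras and is not used.

  Lists under concatenation are the free monoid, so finitely supported functions on lists with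
  the convolution product are the free associative algebra.
\<close>

instantiation list :: (type) monoid_add
begin

definition zero_list :: "'a list" where "zero_list = []"

definition plus_list :: "'a list \<Rightarrow> 'a list \<Rightarrow> 'a list" where "plus_list xs ys = xs @ ys"

instance by standard (simp_all add: zero_list_def plus_list_def)

end

definition var :: "'x \<Rightarrow> ('x list \<Rightarrow>\<^sub>0 'f::field)" where
  "var x = Poly_Mapping.single [x] 1"

definition scal :: "'f \<Rightarrow> ('x list \<Rightarrow>\<^sub>0 'f::field)" where
  "scal a = Poly_Mapping.single 0 a"

definition free_algebra :: "('f::field, 'x list \<Rightarrow>\<^sub>0 'f) module" where
  "free_algebra =
    \<lparr>carrier = UNIV, monoid.mult = (*), one = 1, zero = 0, add = (+), module.smult = (\<lambda>a x. scal a * x)\<rparr>"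

definition quotient_algebra :: "('f, 'a) module \<Rightarrow> 'a set \<Rightarrow> ('f, 'a set) module" where
  "quotient_algebra M J =
    ring.extend (M Quot J) (module.fields (\<lambda>a X. \<Union>x\<in>X. J +>\<^bsub>M\<^esub> (a \<odot>\<^bsub>M\<^esub> x)))"

text \<open>
  A relation \<open>l = r\<close> is given by the element \<open>l - r\<close>; \<^const>\<open>genideal\<close> is the generated
  two-sided ideal.
\<close>

definition presented_algebra ::
    "('x list \<Rightarrow>\<^sub>0 'f::field) set \<Rightarrow> ('f, ('x list \<Rightarrow>\<^sub>0 'f) set) module" where
  "presented_algebra R = quotient_algebra free_algebra (Idl\<^bsub>free_algebra\<^esub> R)"

definition gen_class :: "('x list \<Rightarrow>\<^sub>0 'f::field) set \<Rightarrow> 'x \<Rightarrow> ('x list \<Rightarrow>\<^sub>0 'f) set" where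
  "gen_class R x = (Idl\<^bsub>free_algebra\<^esub> R) +>\<^bsub>free_algebra\<^esub> var x"

definition is_subalgebra :: "('f, 'a) module \<Rightarrow> 'a set \<Rightarrow> bool" where
  "is_subalgebra M S \<longleftrightarrow> subring S M \<and> (\<forall>a. \<forall>x\<in>S. a \<odot>\<^bsub>M\<^esub> x \<in> S)"

definition generated_subalgebra :: "('f, 'a) module \<Rightarrow> 'a set \<Rightarrow> ('f, 'a) module" where
  "generated_subalgebra M X = M\<lparr>carrier := \<Inter>{S. is_subalgebra M S \<and> X \<subseteq> S}\<rparr>"

definition algebra_iso :: "('f, 'a) module \<Rightarrow> ('f, 'b) module \<Rightarrow> ('a \<Rightarrow> 'b) set" where
  "algebra_iso M N =
    {h \<in> ring_iso M N. \<forall>a. \<forall>x\<in>carrier M. h (a \<odot>\<^bsub>M\<^esub> x) = a \<odot>\<^bsub>N\<^esub> h x}"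


section \<open>Quantum numbers in \<open>K(q)\<close>\<close>

definition q_indet :: "'k::field poly fract" where
  "q_indet = Fract [:0, 1:] 1"

definition qint :: "'f::field \<Rightarrow> nat \<Rightarrow> 'f" where
  "qint v m = (v ^ m - inverse v ^ m) / (v - inverse v)"

definition qfact :: "'f::field \<Rightarrow> nat \<Rightarrow> 'f" where
  "qfact v m = (\<Prod>k=1..m. qint v k)"

definition qbinom :: "'f::field \<Rightarrow> nat \<Rightarrow> nat \<Rightarrow> 'f" where
  "qbinom v m n = qfact v m / (qfact v n * qfact v (m - n))"

text \<open>The polynomial written \<open>{}_{-k}F_i(x, y)\<close> in the literature, where \<open>v = q_i\<close>.\<close>

definition qserre ::
    "'f \<Rightarrow> nat \<Rightarrow> ('x list \<Rightarrow>\<^sub>0 'f) \<Rightarrow> ('x list \<Rightarrow>\<^sub>0 'f) \<Rightarrow> ('x list \<Rightarrow>\<^sub>0 'f::field)" where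
  "qserre v k x y =
    (\<Sum>n=0..1 + k. (-1) ^ n * scal (qbinom v (1 + k) n) * x ^ (1 + k - n) * y * x ^ n)"


section \<open>Generalized intersection matrices\<close>

definition gim :: "('i \<Rightarrow> 'i \<Rightarrow> int) \<Rightarrow> bool" where
  "gim A \<longleftrightarrow> (\<forall>i. A i i = 2) \<and>
    (\<forall>i j. (A i j > 0 \<longleftrightarrow> A j i > 0) \<and> (A i j < 0 \<longleftrightarrow> A j i < 0))"

text \<open>
  \<open>A\<close> is symmetrizable iff such an \<open>\<epsilon>\<close> exists. Coprimality is joint, not pairwise.
\<close>

definition symmetrizer :: "('i \<Rightarrow> 'i \<Rightarrow> int) \<Rightarrow> ('i \<Rightarrow> nat) \<Rightarrow> bool" where
  "symmetrizer A \<epsilon> \<longleftrightarrow> (\<forall>i. \<epsilon> i > 0) \<and> Gcd (range \<epsilon>) = 1 \<and>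
    (\<forall>i j. int (\<epsilon> i) * A i j = int (\<epsilon> j) * A j i)"

text \<open>
  The index set \<open>I \<squnion> \<bar>I\<close> is \<^typ>\<open>'i + 'i\<close>, with \<^term>\<open>Inl i\<close> for \<open>i\<close> and \<^term>\<open>Inr i\<close> for
  its copy.
\<close>

fun cartan_of_gim :: "('i \<Rightarrow> 'i \<Rightarrow> int) \<Rightarrow> 'i + 'i \<Rightarrow> 'i + 'i \<Rightarrow> int" where
  "cartan_of_gim A (Inl i) (Inl j) = (if i = j then 2 else if A i j \<le> 0 then A i j else 0)"
| "cartan_of_gim A (Inr i) (Inr j) = (if i = j then 2 else if A i j \<le> 0 then A i j else 0)"
| "cartan_of_gim A (Inl i) (Inr j) = (if i = j then 0 else if A i j > 0 then - A i j else 0)"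
| "cartan_of_gim A (Inr i) (Inl j) = (if i = j then 0 else if A i j > 0 then - A i j else 0)"

definition indecomposable :: "('j \<Rightarrow> 'j \<Rightarrow> int) \<Rightarrow> bool" where
  "indecomposable C \<longleftrightarrow>
    \<not> (\<exists>S. S \<noteq> {} \<and> S \<noteq> UNIV \<and> (\<forall>i\<in>S. \<forall>j\<in>- S. C i j = 0 \<and> C j i = 0))"

definition unoriented :: "('i \<Rightarrow> 'i \<Rightarrow> int) \<Rightarrow> bool" where
  "unoriented A \<longleftrightarrow> indecomposable (cartan_of_gim A)"


section \<open>The quantized enveloping algebra and the quantum GIM algebra\<close>

definition qi :: "('j \<Rightarrow> nat) \<Rightarrow> 'j \<Rightarrow> 'k::field poly fract" where
  "qi \<epsilon> j = q_indet ^ \<epsilon> j"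

datatype 'j uq_gen = UE 'j | UF 'j | UK 'j | UKinv 'j

inductive_set uq_rels ::
    "('j \<Rightarrow> 'j \<Rightarrow> int) \<Rightarrow> ('j \<Rightarrow> nat) \<Rightarrow> ('j uq_gen list \<Rightarrow>\<^sub>0 'k::field poly fract) set"
  for C :: "'j \<Rightarrow> 'j \<Rightarrow> int" and \<epsilon> :: "'j \<Rightarrow> nat" where
  "var (UK i) * var (UKinv i) - 1 \<in> uq_rels C \<epsilon>"
| "var (UKinv i) * var (UK i) - 1 \<in> uq_rels C \<epsilon>"
| "var (UK i) * var (UK j) - var (UK j) * var (UK i) \<in> uq_rels C \<epsilon>"
| "var (UK i) * var (UE j) - scal (qi \<epsilon> i powi C i j) * var (UE j) * var (UK i) \<in> uq_rels C \<epsilon>"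
| "var (UK i) * var (UF j) - scal (qi \<epsilon> i powi (- C i j)) * var (UF j) * var (UK i)
     \<in> uq_rels C \<epsilon>"
| "var (UE i) * var (UF j) - var (UF j) * var (UE i)
     - (if i = j then scal (1 / (qi \<epsilon> i - inverse (qi \<epsilon> i))) * (var (UK i) - var (UKinv i)) else 0)
     \<in> uq_rels C \<epsilon>"
| "i \<noteq> j \<Longrightarrow> qserre (qi \<epsilon> i) (nat (- C i j)) (var (UE i)) (var (UE j)) \<in> uq_rels C \<epsilon>"
| "i \<noteq> j \<Longrightarrow> qserre (qi \<epsilon> i) (nat (- C i j)) (var (UF i)) (var (UF j)) \<in> uq_rels C \<epsilon>"

definition Uq :: "('j \<Rightarrow> 'j \<Rightarrow> int) \<Rightarrow> ('j \<Rightarrow> nat) \<Rightarrow>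
    ('k::field poly fract, ('j uq_gen list \<Rightarrow>\<^sub>0 'k poly fract) set) module" where
  "Uq C \<epsilon> = presented_algebra (uq_rels C \<epsilon>)"

definition uq :: "('j \<Rightarrow> 'j \<Rightarrow> int) \<Rightarrow> ('j \<Rightarrow> nat) \<Rightarrow> 'j uq_gen \<Rightarrow>
    ('j uq_gen list \<Rightarrow>\<^sub>0 'k::field poly fract) set" where
  "uq C \<epsilon> x = gen_class (uq_rels C \<epsilon>) x"

definition Uq_of_gim :: "('i \<Rightarrow> 'i \<Rightarrow> int) \<Rightarrow> ('i \<Rightarrow> nat) \<Rightarrow>
    ('k::field poly fract, (('i + 'i) uq_gen list \<Rightarrow>\<^sub>0 'k poly fract) set) module" where
  "Uq_of_gim A \<epsilon> = Uq (cartan_of_gim A) (case_sum \<epsilon> \<epsilon>)"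

definition uq_of_gim :: "('i \<Rightarrow> 'i \<Rightarrow> int) \<Rightarrow> ('i \<Rightarrow> nat) \<Rightarrow> ('i + 'i) uq_gen \<Rightarrow>
    (('i + 'i) uq_gen list \<Rightarrow>\<^sub>0 'k::field poly fract) set" where
  "uq_of_gim A \<epsilon> x = uq (cartan_of_gim A) (case_sum \<epsilon> \<epsilon>) x"

fun bar :: "'i + 'i \<Rightarrow> 'i + 'i" where
  "bar (Inl i) = Inr i"
| "bar (Inr i) = Inl i"

text \<open>
  \<open>B_j\<close> for \<open>j \<in> I \<squnion> \<bar>I\<close>; the parameter of \<open>\<bar>i\<close> is that of \<open>i\<close>.
\<close>

definition gim_B :: "('i \<Rightarrow> 'i \<Rightarrow> int) \<Rightarrow> ('i \<Rightarrow> nat) \<Rightarrow> ('i \<Rightarrow> 'k::field poly fract) \<Rightarrow> 'i + 'i \<Rightarrow>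
    (('i + 'i) uq_gen list \<Rightarrow>\<^sub>0 'k poly fract) set" where
  "gim_B A \<epsilon> c j =
    uq_of_gim A \<epsilon> (UF j) \<ominus>\<^bsub>Uq_of_gim A \<epsilon>\<^esub>
      (case_sum c c j \<odot>\<^bsub>Uq_of_gim A \<epsilon>\<^esub>
        (uq_of_gim A \<epsilon> (UE (bar j)) \<otimes>\<^bsub>Uq_of_gim A \<epsilon>\<^esub> uq_of_gim A \<epsilon> (UKinv j)))"

text \<open>\<open>K_j K_{\<bar>j}^{-1}\<close>.\<close>

definition gim_L :: "('i \<Rightarrow> 'i \<Rightarrow> int) \<Rightarrow> ('i \<Rightarrow> nat) \<Rightarrow> 'i + 'i \<Rightarrow>
    (('i + 'i) uq_gen list \<Rightarrow>\<^sub>0 'k::field poly fract) set" where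
  "gim_L A \<epsilon> j =
    uq_of_gim A \<epsilon> (UK j) \<otimes>\<^bsub>Uq_of_gim A \<epsilon>\<^esub> uq_of_gim A \<epsilon> (UKinv (bar j))"

definition quantum_gim_algebra ::
    "('i \<Rightarrow> 'i \<Rightarrow> int) \<Rightarrow> ('i \<Rightarrow> nat) \<Rightarrow> ('i \<Rightarrow> 'k::field poly fract) \<Rightarrow>
      ('k poly fract, (('i + 'i) uq_gen list \<Rightarrow>\<^sub>0 'k poly fract) set) module" where
  "quantum_gim_algebra A \<epsilon> c =
    generated_subalgebra (Uq_of_gim A \<epsilon>) (range (gim_B A \<epsilon> c) \<union> range (gim_L A \<epsilon>))"


section \<open>The presented algebra\<close>

datatype 'i gq_gen = GG 'i | GGbar 'i | GL 'i | GLbar 'i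

text \<open>
  The relation that the \<open>L_i\<close> commute is usually left tacit, but it is not a consequence of
  the other relations: those also hold in the algebra generated by free involutions
  \<open>L_i = \<bar>L_i\<close>, with all \<open>G_i\<close> and \<open>\<bar>G_i\<close> sent to 0, where the \<open>L_i\<close> do not commute
  if there are at least two indices.

  In the last four relations \<open>i = j\<close> is allowed, since \<open>a_{ii} = 2 > 0\<close>. The instances obtained
  are consequences of the other relations.
\<close>

inductive_set gq_rels ::
    "('i \<Rightarrow> 'i \<Rightarrow> int) \<Rightarrow> ('i \<Rightarrow> nat) \<Rightarrow> ('i \<Rightarrow> 'k::field poly fract) \<Rightarrow>
      ('i gq_gen list \<Rightarrow>\<^sub>0 'k poly fract) set"
  for A :: "'i \<Rightarrow> 'i \<Rightarrow> int" and \<epsilon> :: "'i \<Rightarrow> nat" and c :: "'i \<Rightarrow> 'k::field poly fract" where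
  "var (GL i) * var (GLbar i) - 1 \<in> gq_rels A \<epsilon> c"
| "var (GLbar i) * var (GL i) - 1 \<in> gq_rels A \<epsilon> c"
| "var (GL i) * var (GL j) - var (GL j) * var (GL i) \<in> gq_rels A \<epsilon> c"
| "var (GL i) * var (GG j) - scal (qi \<epsilon> i powi (- A i j)) * var (GG j) * var (GL i)
     \<in> gq_rels A \<epsilon> c"
| "var (GL i) * var (GGbar j) - scal (qi \<epsilon> i powi A i j) * var (GGbar j) * var (GL i)
     \<in> gq_rels A \<epsilon> c"
| "A i j = 0 \<Longrightarrow> var (GG i) * var (GG j) - var (GG j) * var (GG i) \<in> gq_rels A \<epsilon> c"
| "A i j = 0 \<Longrightarrow> var (GGbar i) * var (GGbar j) - var (GGbar j) * var (GGbar i) \<in> gq_rels A \<epsilon> c"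
| "A i j = 0 \<or> i = j \<Longrightarrow>
     var (GG i) * var (GGbar j) - var (GGbar j) * var (GG i)
     - (if i = j then scal (c i / (qi \<epsilon> i - inverse (qi \<epsilon> i))) * (var (GL i) - var (GLbar i)) else 0)
     \<in> gq_rels A \<epsilon> c"
| "A i j < 0 \<Longrightarrow> qserre (qi \<epsilon> i) (nat (- A i j)) (var (GG i)) (var (GG j)) \<in> gq_rels A \<epsilon> c"
| "A i j < 0 \<Longrightarrow> qserre (qi \<epsilon> i) (nat (- A i j)) (var (GGbar i)) (var (GGbar j)) \<in> gq_rels A \<epsilon> c"
| "A i j < 0 \<Longrightarrow> var (GG i) * var (GGbar j) - var (GGbar j) * var (GG i) \<in> gq_rels A \<epsilon> c"
| "A i j > 0 \<Longrightarrow> qserre (qi \<epsilon> i) (nat (A i j)) (var (GG i)) (var (GGbar j)) \<in> gq_rels A \<epsilon> c"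
| "A i j > 0 \<Longrightarrow> qserre (qi \<epsilon> i) (nat (A i j)) (var (GGbar i)) (var (GG j)) \<in> gq_rels A \<epsilon> c"
| "A i j > 0 \<Longrightarrow> var (GG i) * var (GG j) - var (GG j) * var (GG i) \<in> gq_rels A \<epsilon> c"
| "A i j > 0 \<Longrightarrow> var (GGbar i) * var (GGbar j) - var (GGbar j) * var (GGbar i) \<in> gq_rels A \<epsilon> c"

definition Gq :: "('i \<Rightarrow> 'i \<Rightarrow> int) \<Rightarrow> ('i \<Rightarrow> nat) \<Rightarrow> ('i \<Rightarrow> 'k::field poly fract) \<Rightarrow>
    ('k poly fract, ('i gq_gen list \<Rightarrow>\<^sub>0 'k poly fract) set) module" where
  "Gq A \<epsilon> c = presented_algebra (gq_rels A \<epsilon> c)"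

definition gq :: "('i \<Rightarrow> 'i \<Rightarrow> int) \<Rightarrow> ('i \<Rightarrow> nat) \<Rightarrow> ('i \<Rightarrow> 'k::field poly fract) \<Rightarrow> 'i gq_gen \<Rightarrow>
    ('i gq_gen list \<Rightarrow>\<^sub>0 'k poly fract) set" where
  "gq A \<epsilon> c x = gen_class (gq_rels A \<epsilon> c) x"

end

theory Submission
  imports Defs
begin

text \<open>
  The quantum Serre polynomial \<open>{}_{-k}F(x, y)\<close> is an iterated \<open>q\<close>-commutator of \<open>x\<close> with \<open>y\<close>.
  In \<open>B\<^sub>i = F\<^sub>i - c\<^sub>i E\<^sub>\<iota> K\<^sub>i\<^sup>-\<^sup>1\<close> (\<open>\<iota>\<close> is the partner of \<open>i\<close>) the two summands \<open>q\<close>-commute,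
  and one of them drops out of each of these \<open>q\<close>-commutators, so the Serre relations of the
  \<open>F\<^sub>i\<close> and \<open>E\<^sub>i\<close> give those of the \<open>B\<^sub>i\<close>. This yields the homomorphism.

  For injectivity, filter the presented algebra by the degree in the \<open>G\<^sub>i\<close> and their partners, and
  let \<open>U\<^sub>q\<close> act on the Verma modules with highest weights \<open>\<chi>\<close>. As vector spaces these are the
  algebra generated by the \<open>F\<^sub>j\<close> subject to the Serre relations, because the Serre polynomials of
  the \<open>F\<^sub>j\<close> commute with all \<open>E\<^sub>m\<close>. Since \<open>E\<^sub>m\<close> lowers the degree, the leading term of \<open>B\<close> applied
  to the highest weight vector is the corresponding monomial in the \<open>F\<^sub>j\<close>, and \<open>L\<^sub>i\<close> acts on that vector
  by a character of \<open>\<chi>\<close>. If an element of the presented algebra acts as zero for all \<open>\<chi>\<close>, then by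
  independence of characters its leading coefficients lie in the Serre ideal, hence the
  element already lies in a smaller step of the filtration.
\<close>

section \<open>Algebras, ideals and iterated \<open>q\<close>-commutators\<close>

text \<open>All generators are indexed by I and its copy at once: \<open>G_i\<close> and its partner
  become \<open>b j\<close>, \<open>L_i\<close> and its inverse become \<open>l j\<close>, and the
  sign cases of the relations merge into Serre relations governed by the matrix \<open>C\<close>.
  The \<open>B j\<close> satisfy them as the \<open>F j\<close> do, except for the pair
  \<open>j\<close>, \<open>bar j\<close>: there the commutator is a multiple of
  \<open>l j - l (bar j)\<close> instead of zero. This exception is the obstacle. It keeps
  \<open>F j |-> B j\<close> from defining a homomorphism, so only leading terms can be compared; a
  filtration suffices because the exceptional relation drops from degree 2 to degree 0. The Serre
  polynomial is used in two forms, as a product of q-commutators in \<open>v\<close> and in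
  \<open>1/v\<close>. They agree because quantum binomials are invariant under inversion of
  \<open>v\<close>, and each of the two summands of \<open>B j\<close> drops out of only one of
  them. That U_q is large enough is read off from explicit operators on words, which hold its
  relations modulo the Serre ideal of the \<open>F j\<close>. The scalar multiplication
  \<open>sm\<close> is a parameter so that one calculus serves free algebras and algebras of
  endomorphisms.\<close>

locale assoc_alg =
  fixes sm :: "'f::field \<Rightarrow> 'a::ring_1 \<Rightarrow> 'a"
  assumes sm_add_right: "sm a (x + y) = sm a x + sm a y"
    and sm_add_left: "sm (a + b) x = sm a x + sm b x"
    and sm_sm [simp]: "sm a (sm b x) = sm (a * b) x"
    and sm_one [simp]: "sm 1 x = x"
    and sm_mult_left [simp]: "sm a x * y = sm a (x * y)"
    and sm_mult_right [simp]: "x * sm a y = sm a (x * y)"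
begin

lemma sm_zero_left [simp]: "sm 0 x = 0"
  using sm_add_left[of 0 0 x] by simp

lemma sm_zero_right [simp]: "sm a 0 = 0"
  using sm_add_right[of a 0 0] by simp

lemma sm_minus_left: "sm (- a) x = - sm a x"
  using sm_add_left[of a "- a" x] by (simp add: minus_unique)

lemma sm_minus_right: "sm a (- x) = - sm a x"
  using sm_add_right[of a x "- x"] by (simp add: minus_unique)

lemma sm_diff_right: "sm a (x - y) = sm a x - sm a y"
  using sm_add_right[of a x "- y"] by (simp add: sm_minus_right)

lemma sm_diff_left: "sm (a - b) x = sm a x - sm b x"
  using sm_add_left[of a "- b" x] by (simp add: sm_minus_left)

lemma sm_sum_right: "sm a (\<Sum>i\<in>I. f i) = (\<Sum>i\<in>I. sm a (f i))"
  by (induction I rule: infinite_finite_induct) (auto simp: sm_add_right)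

lemmas sm_distribs = sm_add_right sm_add_left sm_diff_right sm_diff_left sm_minus_left sm_minus_right

text \<open>With X and Y the left and right multiplications by \<open>x\<close>, this is the product
  of the operators X - a v^(2t) Y over t < r, applied to \<open>y\<close>. For
  \<open>a = v^-k\<close> and \<open>r = k + 1\<close> it is the quantum Serre polynomial.\<close>

primrec qcomm :: "'f \<Rightarrow> 'f \<Rightarrow> 'a \<Rightarrow> 'a \<Rightarrow> nat \<Rightarrow> 'a" where
  "qcomm v a x y 0 = y"
| "qcomm v a x y (Suc r) = x * qcomm v a x y r - sm (a * v ^ (2 * r)) (qcomm v a x y r * x)"

lemma qcomm_add: "qcomm v a x (y + z) r = qcomm v a x y r + qcomm v a x z r"
  by (induction r) (simp_all add: algebra_simps sm_distribs)

lemma qcomm_sm: "qcomm v a x (sm s y) r = sm s (qcomm v a x y r)"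
  by (induction r) (simp_all add: algebra_simps sm_distribs)

lemma qcomm_diff: "qcomm v a x (y - z) r = qcomm v a x y r - qcomm v a x z r"
  using qcomm_add[of v a x "y - z" z r] by simp

lemma qcomm_zero [simp]: "qcomm v a x 0 r = 0"
  by (induction r) simp_all

text \<open>Left and right multiplication by \<open>x\<close> commute, so the factors may be applied
  in any order; here the factor with constant \<open>a\<close> acts first. If it kills
  \<open>y\<close>, the whole product vanishes.\<close>

lemma qcomm_Suc_left:
  "qcomm v a x y (Suc r) = qcomm v (a * v ^ 2) x (x * y - sm a (y * x)) r"
  by (induction r) (simp_all add: power_add power2_eq_square power_mult algebra_simps sm_distribs)

lemma qcomm_eq_zero:
  assumes "x * y = sm a (y * x)"
  shows "qcomm v a x y (Suc r) = 0"
  unfolding qcomm_Suc_left using assms by simp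

text \<open>Commutation with \<open>e\<close> is a derivation that kills \<open>f\<close>, so it
  only acts on the inner argument.\<close>

lemma commutator_qcomm:
  assumes "e * f = f * e"
  shows "e * qcomm v a f z r - qcomm v a f z r * e = qcomm v a f (e * z - z * e) r"
proof (induction r)
  case (Suc r)
  let ?q = "qcomm v a f z r" and ?p = "a * v ^ (2 * r)"
  have "e * qcomm v a f z (Suc r) - qcomm v a f z (Suc r) * e =
      f * (e * ?q - ?q * e) - sm ?p ((e * ?q - ?q * e) * f)
      + (e * f - f * e) * ?q + sm ?p (?q * (f * e - e * f))"
    by (simp add: algebra_simps sm_distribs)
  then show ?case using Suc assms by simp
qed simp

lemma commute_qcomm:
  assumes "e * f = f * e" "e * z = z * e"
  shows "e * qcomm v a f z r = qcomm v a f z r * e"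
  using commutator_qcomm[OF assms(1), of v a z r] assms(2) by simp

lemma qcomm_weight:
  assumes "k * f = sm b (f * k)" and "k * z = sm d (z * k)"
  shows "k * qcomm v a f z r = sm (b ^ r * d) (qcomm v a f z r * k)"
proof (induction r)
  case (Suc r)
  let ?q = "qcomm v a f z r"
  have *: "k * (f * ?q) = sm (b ^ Suc r * d) (f * ?q * k)"
  proof -
    have "k * (f * ?q) = sm b (f * (k * ?q))" using assms(1) by (simp flip: mult.assoc)
    then show ?thesis using Suc by (simp add: mult.assoc)
  qed
  have **: "k * (?q * f) = sm (b ^ Suc r * d) (?q * f * k)"
  proof -
    have "k * (?q * f) = sm (b ^ r * d) (?q * (k * f))" using Suc by (simp flip: mult.assoc)
    then show ?thesis using assms(1) by (simp add: mult.assoc mult.commute mult.left_commute)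
  qed
  show ?case using * ** by (simp add: algebra_simps sm_distribs)
qed (use assms in simp)

text \<open>The rank one computation: \<open>e\<close>, \<open>f\<close>, \<open>k\<close>,
  \<open>k'\<close> behave like quantum sl2 and \<open>e\<close> commutes with \<open>z\<close>.
  Each new factor contributes one Cartan term, and all of them are multiples of the same element, so
  only a scalar sum remains. The Serre relation is the case in which this sum is zero.\<close>

lemma commutator_qcomm_Cartan:
  assumes v: "v \<noteq> 0" and a: "a \<noteq> 0"
    and ef: "e * f - f * e = sm h (k - k')"
    and ez: "e * z = z * e"
    and kf: "k * f = sm (inverse v ^ 2) (f * k)" and kf': "k' * f = sm (v ^ 2) (f * k')"
    and kz: "k * z = sm (inverse a) (z * k)" and kz': "k' * z = sm a (z * k')"
  shows "e * qcomm v a f z (Suc r) - qcomm v a f z (Suc r) * e =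
    sm (h * (\<Sum>t\<le>r. inverse (a * v ^ (2 * t)) - a * v ^ (2 * t))) (qcomm v a f z r * k)"
proof -
  define q where "q = qcomm v a f z"
  define p where "p t = a * v ^ (2 * t)" for t
  have p0: "p t \<noteq> 0" for t using a v by (simp add: p_def)
  have q_Suc: "q (Suc r) = f * q r - sm (p r) (q r * f)" for r by (simp add: q_def p_def)
  have kq: "k * q t = sm (inverse (p t)) (q t * k)" for t
    using qcomm_weight[OF kf kz, of v a t]
    by (simp add: q_def p_def power_inverse mult.commute flip: power_mult)
  have kq': "k' * q t = sm (p t) (q t * k')" for t
    using qcomm_weight[OF kf' kz', of v a t]
    by (simp add: q_def p_def mult.commute flip: power_mult)
  have step: "e * q (Suc r) - q (Suc r) * e =
      f * (e * q r - q r * e) - sm (p r) ((e * q r - q r * e) * f)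
      + sm (h * (inverse (p r) - p r)) (q r * k)" for r
  proof -
    have 1: "e * q (Suc r) - q (Suc r) * e =
      f * (e * q r - q r * e) - sm (p r) ((e * q r - q r * e) * f)
      + ((e * f - f * e) * q r - sm (p r) (q r * (e * f - f * e)))"
      by (simp add: q_Suc algebra_simps sm_distribs)
    have 2: "(e * f - f * e) * q r - sm (p r) (q r * (e * f - f * e))
        = sm h (k * q r - k' * q r) - sm (p r * h) (q r * k - q r * k')"
      unfolding ef by (simp add: algebra_simps)
    have 3: "\<dots> = sm (h * (inverse (p r) - p r)) (q r * k)"
      unfolding kq kq' by (simp add: algebra_simps sm_distribs)
    show ?thesis unfolding 1 2 3 ..
  qed
  \<comment> \<open>Moving \<open>k\<close> past \<open>f\<close> costs \<open>v^-2\<close>, which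
    turns the constant \<open>p (Suc r)\<close> of the next q-commutator into \<open>p r\<close>,
    the one that builds \<open>q (Suc r)\<close> from \<open>q r\<close>.\<close>
  have shift: "f * (q r * k) - sm (p (Suc r)) (q r * k * f) = q (Suc r) * k" for r
  proof -
    have "q r * k * f = sm (inverse v ^ 2) (q r * f * k)"
      using kf by (simp add: mult.assoc)
    moreover have "p (Suc r) * inverse v ^ 2 = p r"
      using v by (simp add: p_def field_simps power2_eq_square power_inverse)
    ultimately show ?thesis by (simp add: q_Suc algebra_simps)
  qed
  have "e * q (Suc r) - q (Suc r) * e = sm (h * (\<Sum>t\<le>r. inverse (p t) - p t)) (q r * k)"
  proof (induction r)
    case 0
    have "e * q 0 - q 0 * e = 0" using ez by (simp add: q_def)
    then show ?case using step[of 0] by simp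
  next
    case (Suc r)
    let ?s = "h * (\<Sum>t\<le>r. inverse (p t) - p t)"
    have "e * q (Suc (Suc r)) - q (Suc (Suc r)) * e =
       sm ?s (f * (q r * k) - sm (p (Suc r)) (q r * k * f)) 
       + sm (h * (inverse (p (Suc r)) - p (Suc r))) (q (Suc r) * k)"
      unfolding step[of "Suc r"] Suc by (simp add: sm_distribs mult.assoc mult.left_commute mult.commute)
    also have "\<dots> = sm (?s + h * (inverse (p (Suc r)) - p (Suc r))) (q (Suc r) * k)"
      unfolding shift by (simp add: sm_distribs)
    finally show ?case by (simp add: distrib_left)
  qed
  then show ?thesis by (simp add: q_def p_def)
qed

end

text \<open>A quotient is a record on a carrier set and not a type of class \<open>ring_1\<close>;
  calculations in it are carried out on representatives, up to congruence modulo
  \<open>J\<close>.\<close>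

locale alg_ideal = assoc_alg sm for sm :: "'f::field \<Rightarrow> 'a::ring_1 \<Rightarrow> 'a" +
  fixes J :: "'a set"
  assumes zero_in [simp]: "0 \<in> J"
    and add_in: "x \<in> J \<Longrightarrow> y \<in> J \<Longrightarrow> x + y \<in> J"
    and mult_left_in: "x \<in> J \<Longrightarrow> y * x \<in> J"
    and mult_right_in: "x \<in> J \<Longrightarrow> x * y \<in> J"
begin

lemma sm_in: "x \<in> J \<Longrightarrow> sm a x \<in> J"
  using mult_left_in[of x "sm a 1"] by simp

lemma minus_in: "x \<in> J \<Longrightarrow> - x \<in> J"
  using mult_left_in[of x "-1"] by simp

lemma diff_in: "x \<in> J \<Longrightarrow> y \<in> J \<Longrightarrow> x - y \<in> J"
  using add_in[of x "- y"] minus_in[of y] by simp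

definition eqv :: "'a \<Rightarrow> 'a \<Rightarrow> bool" (infix "\<approx>" 50) where
  "x \<approx> y \<longleftrightarrow> x - y \<in> J"

lemma eqv_refl [simp]: "x \<approx> x"
  by (simp add: eqv_def)

lemma eqv_sym: "x \<approx> y \<Longrightarrow> y \<approx> x"
  using minus_in[of "x - y"] by (simp add: eqv_def)

lemma eqv_trans [trans]: "x \<approx> y \<Longrightarrow> y \<approx> z \<Longrightarrow> x \<approx> z"
  using add_in[of "x - y" "y - z"] by (simp add: eqv_def)

lemma eqv_add: "x \<approx> y \<Longrightarrow> z \<approx> w \<Longrightarrow> x + z \<approx> y + w"
  using add_in[of "x - y" "z - w"] by (simp add: eqv_def algebra_simps)

lemma eqv_diff: "x \<approx> y \<Longrightarrow> z \<approx> w \<Longrightarrow> x - z \<approx> y - w"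
  using diff_in[of "x - y" "z - w"] by (simp add: eqv_def algebra_simps)

lemma eqv_minus: "x \<approx> y \<Longrightarrow> - x \<approx> - y"
  using eqv_diff[of 0 0 x y] by simp

lemma eqv_sm: "x \<approx> y \<Longrightarrow> sm a x \<approx> sm a y"
  using sm_in[of "x - y" a] by (simp add: eqv_def sm_distribs)

lemma eqv_mult: "x \<approx> y \<Longrightarrow> z \<approx> w \<Longrightarrow> x * z \<approx> y * w"
  using add_in[of "(x - y) * z" "y * (z - w)"] mult_left_in[of "z - w" y] mult_right_in[of "x - y" z]
  by (simp add: eqv_def algebra_simps)

lemma eqv_mult_left: "z \<approx> w \<Longrightarrow> x * z \<approx> x * w"
  by (rule eqv_mult) simp_all

lemma eqv_mult_right: "x \<approx> y \<Longrightarrow> x * z \<approx> y * z"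
  by (rule eqv_mult) simp_all

lemma eqv_zero_iff: "x \<approx> 0 \<longleftrightarrow> x \<in> J"
  by (simp add: eqv_def)

lemma in_cong: "x \<approx> y \<Longrightarrow> x \<in> J \<longleftrightarrow> y \<in> J"
  using eqv_sym eqv_trans eqv_zero_iff by blast

text \<open>If \<open>y\<close> \<open>q\<close>-commutes with \<open>x\<close> and \<open>z\<close> with the right factors, then in each of the
  iterated \<open>q\<close>-commutators the contribution of \<open>y\<close> cancels.\<close>

lemma qcomm_absorb:
  assumes yx: "y * x \<approx> sm (v ^ 2) (x * y)" and yz: "y * z \<approx> sm a (z * y)"
  shows "qcomm v a (x + y) z r \<approx> qcomm v a x z r"
    and "y * qcomm v a x z r \<approx> sm (a * v ^ (2 * r)) (qcomm v a x z r * y)"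
proof -
  \<comment> \<open>By induction \<open>y\<close> passes the first \<open>r\<close> q-commutators at
    the price of exactly the constant subtracted in the next one; this is what makes its
    contribution there vanish.\<close>
  have 2: "y * qcomm v a x z r \<approx> sm (a * v ^ (2 * r)) (qcomm v a x z r * y)" for r
  proof (induction r)
    case (Suc r)
    let ?q = "qcomm v a x z r" and ?p = "a * v ^ (2 * r)"
    have "y * x * ?q \<approx> sm (v ^ 2) (x * (y * ?q))"
      using eqv_mult_right[OF yx, of ?q] by (simp add: mult.assoc)
    also have "\<dots> \<approx> sm (v ^ 2) (x * sm ?p (?q * y))"
      by (intro eqv_sm eqv_mult_left Suc)
    finally have A: "y * x * ?q \<approx> sm (?p * v ^ 2) (x * ?q * y)" by (simp add: mult_ac mult.assoc)
    have "y * ?q * x \<approx> sm ?p (?q * (y * x))"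
      using eqv_mult_right[OF Suc, of x] by (simp add: mult.assoc)
    also have "\<dots> \<approx> sm ?p (?q * sm (v ^ 2) (x * y))"
      by (intro eqv_sm eqv_mult_left yx)
    finally have B: "y * ?q * x \<approx> sm (?p * v ^ 2) (?q * x * y)" by (simp add: mult_ac mult.assoc)
    have "y * x * ?q - sm ?p (y * ?q * x) \<approx>
        sm (?p * v ^ 2) (x * ?q * y) - sm ?p (sm (?p * v ^ 2) (?q * x * y))"
      by (intro eqv_diff eqv_sm A B)
    then show ?case
      by (simp add: algebra_simps sm_distribs power2_eq_square power_add)
  qed (use yz in simp)
  show "y * qcomm v a x z r \<approx> sm (a * v ^ (2 * r)) (qcomm v a x z r * y)" by (rule 2)
  show "qcomm v a (x + y) z r \<approx> qcomm v a x z r"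
  proof (induction r)
    case (Suc r)
    let ?q = "qcomm v a x z r" and ?p = "a * v ^ (2 * r)"
    have "qcomm v a (x + y) z (Suc r) \<approx> (x + y) * ?q - sm ?p (?q * (x + y))"
      unfolding qcomm.simps by (intro eqv_diff eqv_sm eqv_mult_left eqv_mult_right Suc)
    also have "\<dots> = (x * ?q - sm ?p (?q * x)) + (y * ?q - sm ?p (?q * y))"
      by (simp add: algebra_simps sm_distribs)
    also have "\<dots> \<approx> (x * ?q - sm ?p (?q * x)) + (sm ?p (?q * y) - sm ?p (?q * y))"
      by (intro eqv_add eqv_diff 2) simp_all
    finally show ?case by simp
  qed simp
qed

text \<open>All Cartan elements can be collected on the right. Moving \<open>k\<close> past
  \<open>z\<close> and \<open>k'\<close> past \<open>e\<close> costs the same scalar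
  \<open>b\<close>, so every monomial of the q-commutator picks up the same total factor. Its value
  is irrelevant for membership in \<open>J\<close>, hence the existential form.\<close>

lemma qcomm_twist:
  assumes ke: "k * e \<approx> e * k" and k'e: "k' * e \<approx> sm b (e * k')"
    and kz: "k * z \<approx> sm b (z * k)" and kk': "k' * k \<approx> k * k'"
  shows "\<exists>g. qcomm v a (sm s (e * k)) (sm s' (z * k')) r \<approx> sm g (qcomm v a e z r * (k ^ r * k'))"
proof -
  let ?q = "qcomm v a e z"
  have kq: "k * ?q r \<approx> sm b (?q r * k)" for r
  proof (induction r)
    case (Suc r)
    have "k * e * ?q r \<approx> e * k * ?q r" by (intro eqv_mult_right ke)
    also have "e * k * ?q r \<approx> e * sm b (?q r * k)" using eqv_mult_left[OF Suc, of e] by (simp add: mult.assoc)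
    finally have A: "k * e * ?q r \<approx> sm b (e * ?q r * k)" by (simp add: mult.assoc)
    have "k * ?q r * e \<approx> sm b (?q r * k) * e" by (intro eqv_mult_right Suc)
    also have "\<dots> \<approx> sm b (?q r * e * k)"
      using eqv_sm[OF eqv_mult_left[OF ke, of "?q r"], of b] by (simp add: mult.assoc)
    finally have B: "k * ?q r * e \<approx> sm b (?q r * e * k)" .
    have "k * e * ?q r - sm (a * v ^ (2 * r)) (k * ?q r * e)
        \<approx> sm b (e * ?q r * k) - sm (a * v ^ (2 * r)) (sm b (?q r * e * k))"
      by (intro eqv_diff eqv_sm A B)
    then show ?case by (simp add: algebra_simps sm_distribs)
  qed (use kz in simp)
  have kpow: "k ^ r * e \<approx> e * k ^ r" for r
  proof (induction r)
    case (Suc r)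
    have "k * (k ^ r * e) \<approx> k * (e * k ^ r)" by (intro eqv_mult_left Suc)
    also have "\<dots> \<approx> e * k * k ^ r" using eqv_mult_right[OF ke, of "k ^ r"] by (simp add: mult.assoc)
    finally show ?case by (simp add: mult.assoc)
  qed simp
  have Ke: "k ^ r * k' * e * k \<approx> sm b (e * (k ^ Suc r * k'))" for r
  proof -
    have "k ^ r * (k' * e) * k \<approx> k ^ r * sm b (e * k') * k"
      by (intro eqv_mult_left eqv_mult_right k'e)
    also have "\<dots> = sm b (k ^ r * e * (k' * k))" by (simp add: mult.assoc)
    also have "\<dots> \<approx> sm b (e * k ^ r * (k * k'))" by (intro eqv_sm eqv_mult kpow kk')
    also have "\<dots> = sm b (e * (k ^ Suc r * k'))"
      by (simp only: power_Suc2 mult.assoc)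
    finally show ?thesis by (simp only: mult.assoc)
  qed
  show ?thesis
  proof (induction r)
    case 0
    show ?case by (rule exI[of _ s']) simp
  next
    case (Suc r)
    let ?x = "sm s (e * k)" and ?p = "a * v ^ (2 * r)"
    let ?K = "k ^ r * k'" and ?K' = "k ^ Suc r * k'"
    from Suc obtain g where g: "qcomm v a ?x (sm s' (z * k')) r \<approx> sm g (?q r * ?K)" by blast
    have A: "?x * qcomm v a ?x (sm s' (z * k')) r \<approx> sm (s * g * b) (e * ?q r * ?K')"
    proof -
      have "?x * qcomm v a ?x (sm s' (z * k')) r \<approx> ?x * sm g (?q r * ?K)"
        by (intro eqv_mult_left g)
      also have "\<dots> = sm (s * g) (e * (k * ?q r) * ?K)" by (simp add: mult.assoc mult.commute)
      also have "\<dots> \<approx> sm (s * g) (e * sm b (?q r * k) * ?K)"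
        by (intro eqv_sm eqv_mult_left eqv_mult_right kq)
      finally show ?thesis by (simp add: mult.assoc)
    qed
    have B: "qcomm v a ?x (sm s' (z * k')) r * ?x \<approx> sm (s * g * b) (?q r * e * ?K')"
    proof -
      have "qcomm v a ?x (sm s' (z * k')) r * ?x \<approx> sm g (?q r * ?K) * ?x"
        by (intro eqv_mult_right g)
      also have "\<dots> = sm (s * g) (?q r * (?K * e * k))" by (simp add: mult.assoc mult.commute)
      also have "\<dots> \<approx> sm (s * g) (?q r * sm b (e * ?K'))"
        by (intro eqv_sm eqv_mult_left Ke)
      finally show ?thesis by (simp add: mult.assoc)
    qed
    have "qcomm v a ?x (sm s' (z * k')) (Suc r)
        \<approx> sm (s * g * b) (e * ?q r * ?K') - sm ?p (sm (s * g * b) (?q r * e * ?K'))"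
      unfolding qcomm.simps by (intro eqv_diff eqv_sm A B)
    also have "\<dots> = sm (s * g * b) (?q (Suc r) * ?K')"
      by (simp add: algebra_simps sm_distribs del: power_Suc)
    finally show ?case by blast
  qed
qed

end

section \<open>Free algebras\<close>

definition fsm :: "'f \<Rightarrow> ('x list \<Rightarrow>\<^sub>0 'f::field) \<Rightarrow> ('x list \<Rightarrow>\<^sub>0 'f)" where
  "fsm a x = scal a * x"

abbreviation word :: "'x list \<Rightarrow> ('x list \<Rightarrow>\<^sub>0 'f::field)" where
  "word w \<equiv> Poly_Mapping.single w 1"

lemma update_eq_add_single:
  "Poly_Mapping.lookup p w = 0 \<Longrightarrow> Poly_Mapping.update w a p = p + Poly_Mapping.single w a"
  by (rule poly_mapping_eqI) (auto simp: lookup_update lookup_add lookup_single when_def)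

lemma scal_commute: "scal a * x = x * scal a"
proof (induction x rule: update_induct)
  case (update p w b)
  then show ?case
    by (simp add: update_eq_add_single in_keys_iff distrib_left distrib_right scal_def mult_single mult.commute)
qed simp

lemma lookup_fsm [simp]: "Poly_Mapping.lookup (fsm a p) w = a * Poly_Mapping.lookup p w"
  by (simp add: fsm_def scal_def mult_map_scale_conv_mult[symmetric] map.rep_eq when_def)

global_interpretation free: assoc_alg fsm
proof
  fix a b :: "'f::field" and x y :: "'x list \<Rightarrow>\<^sub>0 'f"
  show "x * fsm a y = fsm a (x * y)"
    by (simp add: fsm_def scal_commute[of a] mult.assoc[symmetric])
       (simp add: scal_commute mult.assoc)
qed (simp_all add: fsm_def scal_def distrib_left distrib_right single_add mult.assoc[symmetric] mult_single)

lemma fsm_single: "fsm a (Poly_Mapping.single w b) = Poly_Mapping.single w (a * b)"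
  by (simp add: fsm_def scal_def mult_single)

lemma word_mult: "word u * word w = (word (u @ w) :: 'x list \<Rightarrow>\<^sub>0 'f::field)"
  by (simp add: mult_single plus_list_def)

lemma word_Nil: "word [] = (1 :: 'x list \<Rightarrow>\<^sub>0 'f::field)"
  by (simp flip: zero_list_def)

lemma word_Cons: "word (x # w) = (var x * word w :: 'x list \<Rightarrow>\<^sub>0 'f::field)"
  by (simp add: var_def word_mult)

lemma scal_eq_fsm: "scal a = fsm a 1"
  by (simp add: fsm_def)

lemma free_algebra_induct [case_names word add fsm]:
  fixes p :: "'x list \<Rightarrow>\<^sub>0 'f::field"
  assumes "\<And>w. P (word w)" and "\<And>x y. P x \<Longrightarrow> P y \<Longrightarrow> P (x + y)" and "\<And>a x. P x \<Longrightarrow> P (fsm a x)"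
  shows "P p"
proof (induction p rule: update_induct)
  case const
  show ?case using assms(3)[OF assms(1)[of "[]"], of 0] by simp
next
  case (update p w a)
  have "Poly_Mapping.update w a p = p + fsm a (word w)"
    using update(1) by (simp add: update_eq_add_single fsm_single in_keys_iff)
  then show ?case using assms update by simp
qed

context assoc_alg
begin

definition lin :: "('b \<Rightarrow> 'a) \<Rightarrow> ('b \<Rightarrow>\<^sub>0 'f) \<Rightarrow> 'a" where
  "lin g p = (\<Sum>w\<in>Poly_Mapping.keys p. sm (Poly_Mapping.lookup p w) (g w))"

lemma lin_superset:
  assumes "finite S" "Poly_Mapping.keys p \<subseteq> S"
  shows "lin g p = (\<Sum>w\<in>S. sm (Poly_Mapping.lookup p w) (g w))"
  unfolding lin_def by (rule sum.mono_neutral_left) (use assms in \<open>auto simp: in_keys_iff\<close>)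

lemma lin_add: "lin g (p + q) = lin g p + lin g q"
  using keys_add[of p q]
  by (simp add: lin_superset[where S = "Poly_Mapping.keys p \<union> Poly_Mapping.keys q"] lookup_add
      sm_add_left sum.distrib)

lemma lin_zero [simp]: "lin g 0 = 0"
  by (simp add: lin_def)

lemma lin_single [simp]: "lin g (Poly_Mapping.single w a) = sm a (g w)"
  by (simp add: lin_superset[where S = "{w}"])

lemma lin_fsm: "lin g (fsm a p) = sm a (lin g p)"
  by (simp add: lin_superset[where S = "Poly_Mapping.keys p"] subset_iff in_keys_iff sm_sum_right)

lemma lin_minus: "lin g (- p) = - lin g p"
  using lin_add[of g p "- p"] by (simp add: minus_unique)

lemma lin_diff: "lin g (p - q) = lin g p - lin g q"
  using lin_add[of g p "- q"] by (simp add: lin_minus)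

lemma lin_sum: "lin g (\<Sum>i\<in>I. f i) = (\<Sum>i\<in>I. lin g (f i))"
  by (induction I rule: infinite_finite_induct) (auto simp: lin_add)

definition lift :: "('x \<Rightarrow> 'a) \<Rightarrow> ('x list \<Rightarrow>\<^sub>0 'f) \<Rightarrow> 'a" where
  "lift f = lin (\<lambda>w. prod_list (List.map f w))"

lemma lift_add: "lift f (p + q) = lift f p + lift f q"
  and lift_diff: "lift f (p - q) = lift f p - lift f q"
  and lift_minus: "lift f (- p) = - lift f p"
  and lift_fsm: "lift f (fsm a p) = sm a (lift f p)"
  and lift_sum: "lift f (\<Sum>i\<in>I. h i) = (\<Sum>i\<in>I. lift f (h i))"
  and lift_zero [simp]: "lift f 0 = 0"
  by (simp_all add: lift_def lin_add lin_diff lin_minus lin_fsm lin_sum)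

lemma lift_word: "lift f (word w) = prod_list (List.map f w)"
  by (simp add: lift_def)

lemma lift_var [simp]: "lift f (var x) = f x"
  by (simp add: lift_def var_def)

lemma lift_one [simp]: "lift f 1 = 1"
  using lift_word[of f "[]"] by (simp add: word_Nil)

lemma lift_mult: "lift f (p * q) = lift f p * lift f q"
proof (induction p rule: free_algebra_induct)
  case (word u)
  show ?case
    by (induction q rule: free_algebra_induct)
      (simp_all add: word_mult lift_word lift_add lift_fsm distrib_left)
qed (simp_all add: lift_add lift_fsm distrib_right)

lemma lift_scal: "lift f (scal a) = sm a 1"
  by (simp add: scal_eq_fsm lift_fsm)

lemma lift_qcomm: "lift f (free.qcomm v a x y r) = qcomm v a (lift f x) (lift f y) r"
  by (induction r) (simp_all add: lift_mult lift_diff lift_fsm)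

lemmas lift_simps = lift_add lift_diff lift_minus lift_fsm lift_mult lift_scal

end

section \<open>Quantum Serre polynomials as iterated \<open>q\<close>-commutators\<close>

lemma qint_inverse: "qint (inverse v) m = qint v m"
proof -
  have "qint (inverse v) m = (- (v ^ m - inverse v ^ m)) / (- (v - inverse v))"
    by (simp add: qint_def)
  then show ?thesis by (simp add: qint_def del: minus_diff_eq)
qed

lemma qserre_inverse: "qserre (inverse v) k x y = qserre v k x y"
  by (simp add: qserre_def qbinom_def qfact_def qint_inverse)

text \<open>\<open>v\<close> is not a root of unity, so all positive quantum integers are invertible
  and quantum binomials may be computed as quotients of factorials.\<close>

locale generic_parameter =
  fixes v :: "'f::field"
  assumes v_nonzero [simp]: "v \<noteq> 0"
    and v_power: "n > 0 \<Longrightarrow> v ^ n \<noteq> 1"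
begin

lemma v_minus_inverse: "v - inverse v \<noteq> 0"
  using v_power[of 2] by (simp add: field_simps power2_eq_square)

lemma qint_nonzero: "m > 0 \<Longrightarrow> qint v m \<noteq> 0"
  using v_power[of "m + m"] v_minus_inverse 
  by (simp add: qint_def power_inverse field_simps power_add)

lemma qfact_nonzero: "qfact v m \<noteq> 0"
  by (simp add: qfact_def qint_nonzero)

lemma qfact_Suc: "qfact v (Suc m) = qfact v m * qint v (Suc m)"
  by (simp add: qfact_def)

lemma qbinom_zero: "qbinom v m 0 = 1" and qbinom_self: "qbinom v m m = 1"
  using qfact_nonzero by (simp_all add: qbinom_def) (simp_all add: qfact_def)

text \<open>A q-Pascal rule, multiplied by a power of \<open>v\<close> so that no inverse powers
  occur. It comes from splitting \<open>v^(n+1) [r+1]\<close> as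
  \<open>[r-n] + v^(r+1) [n+1]\<close>.\<close>

lemma qbinom_Suc_Suc:
  assumes "n < r"
  shows "v ^ Suc n * qbinom v (Suc r) (Suc n) = qbinom v r (Suc n) + v ^ Suc r * qbinom v r n"
proof -
  from assms obtain d where r: "r = Suc (n + d)" using less_iff_Suc_add by auto
  have *: "v ^ Suc n * qint v (Suc r) = qint v (Suc d) + v ^ Suc r * qint v (Suc n)"
  proof -
    have "v ^ Suc n * (v ^ Suc r - inverse v ^ Suc r) =
        (v ^ Suc d - inverse v ^ Suc d) + v ^ Suc r * (v ^ Suc n - inverse v ^ Suc n)"
      by (simp add: r field_simps power_add power_inverse)
    then show ?thesis unfolding qint_def by (simp only: times_divide_eq_right add_divide_distrib[symmetric])
  qed
  have "v ^ Suc n * qbinom v (Suc r) (Suc n) =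
      qfact v r * (v ^ Suc n * qint v (Suc r)) / (qfact v (Suc n) * qfact v (Suc d))"
    by (simp add: qbinom_def r qfact_Suc[of "Suc (n + d)"] mult_ac)
  also have "\<dots> = qfact v r * qint v (Suc d) / (qfact v (Suc n) * qfact v (Suc d))
       + v ^ Suc r * (qfact v r * qint v (Suc n) / (qfact v (Suc n) * qfact v (Suc d)))"
    unfolding * by (simp add: distrib_left add_divide_distrib mult_ac)
  also have "qfact v r * qint v (Suc d) / (qfact v (Suc n) * qfact v (Suc d)) = qbinom v r (Suc n)"
    using qint_nonzero[of "Suc d"] by (simp add: qbinom_def r qfact_Suc[of d])
  also have "qfact v r * qint v (Suc n) / (qfact v (Suc n) * qfact v (Suc d)) = qbinom v r n"
    using qint_nonzero[of "Suc n"] by (simp add: qbinom_def r qfact_Suc[of n] Suc_diff_le)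
  finally show ?thesis .
qed

text \<open>The coefficients of the q-binomial theorem for the product of X - a v^(2t) Y over t < r.
  The case distinction matters: \<open>qbinom\<close> uses truncated subtraction and does not vanish
  for \<open>n > r\<close>.\<close>

definition qcoeff :: "'f \<Rightarrow> nat \<Rightarrow> nat \<Rightarrow> 'f" where
  "qcoeff a r n = (if n \<le> r then (- a) ^ n * v ^ (n * (r - 1)) * qbinom v r n else 0)"

lemma qcoeff_Suc: "qcoeff a (Suc r) (Suc n) = qcoeff a r (Suc n) - a * v ^ (2 * r) * qcoeff a r n"
proof -
  consider "n < r" | "n = r" | "n > r" by linarith
  then show ?thesis
  proof cases
    case 1
    then obtain s where s: "r = Suc s" using less_iff_Suc_add by auto
    have "qcoeff a (Suc r) (Suc n) = (- a) ^ Suc n * v ^ (Suc n * s) * (v ^ Suc n * qbinom v (Suc r) (Suc n))"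
      using 1 by (simp add: qcoeff_def s power_add mult_ac)
    also have "\<dots> = (- a) ^ Suc n * v ^ (Suc n * s) * qbinom v r (Suc n)
        - a * ((- a) ^ n * v ^ (Suc n * s + Suc r) * qbinom v r n)"
      unfolding qbinom_Suc_Suc[OF 1] by (simp add: algebra_simps power_add)
    also have "Suc n * s + Suc r = 2 * r + n * s" by (simp add: s)
    finally show ?thesis using 1 by (simp add: qcoeff_def s power_add mult_ac)
  next
    case 2
    have "Suc r * r = 2 * r + r * (r - 1)" by (cases r) simp_all
    then have "v ^ (Suc r * r) = v ^ (2 * r) * v ^ (r * (r - 1))" by (simp only: power_add)
    with 2 show ?thesis by (simp add: qcoeff_def qbinom_self)
  qed (simp add: qcoeff_def)
qed

lemma qcomm_eq_sum:
  assumes "assoc_alg sm"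
  shows "assoc_alg.qcomm sm v a x y r = (\<Sum>n\<le>r. sm (qcoeff a r n) (x ^ (r - n) * y * x ^ n))"
proof -
  interpret assoc_alg sm by fact
  show ?thesis
  proof (induction r)
    case 0
    show ?case by (simp add: qcoeff_def qbinom_zero)
  next
    case (Suc r)
    let ?t = "\<lambda>n. x ^ (Suc r - n) * y * x ^ n"
    have 1: "x * (\<Sum>n\<le>r. sm (qcoeff a r n) (x ^ (r - n) * y * x ^ n)) = (\<Sum>n\<le>Suc r. sm (qcoeff a r n) (?t n))"
    proof -
      have "qcoeff a r (Suc r) = 0" by (simp add: qcoeff_def)
      then show ?thesis by (auto simp: sum_distrib_left mult.assoc Suc_diff_le intro!: sum.cong)
    qed
    have 2: "(\<Sum>n\<le>r. sm (qcoeff a r n) (x ^ (r - n) * y * x ^ n)) * x = (\<Sum>n\<le>r. sm (qcoeff a r n) (?t (Suc n)))"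
      by (simp add: sum_distrib_right mult.assoc power_commutes)
    have "qcoeff a (Suc r) 0 = qcoeff a r 0" by (simp add: qcoeff_def qbinom_zero)
    then show ?case
      unfolding qcomm.simps Suc 1 2
      by (simp add: sum.atMost_Suc_shift qcoeff_Suc sm_distribs sum_subtractf sm_sum_right del: sum.atMost_Suc)
  qed
qed

text \<open>For \<open>a = v^-k\<close> and \<open>r = k + 1\<close> the factor
  \<open>(-a)^n v^(n(r-1))\<close> of the q-binomial theorem reduces to
  \<open>(-1)^n\<close>.\<close>

lemma qserre_eq_qcomm:
  fixes x y :: "'x list \<Rightarrow>\<^sub>0 'f"
  shows "qserre v k x y = free.qcomm v (inverse v ^ k) x y (Suc k)"
proof -
  have "qcoeff (inverse v ^ k) (Suc k) n = (-1) ^ n * qbinom v (Suc k) n" if "n \<le> Suc k" for n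
  proof -
    have "(- (inverse v ^ k)) ^ n * v ^ (n * k) = (-1) ^ n"
      by (subst power_minus) (simp add: power_mult[symmetric] mult.commute[of n] power_inverse)
    then show ?thesis using that by (simp add: qcoeff_def)
  qed
  moreover have "(-1) ^ n * scal b = (fsm ((-1) ^ n * b) 1 :: 'x list \<Rightarrow>\<^sub>0 'f)" for n b
    by (induction n) (simp_all add: scal_eq_fsm free.sm_distribs)
  ultimately show ?thesis
    unfolding qcomm_eq_sum[OF free.assoc_alg_axioms] qserre_def
    by (intro sum.cong) (auto simp: atLeast0AtMost simp flip: mult.assoc)
qed

lemma generic_inverse: "generic_parameter (inverse v)"
  by unfold_locales (use v_power in \<open>auto simp: power_inverse\<close>)

lemma qserre_eq_qcomm':
  fixes x y :: "'x list \<Rightarrow>\<^sub>0 'f"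
  shows "qserre v k x y = free.qcomm (inverse v) (v ^ k) x y (Suc k)"
  using generic_parameter.qserre_eq_qcomm[OF generic_inverse, of k x y] by (simp add: qserre_inverse)

text \<open>Both sides are evaluations of one Serre polynomial. The identity lives in the free
  algebra on two letters, here the two truth values, and is carried to any algebra by
  evaluation.\<close>

lemma qcomm_symmetric:
  assumes "assoc_alg sm"
  shows "assoc_alg.qcomm sm v (inverse v ^ k) x y (Suc k) = assoc_alg.qcomm sm (inverse v) (v ^ k) x y (Suc k)"
proof -
  interpret assoc_alg sm by fact
  let ?x = "var True" and ?y = "var False"
  let ?f = "\<lambda>b. if b then x else y"
  have *: "lift ?f (qserre v k ?x ?y) = qcomm v (inverse v ^ k) x y (Suc k)"
    unfolding qserre_eq_qcomm lift_qcomm by (simp only: lift_var if_True if_False)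
  have "lift ?f (qserre v k ?x ?y) = qcomm (inverse v) (v ^ k) x y (Suc k)"
    unfolding qserre_eq_qcomm' lift_qcomm by (simp only: lift_var if_True if_False)
  with * show ?thesis by (rule trans[OF sym])
qed

end

section \<open>Presented algebras\<close>

lemma free_algebra_simps [simp]:
  "carrier free_algebra = UNIV" "monoid.mult free_algebra = (*)" "monoid.one free_algebra = 1"
  "ring.zero free_algebra = 0" "ring.add free_algebra = (+)" "module.smult free_algebra = fsm"
  by (simp_all add: free_algebra_def fsm_def fun_eq_iff)

lemma ring_free_algebra: "ring (free_algebra :: ('f::field, 'x list \<Rightarrow>\<^sub>0 'f) module)"
  by (rule ringI)
    (auto intro!: abelian_groupI monoid.intro simp: algebra_simps exI[of _ "- x" for x])

interpretation free_algebra: ring "free_algebra :: ('f::field, 'x list \<Rightarrow>\<^sub>0 'f) module"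
  by (rule ring_free_algebra)

text \<open>The bridge between ideals of the record structure, in which generated ideals and
  quotients are formed, and \<open>alg_ideal\<close>, which provides the congruence
  calculus.\<close>

lemma ideal_free_algebra_iff:
  "ideal J (free_algebra :: ('f::field, 'x list \<Rightarrow>\<^sub>0 'f) module) \<longleftrightarrow> alg_ideal fsm J"
proof
  assume "ideal J (free_algebra :: ('f, 'x list \<Rightarrow>\<^sub>0 'f) module)"
  then interpret ideal J "free_algebra :: ('f, 'x list \<Rightarrow>\<^sub>0 'f) module" .
  show "alg_ideal fsm J"
    by unfold_locales (use a_closed zero_closed I_l_closed I_r_closed in auto)
next
  assume "alg_ideal fsm J"
  then interpret alg_ideal fsm J .
  have inv: "inv\<^bsub>add_monoid free_algebra\<^esub> x = - x" for x :: "'x list \<Rightarrow>\<^sub>0 'f"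
    using free_algebra.minus_equality[of "- x" x] by (simp add: a_inv_def)
  have "subgroup J (add_monoid (free_algebra :: ('f, 'x list \<Rightarrow>\<^sub>0 'f) module))"
    by (rule subgroup.intro) (simp_all only: inv minus_in, simp_all add: add_in)
  then show "ideal J (free_algebra :: ('f, 'x list \<Rightarrow>\<^sub>0 'f) module)"
    by (rule idealI[OF ring_free_algebra]) (simp_all add: mult_left_in mult_right_in)
qed

lemma alg_ideal_genideal: "alg_ideal fsm (Idl\<^bsub>free_algebra\<^esub> R)"
  using free_algebra.genideal_ideal[of R] by (simp add: ideal_free_algebra_iff)

lemma genideal_least: "alg_ideal fsm I \<Longrightarrow> R \<subseteq> I \<Longrightarrow> Idl\<^bsub>free_algebra\<^esub> R \<subseteq> I"
  using free_algebra.genideal_minimal[of I R] by (simp add: ideal_free_algebra_iff)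

lemma genideal_superset: "R \<subseteq> Idl\<^bsub>free_algebra\<^esub> R"
  using free_algebra.genideal_self[of R] by simp

definition coset :: "('x list \<Rightarrow>\<^sub>0 'f::field) set \<Rightarrow> ('x list \<Rightarrow>\<^sub>0 'f) \<Rightarrow> ('x list \<Rightarrow>\<^sub>0 'f) set" where
  "coset J x = J +>\<^bsub>free_algebra\<^esub> x"

locale free_ideal = alg_ideal fsm J for J :: "('x list \<Rightarrow>\<^sub>0 'f::field) set"
begin

sublocale ideal J free_algebra
  by (simp add: ideal_free_algebra_iff alg_ideal_axioms)

abbreviation "Q \<equiv> quotient_algebra free_algebra J"

lemma mem_coset_iff: "y \<in> coset J x \<longleftrightarrow> y \<approx> x"
  by (auto simp: coset_def a_r_coset_defs eqv_def) (metis diff_add_cancel)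

lemma coset_eq_iff: "coset J x = coset J y \<longleftrightarrow> x \<approx> y"
  using mem_coset_iff eqv_sym eqv_trans eqv_refl by (metis subsetI subset_antisym)

lemma Q_carrier: "carrier Q = range (coset J)"
  by (auto simp: quotient_algebra_def ring.defs FactRing_def A_RCOSETS_defs coset_def a_r_coset_def)

lemma Q_mult [simp]: "coset J x \<otimes>\<^bsub>Q\<^esub> coset J y = coset J (x * y)"
  by (simp add: quotient_algebra_def ring.defs FactRing_def coset_def rcoset_mult_add)

lemma Q_add [simp]: "coset J x \<oplus>\<^bsub>Q\<^esub> coset J y = coset J (x + y)"
  by (simp add: quotient_algebra_def ring.defs FactRing_def coset_def a_rcos_sum)

lemma Q_one: "\<one>\<^bsub>Q\<^esub> = coset J 1"
  by (simp add: quotient_algebra_def ring.defs FactRing_def coset_def)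

lemma Q_zero: "\<zero>\<^bsub>Q\<^esub> = coset J 0"
proof -
  have "coset J 0 = J" by (auto simp: mem_coset_iff eqv_def)
  then show ?thesis by (simp add: quotient_algebra_def ring.defs FactRing_def)
qed

lemma Q_smult [simp]: "a \<odot>\<^bsub>Q\<^esub> coset J x = coset J (fsm a x)"
proof -
  \<comment> \<open>The union in the scalar multiplication of the quotient runs over all
    representatives; they all give the same coset.\<close>
  have "coset J (fsm a y) = coset J (fsm a x)" if "y \<in> coset J x" for y
    using that by (simp add: mem_coset_iff coset_eq_iff eqv_sm)
  moreover have "x \<in> coset J x" by (simp add: mem_coset_iff)
  ultimately have "(\<Union>y\<in>coset J x. coset J (fsm a y)) = coset J (fsm a x)" by blast
  then show ?thesis by (simp add: quotient_algebra_def ring.defs module.defs coset_def)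
qed

lemma ring_Q: "ring Q"
proof (rule ringI)
  have "\<exists>y. coset J (y + x) = coset J 0" for x
    by (rule exI[of _ "- x"]) simp
  then show "abelian_group Q"
    by (intro abelian_groupI) (auto simp: Q_carrier Q_zero add_ac)
  show "Group.monoid Q"
    by (rule Group.monoid.intro) (auto simp: Q_carrier Q_one algebra_simps)
qed (auto simp: Q_carrier algebra_simps)

lemma Q_minus [simp]: "coset J x \<ominus>\<^bsub>Q\<^esub> coset J y = coset J (x - y)"
proof -
  interpret Q: ring Q by (rule ring_Q)
  have "coset J (- y) \<oplus>\<^bsub>Q\<^esub> coset J y = \<zero>\<^bsub>Q\<^esub>" by (simp add: Q_zero)
  then have "\<ominus>\<^bsub>Q\<^esub> coset J y = coset J (- y)"
    by (intro Q.minus_equality) (auto simp: Q_carrier)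
  then show ?thesis by (simp add: a_minus_def)
qed

end

section \<open>Homomorphisms out of presented algebras, and generated subalgebras\<close>

context free_ideal
begin

lemma Q_hom_eqI:
  assumes h: "h \<in> ring_hom Q N" "h' \<in> ring_hom Q N"
    and sm: "\<And>a x. x \<in> carrier Q \<Longrightarrow> h (a \<odot>\<^bsub>Q\<^esub> x) = a \<odot>\<^bsub>N\<^esub> h x"
      "\<And>a x. x \<in> carrier Q \<Longrightarrow> h' (a \<odot>\<^bsub>Q\<^esub> x) = a \<odot>\<^bsub>N\<^esub> h' x"
    and gen: "\<And>x. h (coset J (var x)) = h' (coset J (var x))"
    and X: "X \<in> carrier Q"
  shows "h X = h' X"
proof -
  have carr: "coset J p \<in> carrier Q" for p by (simp add: Q_carrier)
  have mult: "h (coset J (p * q)) = h (coset J p) \<otimes>\<^bsub>N\<^esub> h (coset J q)"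
    "h' (coset J (p * q)) = h' (coset J p) \<otimes>\<^bsub>N\<^esub> h' (coset J q)" for p q
    using ring_hom_mult[OF h(1), OF carr carr] ring_hom_mult[OF h(2), OF carr carr] by simp_all
  have add: "h (coset J (p + q)) = h (coset J p) \<oplus>\<^bsub>N\<^esub> h (coset J q)"
    "h' (coset J (p + q)) = h' (coset J p) \<oplus>\<^bsub>N\<^esub> h' (coset J q)" for p q
    using ring_hom_add[OF h(1), OF carr carr] ring_hom_add[OF h(2), OF carr carr] by simp_all
  have "h (coset J p) = h' (coset J p)" for p
  proof (induction p rule: free_algebra_induct)
    case (word w)
    show ?case
    proof (induction w)
      case Nil
      show ?case using ring_hom_one[OF h(1)] ring_hom_one[OF h(2)] by (simp add: word_Nil Q_one)
    qed (simp add: word_Cons mult gen)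
  next
    case (fsm a x)
    then show ?case using sm[OF carr, of a x] by simp
  qed (simp add: add)
  with X show ?thesis by (auto simp: Q_carrier)
qed

text \<open>The image of the evaluation homomorphism is itself a subalgebra, and every subalgebra
  containing the generators contains it, so the intersection is attained.\<close>

lemma carrier_generated_subalgebra:
  fixes g :: "'y \<Rightarrow> 'x list \<Rightarrow>\<^sub>0 'f"
  shows "carrier (generated_subalgebra Q (range (\<lambda>y. coset J (g y)))) = range (\<lambda>p. coset J (free.lift g p))"
    (is "_ = ?S")
proof -
  interpret Q: ring Q by (rule ring_Q)
  have "is_subalgebra Q ?S"
    unfolding is_subalgebra_def
  proof (intro conjI allI ballI)
    show "subring ?S Q"
    proof (rule Q.subringI)
      show "\<one>\<^bsub>Q\<^esub> \<in> ?S" unfolding Q_one using free.lift_one by (metis rangeI)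
    next
      fix X assume "X \<in> ?S"
      then obtain p where X: "X = coset J (free.lift g p)" by blast
      have "\<ominus>\<^bsub>Q\<^esub> X = coset J (free.lift g (- p))"
        by (intro Q.minus_equality) (auto simp: X Q_carrier Q_zero free.lift_simps)
      then show "\<ominus>\<^bsub>Q\<^esub> X \<in> ?S" by blast
    next
      fix X Y assume "X \<in> ?S" "Y \<in> ?S"
      then obtain p q where X: "X = coset J (free.lift g p)" "Y = coset J (free.lift g q)" by blast
      have "X \<otimes>\<^bsub>Q\<^esub> Y = coset J (free.lift g (p * q))" "X \<oplus>\<^bsub>Q\<^esub> Y = coset J (free.lift g (p + q))"
        by (simp_all add: X free.lift_simps)
      then show "X \<otimes>\<^bsub>Q\<^esub> Y \<in> ?S" "X \<oplus>\<^bsub>Q\<^esub> Y \<in> ?S" by blast+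
    qed (auto simp: Q_carrier)
  next
    fix a X assume "X \<in> ?S"
    then obtain p where X: "X = coset J (free.lift g p)" by blast
    have "a \<odot>\<^bsub>Q\<^esub> X = coset J (free.lift g (fsm a p))" by (simp add: X free.lift_simps)
    then show "a \<odot>\<^bsub>Q\<^esub> X \<in> ?S" by blast
  qed
  moreover have "range (\<lambda>y. coset J (g y)) \<subseteq> ?S" using free.lift_var by (metis image_subsetI rangeI)
  moreover have "?S \<subseteq> S" if S: "is_subalgebra Q S" and gS: "range (\<lambda>y. coset J (g y)) \<subseteq> S" for S
  proof -
    interpret S: subring S Q using S by (simp add: is_subalgebra_def)
    have "coset J (free.lift g p) \<in> S" for p
    proof (induction p rule: free_algebra_induct)
      case (word w)
      show ?case
      proof (induction w)
        case Nil
        show ?case using S.one_closed by (simp add: word_Nil Q_one)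
      next
        case (Cons y w)
        then show ?case using S.m_closed[of "coset J (g y)" "coset J (free.lift g (word w))"] gS
          by (auto simp: word_Cons free.lift_simps)
      qed
    next
      case (add p q)
      then show ?case using subringE(7)[OF S.subring_axioms, of "coset J (free.lift g p)" "coset J (free.lift g q)"]
        by (simp add: free.lift_simps)
    next
      case (fsm a p)
      then show ?case using S unfolding is_subalgebra_def by (metis Q_smult free.lift_fsm)
    qed
    then show ?thesis by blast
  qed
  ultimately have "\<Inter>{S. is_subalgebra Q S \<and> range (\<lambda>y. coset J (g y)) \<subseteq> S} = ?S"
    by (intro subset_antisym Inter_lower Inter_greatest) auto
  then show ?thesis by (simp add: generated_subalgebra_def)
qed

end

lemma free_ideal_genideal: "free_ideal (Idl\<^bsub>free_algebra\<^esub> R)"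
  by (simp add: free_ideal_def alg_ideal_genideal)

text \<open>Reduces an isomorphism onto a generated subalgebra to two statements about free
  algebras: evaluation maps the relations into \<open>J'\<close>, and the preimage of
  \<open>J'\<close> lies in \<open>J\<close>. Surjectivity is automatic.\<close>

lemma algebra_iso_generated_subalgebra:
  fixes R :: "('y list \<Rightarrow>\<^sub>0 'f::field) set" and R' :: "('x list \<Rightarrow>\<^sub>0 'f) set"
    and g :: "'y \<Rightarrow> 'x list \<Rightarrow>\<^sub>0 'f"
  defines "J \<equiv> Idl\<^bsub>free_algebra\<^esub> R" and "J' \<equiv> Idl\<^bsub>free_algebra\<^esub> R'"
  assumes hom: "\<And>r. r \<in> R \<Longrightarrow> free.lift g r \<in> J'"
    and inj: "\<And>p. free.lift g p \<in> J' \<Longrightarrow> p \<in> J"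
  obtains \<phi> where "\<phi> \<in> algebra_iso (presented_algebra R)
      (generated_subalgebra (presented_algebra R') (range (\<lambda>y. coset J' (g y))))"
    "\<phi> \<in> extensional (carrier (presented_algebra R))"
    "\<And>p. \<phi> (coset J p) = coset J' (free.lift g p)"
proof -
  interpret J: free_ideal J unfolding J_def by (rule free_ideal_genideal)
  interpret J': free_ideal J' unfolding J'_def by (rule free_ideal_genideal)
  let ?N = "generated_subalgebra J'.Q (range (\<lambda>y. coset J' (g y)))"
  have "alg_ideal fsm {p. free.lift g p \<in> J'}"
    by unfold_locales (simp_all add: free.lift_simps J'.add_in J'.mult_left_in J'.mult_right_in)
  then have "J \<subseteq> {p. free.lift g p \<in> J'}"
    unfolding J_def using hom by (intro genideal_least) auto
  then have iff: "free.lift g p \<in> J' \<longleftrightarrow> p \<in> J" for p using inj by blast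
  \<comment> \<open>The representative is arbitrary, since evaluation respects the congruences. The
    restriction fixes the values outside the carrier, without which uniqueness as a function would
    fail.\<close>
  define \<phi> where "\<phi> = restrict (\<lambda>X. coset J' (free.lift g (SOME p. X = coset J p))) (carrier J.Q)"
  have \<phi>: "\<phi> (coset J p) = coset J' (free.lift g p)" for p
  proof -
    have "coset J p = coset J (SOME p'. coset J p = coset J p')" by (rule someI) (rule refl)
    then show ?thesis
      unfolding \<phi>_def using iff
      by (simp add: J.Q_carrier J.coset_eq_iff J'.coset_eq_iff J.eqv_def J'.eqv_def
          free.lift_diff[symmetric] del: free.lift_diff)
         (metis J.minus_in minus_diff_eq)
  qed
  have ops: "monoid.mult ?N = monoid.mult J'.Q" "ring.add ?N = ring.add J'.Q" "monoid.one ?N = monoid.one J'.Q"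
    "module.smult ?N = module.smult J'.Q"
    by (simp_all add: generated_subalgebra_def)
  have "\<phi> \<in> ring_iso J.Q ?N"
  proof (rule ring_iso_memI)
    show "bij_betw \<phi> (carrier J.Q) (carrier ?N)"
      unfolding bij_betw_def
    proof
      show "inj_on \<phi> (carrier J.Q)"
        by (auto simp: inj_on_def J.Q_carrier \<phi> J.coset_eq_iff J'.coset_eq_iff J.eqv_def J'.eqv_def
            free.lift_diff[symmetric] iff)
      show "\<phi> ` carrier J.Q = carrier ?N"
        by (auto simp: J.Q_carrier J'.carrier_generated_subalgebra \<phi> image_image)
    qed
  qed (auto simp: J.Q_carrier J'.carrier_generated_subalgebra ops \<phi> free.lift_simps J.Q_one J'.Q_one)
  then have "\<phi> \<in> algebra_iso J.Q ?N"
    by (auto simp: algebra_iso_def J.Q_carrier ops \<phi> free.lift_simps)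
  moreover have "\<phi> \<in> extensional (carrier J.Q)" by (simp add: \<phi>_def)
  ultimately show ?thesis
    using that[OF _ _ \<phi>] by (simp add: presented_algebra_def J_def J'_def)
qed

section \<open>The relations satisfied by the generators \<open>B\<^sub>j\<close> and \<open>L\<^sub>j\<close>\<close>

context alg_ideal
begin

definition qcommute :: "'a \<Rightarrow> 'f \<Rightarrow> 'a \<Rightarrow> bool" where
  "qcommute g s x \<longleftrightarrow> g * x \<approx> sm s (x * g)"

lemma qcommute_eqv: "qcommute g s x \<Longrightarrow> g * x \<approx> sm s (x * g)"
  by (simp add: qcommute_def)

lemma qcommute_mult_right:
  assumes "qcommute g s x" "qcommute g t y"
  shows "qcommute g (s * t) (x * y)"
proof -
  have "g * x * y \<approx> sm s (x * g) * y" by (intro eqv_mult_right qcommute_eqv assms)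
  also have "\<dots> = sm s (x * (g * y))" by (simp add: mult.assoc)
  also have "\<dots> \<approx> sm s (x * sm t (y * g))" by (intro eqv_sm eqv_mult_left qcommute_eqv assms)
  finally show ?thesis by (simp add: qcommute_def mult.assoc)
qed

lemma qcommute_mult_left:
  assumes "qcommute g s x" "qcommute h t x"
  shows "qcommute (g * h) (s * t) x"
proof -
  have "g * (h * x) \<approx> g * sm t (x * h)" by (intro eqv_mult_left qcommute_eqv assms)
  also have "\<dots> = sm t (g * x * h)" by (simp add: mult.assoc)
  also have "\<dots> \<approx> sm t (sm s (x * g) * h)" by (intro eqv_sm eqv_mult_right qcommute_eqv assms)
  finally show ?thesis by (simp add: qcommute_def mult.assoc mult.commute)
qed

lemma qcommute_sm_right: "qcommute g s x \<Longrightarrow> qcommute g s (sm a x)"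
  unfolding qcommute_def using eqv_sm[of "g * x" "sm s (x * g)" a] by (simp add: mult.commute)

lemma qcommute_sm_left: "qcommute g s x \<Longrightarrow> qcommute (sm a g) s x"
  unfolding qcommute_def using eqv_sm[of "g * x" "sm s (x * g)" a] by (simp add: mult.commute)

lemma qcommute_add: "qcommute g s x \<Longrightarrow> qcommute g s y \<Longrightarrow> qcommute g s (x + y)"
  unfolding qcommute_def using eqv_add[of "g * x" _ "g * y"] by (simp add: sm_distribs algebra_simps)

lemma qcommute_sym:
  assumes "qcommute g s x" "s \<noteq> 0"
  shows "qcommute x (inverse s) g"
  using eqv_sym[OF eqv_sm[OF qcommute_eqv[OF assms(1)], of "inverse s"]] assms(2)
  by (simp add: qcommute_def)

lemma qcommute_inverse:
  assumes "qcommute g s x" "s \<noteq> 0" "g * g' \<approx> 1" "g' * g \<approx> 1"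
  shows "qcommute g' (inverse s) x"
proof -
  have "g' * x \<approx> g' * x * (g * g')" 
    using eqv_mult_left[OF eqv_sym[OF assms(3)], of "g' * x"] by simp
  also have "\<dots> = sm (inverse s) (g' * sm s (x * g) * g')" using assms(2) by (simp add: mult.assoc)
  also have "\<dots> \<approx> sm (inverse s) (g' * (g * x) * g')"
    by (intro eqv_sm eqv_mult_left eqv_mult_right eqv_sym[OF qcommute_eqv] assms)
  also have "\<dots> = sm (inverse s) (g' * g * (x * g'))" by (simp add: mult.assoc)
  also have "\<dots> \<approx> sm (inverse s) (1 * (x * g'))" by (intro eqv_sm eqv_mult_right assms)
  finally show ?thesis by (simp add: qcommute_def)
qed

lemma qcommute_oneD: "qcommute g 1 x \<Longrightarrow> g * x \<approx> x * g"
  by (simp add: qcommute_def)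

lemma qcommute_oneI: "g * x \<approx> x * g \<Longrightarrow> qcommute g 1 x"
  by (simp add: qcommute_def)

end

lemma bar_bar [simp]: "bar (bar j) = j"
  by (cases j) simp_all

lemma bar_neq [simp]: "bar j \<noteq> j" "j \<noteq> bar j"
  by (cases j; simp)+

lemma bar_eq_iff [simp]: "bar j = bar k \<longleftrightarrow> j = k"
  by (metis bar_bar)

lemma q_indet_power: "n > 0 \<Longrightarrow> (q_indet :: 'k::field poly fract) ^ n \<noteq> 1"
proof -
  assume n: "n > 0"
  have "(q_indet :: 'k poly fract) ^ n = Fract ([:0, 1:] ^ n) 1"
    by (induction n) (simp_all add: q_indet_def One_fract_def)
  moreover have "[:0, 1:] ^ n \<noteq> (1 :: 'k poly)"
    using degree_power_eq[of "[:0, 1:] :: 'k poly" n] n by auto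
  ultimately show ?thesis by (simp add: One_fract_def eq_fract)
qed

text \<open>The properties of \<open>cartan_of_gim\<close> and its symmetrizer on which the
  calculations rest. The parameters \<open>c\<close> are extended to the copy of I, so that
  \<open>bar\<close> is a symmetry of all data.\<close>

locale gim_data =
  fixes C :: "'i::finite + 'i \<Rightarrow> 'i + 'i \<Rightarrow> int" and \<epsilon> :: "'i + 'i \<Rightarrow> nat"
    and c :: "'i + 'i \<Rightarrow> 'k::field poly fract"
  assumes C_diag: "C j j = 2"
    and C_nonpos: "j \<noteq> k \<Longrightarrow> C j k \<le> 0"
    and C_sym: "int (\<epsilon> j) * C j k = int (\<epsilon> k) * C k j"
    and C_bar: "C (bar j) (bar k) = C j k"
    and C_bar_right: "C j (bar j) = 0"
    and eps_pos: "\<epsilon> j > 0"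
    and eps_bar: "\<epsilon> (bar j) = \<epsilon> j"
    and c_bar: "c (bar j) = c j"
begin

definition v :: "'i + 'i \<Rightarrow> 'k poly fract" where "v j = qi \<epsilon> j"

lemma generic_v: "generic_parameter (v j)"
proof
  have "(q_indet :: 'k poly fract) \<noteq> 0" by (simp add: q_indet_def Zero_fract_def eq_fract)
  then show "v j \<noteq> 0" by (simp add: v_def qi_def)
  show "v j ^ n \<noteq> 1" if "n > 0" for n
    unfolding v_def qi_def power_mult[symmetric] by (rule q_indet_power) (use that eps_pos in simp)
qed

sublocale v: generic_parameter "v j" for j
  by (rule generic_v)

lemma v_bar [simp]: "v (bar j) = v j"
  by (simp add: v_def qi_def eps_bar)

lemma C_bar_swap: "C (bar j) k = C j (bar k)"
  using C_bar[of j "bar k"] by simp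

lemma v_powi_sym: "v j powi C j k = v k powi C k j"
  using C_sym[of j k] by (simp add: v_def qi_def power_int_power)

abbreviation N :: "'i + 'i \<Rightarrow> 'i + 'i \<Rightarrow> nat" where
  "N j k \<equiv> nat (- C j k)"

lemma v_powi_C: "j \<noteq> k \<Longrightarrow> v j powi C j k = inverse (v j) ^ N j k"
  using C_nonpos[of j k] by (auto simp: power_int_def)

lemma v_powi_minus_C: "j \<noteq> k \<Longrightarrow> v j powi (- C j k) = v j ^ N j k"
  using C_nonpos[of j k] by (auto simp: power_int_def)

definition h :: "'i + 'i \<Rightarrow> 'k poly fract" where
  "h j = 1 / (v j - inverse (v j))"

lemma h_bar [simp]: "h (bar j) = h j"
  by (simp add: h_def)

end

text \<open>The relations of U_q modulo an ideal. The Serre relations of the \<open>E j\<close> are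
  stated with \<open>1/v\<close> and those of the \<open>F j\<close> with \<open>v\<close>, the
  forms in which \<open>Y j\<close> and \<open>F j\<close> will use them.\<close>

locale quantum_group_elements = gim_data C \<epsilon> c + alg_ideal sm J
  for C :: "'i::finite + 'i \<Rightarrow> 'i + 'i \<Rightarrow> int" and \<epsilon> and c :: "'i + 'i \<Rightarrow> 'k::field poly fract"
    and sm :: "'k poly fract \<Rightarrow> 'a::ring_1 \<Rightarrow> 'a" and J +
  fixes E F K K' :: "'i + 'i \<Rightarrow> 'a"
  assumes K_K': "K j * K' j \<approx> 1" and K'_K: "K' j * K j \<approx> 1"
    and K_K: "K j * K k \<approx> K k * K j"
    and K_E: "qcommute (K j) (v j powi C j k) (E k)"
    and K_F: "qcommute (K j) (v j powi (- C j k)) (F k)"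
    and E_F: "j \<noteq> k \<Longrightarrow> E j * F k \<approx> F k * E j"
    and E_F_same: "E j * F j - F j * E j \<approx> sm (h j) (K j - K' j)"
    and serre_E: "j \<noteq> k \<Longrightarrow> qcomm (inverse (v j)) (v j ^ N j k) (E j) (E k) (Suc (N j k)) \<in> J"
    and serre_F: "j \<noteq> k \<Longrightarrow> qcomm (v j) (inverse (v j) ^ N j k) (F j) (F k) (Suc (N j k)) \<in> J"
begin

lemma K'_E: "qcommute (K' j) (v j powi (- C j k)) (E k)"
  using qcommute_inverse[OF K_E _ K_K' K'_K, of j k] by (simp add: power_int_minus)

lemma K'_F: "qcommute (K' j) (v j powi C j k) (F k)"
  using qcommute_inverse[OF K_F _ K_K' K'_K, of j k] by (simp add: power_int_minus)

lemma K'_K_commute: "qcommute (K' j) 1 (K k)"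
  using qcommute_inverse[OF qcommute_oneI[OF K_K] _ K_K' K'_K, of j k] by simp

lemma K'_K': "qcommute (K' j) 1 (K' k)"
proof -
  have "qcommute (K k) 1 (K' j)" using qcommute_sym[OF K'_K_commute[of j k]] by simp
  from qcommute_inverse[OF this _ K_K' K'_K] have "qcommute (K' k) 1 (K' j)" by simp
  from qcommute_sym[OF this] show ?thesis by simp
qed

lemma E_E_orthogonal: "j \<noteq> k \<Longrightarrow> C j k = 0 \<Longrightarrow> E j * E k \<approx> E k * E j"
  using serre_E[of j k] by (simp add: eqv_def)

lemma F_F_orthogonal: "j \<noteq> k \<Longrightarrow> C j k = 0 \<Longrightarrow> F j * F k \<approx> F k * F j"
  using serre_F[of j k] by (simp add: eqv_def)

definition Y :: "'i + 'i \<Rightarrow> 'a" where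
  "Y j = sm (- c j) (E (bar j) * K' j)"

definition B :: "'i + 'i \<Rightarrow> 'a" where
  "B j = F j + Y j"

definition L :: "'i + 'i \<Rightarrow> 'a" where
  "L j = K j * K' (bar j)"

lemma L_L_bar: "L j * L (bar j) \<approx> 1"
proof -
  have "K j * (K' (bar j) * K (bar j)) * K' j \<approx> K j * 1 * K' j"
    by (intro eqv_mult_left eqv_mult_right K'_K)
  also have "\<dots> \<approx> 1" using K_K' by simp
  finally show ?thesis by (simp add: L_def mult.assoc)
qed

lemma L_L: "L j * L k \<approx> L k * L j"
proof -
  have 1: "qcommute (K j) 1 (K k)" for j k by (intro qcommute_oneI K_K)
  have 2: "qcommute (K j) 1 (K' k)" for j k using qcommute_sym[OF K'_K_commute[of k j]] by simp
  have "qcommute (L j) (1 * 1) (L k)"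
    unfolding L_def 
    by (intro qcommute_mult_right; rule qcommute_mult_left[where s = 1 and t = 1, simplified])
      (intro 1 2 K'_K_commute K'_K')+
  then show ?thesis by (simp add: qcommute_oneD)
qed

lemma L_B: "qcommute (L j) (v j powi (C (bar j) k - C j k)) (B k)"
proof -
  have "qcommute (L j) (v j powi (- C j k) * v (bar j) powi C (bar j) k) (F k)"
    unfolding L_def by (rule qcommute_mult_left[OF K_F K'_F])
  then have 1: "qcommute (L j) (v j powi (C (bar j) k - C j k)) (F k)"
    by (simp add: power_int_add[symmetric])
  have "qcommute (L j) (v j powi C j (bar k) * v (bar j) powi (- C (bar j) (bar k))) (E (bar k))"
    unfolding L_def by (rule qcommute_mult_left[OF K_E K'_E])
  then have 2: "qcommute (L j) (v j powi (C (bar j) k - C j k)) (E (bar k))"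
    by (simp add: power_int_add[symmetric] C_bar C_bar_swap)
  have "qcommute (L j) 1 (K' k)"
    unfolding L_def using qcommute_mult_left[OF _ K'_K', of "K j" 1 k] qcommute_sym[OF K'_K_commute[of k j]]
    by simp
  from qcommute_mult_right[OF 2 this] have "qcommute (L j) (v j powi (C (bar j) k - C j k)) (Y k)"
    unfolding Y_def by (intro qcommute_sm_right) simp
  with 1 show ?thesis unfolding B_def by (rule qcommute_add)
qed

lemma Y_F_same: "qcommute (Y j) (v j ^ 2) (F j)"
  unfolding Y_def 
  using qcommute_sm_left[OF qcommute_mult_left[OF qcommute_oneI[OF E_F[of "bar j" j]] K'_F[of j j]]]
  by (simp add: C_diag)

lemma Y_F:
  assumes "j \<noteq> k" "k \<noteq> bar j"
  shows "qcommute (Y j) (v j powi C j k) (F k)"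
  unfolding Y_def 
  using qcommute_sm_left[OF qcommute_mult_left[OF qcommute_oneI[OF E_F[of "bar j" k]] K'_F[of j k]]] assms
  by simp

text \<open>Up to a scalar and Cartan elements on the right this is the Serre polynomial of
  \<open>E (bar j)\<close> and \<open>E (bar k)\<close>, and \<open>C\<close> is invariant under
  \<open>bar\<close>.\<close>

lemma serre_Y:
  assumes jk: "j \<noteq> k"
  shows "qcomm (inverse (v j)) (v j ^ N j k) (Y j) (Y k) (Suc (N j k)) \<in> J"
proof -
  have "v k powi C k (bar j) = v j powi C j (bar k)"
    using v_powi_sym[of k "bar j"] by (simp add: C_bar_swap)
  then have b: "v k powi (- C k (bar j)) = v j powi (- C j (bar k))" by (simp add: power_int_minus)
  have "\<exists>g. qcomm (inverse (v j)) (v j ^ N j k) (Y j) (Y k) (Suc (N j k))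
    \<approx> sm g (qcomm (inverse (v j)) (v j ^ N j k) (E (bar j)) (E (bar k)) (Suc (N j k)) * (K' j ^ Suc (N j k) * K' k))"
    unfolding Y_def
  proof (rule qcomm_twist)
    show "K' j * E (bar j) \<approx> E (bar j) * K' j"
      using K'_E[of j "bar j"] by (simp add: C_bar_right qcommute_oneD)
    show "K' k * E (bar j) \<approx> sm (v j powi (- C j (bar k))) (E (bar j) * K' k)"
      using qcommute_eqv[OF K'_E[of k "bar j"]] by (simp only: b)
    show "K' j * E (bar k) \<approx> sm (v j powi (- C j (bar k))) (E (bar k) * K' j)"
      by (rule qcommute_eqv[OF K'_E])
    show "K' k * K' j \<approx> K' j * K' k" by (rule qcommute_oneD[OF K'_K'])
  qed
  moreover have "qcomm (inverse (v j)) (v j ^ N j k) (E (bar j)) (E (bar k)) (Suc (N j k)) \<in> J"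
    using serre_E[of "bar j" "bar k"] jk by (simp only: bar_eq_iff C_bar v_bar) simp
  ultimately show ?thesis
    using in_cong sm_in mult_right_in by blast
qed

text \<open>The polynomial is linear in its second argument, so \<open>F k\<close> and
  \<open>Y k\<close> are treated separately. The condition \<open>k \<noteq> bar j\<close> makes
  \<open>E (bar j)\<close> commute with \<open>F k\<close> and \<open>F j\<close> with
  \<open>E (bar k)\<close>.\<close>

lemma serre_B:
  assumes jk: "j \<noteq> k" "k \<noteq> bar j"
  shows "qcomm (v j) (inverse (v j) ^ N j k) (B j) (B k) (Suc (N j k)) \<in> J"
proof -
  let ?m = "Suc (N j k)" and ?w = "inverse (v j)"
  have sym: "qcomm (v j) (?w ^ N j k) x y ?m = qcomm ?w (v j ^ N j k) x y ?m" for x y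
    by (rule v.qcomm_symmetric) (rule assoc_alg_axioms)
  \<comment> \<open>Against \<open>F j\<close> and \<open>F k\<close> the element \<open>Y j\<close>
    has the factors \<open>v^2\<close> and \<open>v^-N\<close>, those of the form in
    \<open>v\<close>; so it drops out.\<close>
  have "qcomm (v j) (?w ^ N j k) (F j + Y j) (F k) ?m \<approx> qcomm (v j) (?w ^ N j k) (F j) (F k) ?m"
    by (rule qcomm_absorb(1))
      (use qcommute_eqv[OF Y_F_same[of j]] qcommute_eqv[OF Y_F[OF jk]] jk in \<open>simp_all add: v_powi_C\<close>)
  then have 1: "qcomm (v j) (?w ^ N j k) (B j) (F k) ?m \<in> J"
    unfolding B_def using serre_F[OF jk(1)] by (rule in_cong[THEN iffD2])
  have FY: "qcommute (F j) (v j ^ N j k) (Y k)"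
  proof -
    have "qcommute (F j) (inverse (v k powi C k j)) (K' k)"
      by (rule qcommute_sym[OF K'_F]) simp
    moreover have "inverse (v k powi C k j) = v j ^ N j k"
      using jk v_powi_sym[of j k] by (simp add: v_powi_C power_inverse)
    moreover have "qcommute (F j) 1 (E (bar k))"
      using jk by (intro qcommute_oneI eqv_sym[OF E_F]) auto
    ultimately show ?thesis unfolding Y_def using qcommute_sm_right[OF qcommute_mult_right] by fastforce
  qed
  \<comment> \<open>Against \<open>Y j\<close> and \<open>Y k\<close> the element \<open>F j\<close>
    has the factors \<open>v^-2\<close> and \<open>v^N\<close>; so now \<open>F j\<close> drops out,
    but of the form in \<open>1/v\<close>.\<close>
  have "qcomm ?w (v j ^ N j k) (Y j + F j) (Y k) ?m \<approx> qcomm ?w (v j ^ N j k) (Y j) (Y k) ?m"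
    by (rule qcomm_absorb(1))
      (use qcommute_eqv[OF qcommute_sym[OF Y_F_same[of j]]] qcommute_eqv[OF FY] in \<open>simp_all add: power_inverse\<close>)
  then have 2: "qcomm (v j) (?w ^ N j k) (B j) (Y k) ?m \<in> J"
    unfolding B_def sym add.commute[of "F j"] using serre_Y[OF jk(1)] by (rule in_cong[THEN iffD2])
  show ?thesis
    using add_in[OF 1 2] unfolding qcomm_add[symmetric] by (simp only: B_def[of k])
qed

text \<open>The pure terms cancel: the two \<open>F\<close> commute by orthogonality, and in the
  product of the two \<open>Y\<close> the factors \<open>v^2\<close> and \<open>v^-2\<close>
  compensate. Only the mixed terms survive, each through one Cartan relation.\<close>

lemma B_B_bar: "B j * B (bar j) - B (bar j) * B j \<approx> sm (c j * h j) (L j - L (bar j))"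
proof -
  have FF: "F j * F (bar j) - F (bar j) * F j \<approx> 0"
    using F_F_orthogonal[of j "bar j"] by (simp add: C_bar_right eqv_def)
  have YY: "Y j * Y (bar j) - Y (bar j) * Y j \<approx> 0"
  proof -
    have 1: "qcommute (E (bar j)) 1 (E j)"
      using E_E_orthogonal[of "bar j" j] C_bar_right[of "bar j"] by (simp add: qcommute_oneI)
    have 2: "qcommute (E (bar j)) (v j ^ 2) (K' (bar j))"
      using qcommute_sym[OF K'_E[of "bar j" "bar j"]] by (simp add: C_diag power_int_minus)
    have 3: "qcommute (K' j) (inverse (v j ^ 2)) (E j)"
      using K'_E[of j j] by (simp add: C_diag power_int_minus)
    have "qcommute (E (bar j) * K' j) (1 * inverse (v j ^ 2) * (v j ^ 2 * 1)) (E j * K' (bar j))"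
      by (intro qcommute_mult_right qcommute_mult_left 1 2 3 K'_K')
    then have "qcommute (Y j) 1 (Y (bar j))"
      unfolding Y_def by (intro qcommute_sm_left qcommute_sm_right) simp
    then show ?thesis by (simp add: qcommute_def eqv_def)
  qed
  have FY: "F j * Y (bar j) - Y (bar j) * F j \<approx> sm (c j * h j) ((K j - K' j) * K' (bar j))" for j
  proof -
    have "F j * Y (bar j) - Y (bar j) * F j =
        sm (c j) (E j * (K' (bar j) * F j) - F j * E j * K' (bar j))"
      by (simp add: Y_def c_bar sm_distribs mult.assoc)
    also have "\<dots> \<approx> sm (c j) (E j * (F j * K' (bar j)) - F j * E j * K' (bar j))"
      using K'_F[of "bar j" j] C_bar_right[of "bar j"]
      by (intro eqv_sm eqv_diff eqv_mult_left) (simp_all add: qcommute_oneD)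
    also have "\<dots> = sm (c j) ((E j * F j - F j * E j) * K' (bar j))" by (simp add: algebra_simps)
    also have "\<dots> \<approx> sm (c j) (sm (h j) (K j - K' j) * K' (bar j))"
      by (intro eqv_sm eqv_mult_right E_F_same)
    finally show ?thesis by simp
  qed
  have FY': "F (bar j) * Y j - Y j * F (bar j) \<approx> sm (c j * h j) ((K (bar j) - K' (bar j)) * K' j)"
    using FY[of "bar j"] by (simp only: bar_bar c_bar h_bar)
  have KK: "K' j * K' (bar j) - K' (bar j) * K' j \<approx> 0"
    using qcommute_oneD[OF K'_K'[of j "bar j"]] by (simp only: eqv_def diff_zero)
  have "B j * B (bar j) - B (bar j) * B j =
      (F j * F (bar j) - F (bar j) * F j) + (Y j * Y (bar j) - Y (bar j) * Y j)
      + ((F j * Y (bar j) - Y (bar j) * F j) - (F (bar j) * Y j - Y j * F (bar j)))"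
    unfolding B_def by (simp add: algebra_simps)
  then have 1: "B j * B (bar j) - B (bar j) * B j \<approx>
      sm (c j * h j) ((K j - K' j) * K' (bar j)) - sm (c j * h j) ((K (bar j) - K' (bar j)) * K' j)"
    using eqv_add[OF eqv_add[OF FF YY] eqv_diff[OF FY FY']] by simp
  \<comment> \<open>The products of two inverses cancel between the mixed terms, so that only the
    \<open>L\<close> remain.\<close>
  have 2: "(K j - K' j) * K' (bar j) - (K (bar j) - K' (bar j)) * K' j =
      L j - L (bar j) - (K' j * K' (bar j) - K' (bar j) * K' j)"
    unfolding L_def bar_bar by (simp add: algebra_simps)
  have "sm (c j * h j) ((K j - K' j) * K' (bar j) - (K (bar j) - K' (bar j)) * K' j)
      \<approx> sm (c j * h j) (L j - L (bar j))"
    unfolding 2 using eqv_sm[OF eqv_diff[OF eqv_refl KK]] by simp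
  with 1 show ?thesis unfolding sm_diff_right by (rule eqv_trans)
qed

end

text \<open>The relations shared by the \<open>B j\<close>, \<open>L j\<close> in U_q and the
  generators of the presented algebra. The locale is instantiated on both sides: on one it yields
  the homomorphism, on the other the filtration.\<close>

locale gim_elements = gim_data C \<epsilon> c + alg_ideal sm J
  for C :: "'i::finite + 'i \<Rightarrow> 'i + 'i \<Rightarrow> int" and \<epsilon> and c :: "'i + 'i \<Rightarrow> 'k::field poly fract"
    and sm :: "'k poly fract \<Rightarrow> 'a::ring_1 \<Rightarrow> 'a" and J +
  fixes b l :: "'i + 'i \<Rightarrow> 'a"
  assumes l_l_bar: "l j * l (bar j) \<approx> 1"
    and l_l: "l j * l k \<approx> l k * l j"
    and l_b: "qcommute (l j) (v j powi (C (bar j) k - C j k)) (b k)"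
    and serre_b: "j \<noteq> k \<Longrightarrow> k \<noteq> bar j \<Longrightarrow>
      qcomm (v j) (inverse (v j) ^ N j k) (b j) (b k) (Suc (N j k)) \<in> J"
    and b_b_bar: "b j * b (bar j) - b (bar j) * b j \<approx> sm (c j * h j) (l j - l (bar j))"

sublocale quantum_group_elements \<subseteq> gim_elements C \<epsilon> c sm J B L
  by unfold_locales (intro L_L_bar L_L L_B serre_B B_B_bar; assumption)+

context gim_elements
begin

lemma b_b_orthogonal:
  assumes "j \<noteq> k" "k \<noteq> bar j" "C j k = 0"
  shows "b j * b k - b k * b j \<in> J"
  using serre_b[of j k] assms by simp

text \<open>The instance \<open>i = j\<close> of the Serre relations for positive entries. The
  constants of the three q-commutators are \<open>v^-2\<close>, 1 and \<open>v^2\<close>; the middle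
  one is the ordinary commutator, so the polynomial is \<open>D\<close> applied to the commutator of
  \<open>b j\<close> and \<open>b (bar j)\<close>.\<close>

lemma serre_b_bar: "qcomm (v j) (inverse (v j) ^ 2) (b j) (b (bar j)) (Suc 2) \<in> J"
proof -
  define u where "u = v j ^ 2"
  \<comment> \<open>The product of the two outer q-commutators. It kills whatever \<open>b j\<close>
    q-commutes with at a root \<open>u\<close> or \<open>1/u\<close> of its characteristic
    polynomial, hence \<open>l j\<close> and \<open>l (bar j)\<close>.\<close>
  define D where "D w = b j * b j * w - sm (u + inverse u) (b j * w * b j) + w * b j * b j" for w
  have u: "u \<noteq> 0" by (simp add: u_def)
  have D_diff: "D (w - w') = D w - D w'" and D_sm: "D (sm s w) = sm s (D w)" for w w' s
    by (simp_all add: D_def algebra_simps sm_distribs)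
  have D_in: "D w \<in> J" if w: "qcommute (b j) s w" and s: "s * s - (u + inverse u) * s + 1 = 0" for s w
  proof -
    have 1: "b j * w \<approx> sm s (w * b j)" by (rule qcommute_eqv[OF w])
    have "b j * (b j * w) \<approx> b j * sm s (w * b j)" by (rule eqv_mult_left[OF 1])
    also have "\<dots> = sm s (b j * w * b j)" by (simp add: mult.assoc)
    also have "\<dots> \<approx> sm s (sm s (w * b j) * b j)" by (rule eqv_sm[OF eqv_mult_right[OF 1]])
    finally have 2: "b j * (b j * w) \<approx> sm (s * s) (w * b j * b j)" by simp
    have "D w \<approx> sm (s * s) (w * b j * b j) - sm (u + inverse u) (sm s (w * b j) * b j) + w * b j * b j"
      unfolding D_def mult.assoc[of "b j" "b j" w] by (intro eqv_add eqv_diff 2 eqv_sm eqv_mult_right 1) simp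
    also have "\<dots> = sm (s * s - (u + inverse u) * s + 1) (w * b j * b j)"
      by (simp add: sm_distribs)
    finally show ?thesis unfolding s by (simp add: eqv_zero_iff)
  qed
  have "qcommute (l j) (inverse u) (b j)"
    using l_b[of j j] C_bar_right[of "bar j"] by (simp add: C_diag u_def power_int_minus)
  then have "qcommute (b j) u (l j)" using qcommute_sym[of "l j" "inverse u" "b j"] u by simp
  then have "D (l j) \<in> J" by (rule D_in) (use u in \<open>simp add: field_simps\<close>)
  moreover have "qcommute (l (bar j)) u (b j)"
    using l_b[of "bar j" j] C_bar_right[of "bar j"] by (simp add: C_diag u_def)
  from qcommute_sym[OF this u] have "D (l (bar j)) \<in> J"
    by (rule D_in) (use u in \<open>simp add: field_simps\<close>)
  ultimately have "D (sm (c j * h j) (l j - l (bar j))) \<in> J"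
    unfolding D_sm D_diff by (intro sm_in diff_in)
  moreover have "D (b j * b (bar j) - b (bar j) * b j) \<approx> D (sm (c j * h j) (l j - l (bar j)))"
    unfolding D_def by (intro eqv_add eqv_diff[OF eqv_mult_left[OF b_b_bar]] eqv_sm eqv_mult_left eqv_mult_right b_b_bar)
  ultimately have "D (b j * b (bar j) - b (bar j) * b j) \<in> J" using in_cong by blast
  moreover have "qcomm (v j) (inverse (v j) ^ 2) (b j) y (Suc 2) = D (b j * y - y * b j)" for y
  proof -
    have 1: "inverse (v j) ^ 2 = inverse u" by (simp add: u_def power_inverse)
    have 2: "v j ^ (2 * 1) = u" "v j ^ (2 * Suc 1) = u * u" by (simp_all add: u_def power2_eq_square eval_nat_numeral)
    show ?thesis
      unfolding numeral_2_eq_2 qcomm.simps 1[unfolded numeral_2_eq_2] 2[unfolded numeral_2_eq_2] D_def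
      using u 2 by (simp add: algebra_simps sm_distribs numeral_2_eq_2)
  qed
  ultimately show ?thesis by simp
qed

end

section \<open>Translation between the listed relations and the uniform ones\<close>

primrec ggen :: "'i + 'i \<Rightarrow> 'i gq_gen" where
  "ggen (Inl i) = GG i"
| "ggen (Inr i) = GGbar i"

primrec lgen :: "'i + 'i \<Rightarrow> 'i gq_gen" where
  "lgen (Inl i) = GL i"
| "lgen (Inr i) = GLbar i"

lemma range_ggen_lgen: "range ggen \<union> range lgen = UNIV"
proof -
  have "x \<in> range ggen \<union> range lgen" for x :: "'i gq_gen"
    by (cases x) (metis UnCI rangeI ggen.simps lgen.simps)+
  then show ?thesis by blast
qed

lemma gim_data_of_gim:
  fixes A :: "'i::finite \<Rightarrow> 'i \<Rightarrow> int"
  assumes A: "gim A" and \<epsilon>: "symmetrizer A \<epsilon>"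
  shows "gim_data (cartan_of_gim A) (case_sum \<epsilon> \<epsilon>) (case_sum c c)"
proof
  fix j k :: "'i + 'i"
  have *: "int (\<epsilon> i) * A i i' = int (\<epsilon> i') * A i' i" "0 < A i i' \<longleftrightarrow> 0 < A i' i" for i i'
    using A \<epsilon> by (auto simp: gim_def symmetrizer_def)
  show "int (case_sum \<epsilon> \<epsilon> j) * cartan_of_gim A j k = int (case_sum \<epsilon> \<epsilon> k) * cartan_of_gim A k j"
    by (cases j; cases k) (use * in \<open>auto simp: not_less[symmetric]\<close>)
  show "cartan_of_gim A (bar j) (bar k) = cartan_of_gim A j k"
    by (cases j; cases k) simp_all
  show "cartan_of_gim A j k \<le> 0" if "j \<noteq> k"
    using that by (cases j; cases k) auto
  show "cartan_of_gim A j j = 2" "cartan_of_gim A j (bar j) = 0"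
    "case_sum \<epsilon> \<epsilon> (bar j) = case_sum \<epsilon> \<epsilon> j" "case_sum c c (bar j) = case_sum c c j"
    by (cases j; simp)+
  show "0 < case_sum \<epsilon> \<epsilon> j" using \<epsilon> by (cases j) (auto simp: symmetrizer_def)
qed

locale gim_elements_of_gim = gim_elements "cartan_of_gim A" "case_sum \<epsilon> \<epsilon>" "case_sum c c" sm J b l
  for A :: "'i::finite \<Rightarrow> 'i \<Rightarrow> int" and \<epsilon> :: "'i \<Rightarrow> nat" and c :: "'i \<Rightarrow> 'k::field poly fract"
    and sm :: "'k poly fract \<Rightarrow> 'a::ring_1 \<Rightarrow> 'a" and J b l +
  assumes gim: "gim A"
begin

primrec val :: "'i gq_gen \<Rightarrow> 'a" where
  "val (GG i) = b (Inl i)"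
| "val (GGbar i) = b (Inr i)"
| "val (GL i) = l (Inl i)"
| "val (GLbar i) = l (Inr i)"

lemma v_eq: "v (Inl i) = qi \<epsilon> i" "v (Inr i) = qi \<epsilon> i"
  by (simp_all add: v_def qi_def)

lemma generic_qi: "generic_parameter (qi \<epsilon> i :: 'k poly fract)"
  using generic_v[of "Inl i"] by (simp add: v_eq)

lemma lift_qserre: "lift f (qserre (qi \<epsilon> i) k x y) =
    qcomm (qi \<epsilon> i) (inverse (qi \<epsilon> i) ^ k) (lift f x) (lift f y) (Suc k)"
  by (simp only: generic_parameter.qserre_eq_qcomm[OF generic_qi] lift_qcomm)

lemma A_diag: "A i i = 2"
  using gim by (simp add: gim_def)

lemma lift_rel_in:
  assumes "r \<in> gq_rels A \<epsilon> c"
  shows "lift val r \<in> J"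
  using assms
proof cases
  case (1 i)
  then show ?thesis using l_l_bar[of "Inl i"] by (simp add: lift_simps eqv_def)
next
  case (2 i)
  then show ?thesis using l_l_bar[of "Inr i"] by (simp add: lift_simps eqv_def)
next
  case (3 i j)
  then show ?thesis using l_l[of "Inl i" "Inl j"] by (simp add: lift_simps eqv_def)
next
  case (4 i j)
  \<comment> \<open>For \<open>i \<noteq> j\<close> at most one of the two entries is nonzero, and
    for either sign of \<open>A i j\<close> the difference is the same.\<close>
  have "cartan_of_gim A (Inr i) (Inl j) - cartan_of_gim A (Inl i) (Inl j) = - A i j"
    using A_diag by auto
  with 4 show ?thesis using l_b[of "Inl i" "Inl j"] by (simp add: lift_simps eqv_def qcommute_def v_eq)
next
  case (5 i j)
  have "cartan_of_gim A (Inr i) (Inr j) - cartan_of_gim A (Inl i) (Inr j) = A i j"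
    using A_diag by auto
  with 5 show ?thesis using l_b[of "Inl i" "Inr j"] by (simp add: lift_simps eqv_def qcommute_def v_eq)
next
  case (6 i j)
  then have "i \<noteq> j" using A_diag by auto
  with 6 show ?thesis using b_b_orthogonal[of "Inl i" "Inl j"] by (simp add: lift_simps)
next
  case (7 i j)
  then have "i \<noteq> j" using A_diag by auto
  with 7 show ?thesis using b_b_orthogonal[of "Inr i" "Inr j"] by (simp add: lift_simps)
next
  case (8 i j)
  show ?thesis
  proof (cases "i = j")
    case True
    then show ?thesis using b_b_bar[of "Inl i"] 8 by (simp add: lift_simps eqv_def h_def v_eq)
  next
    case False
    with 8 show ?thesis using b_b_orthogonal[of "Inl i" "Inr j"] by (simp add: lift_simps)
  qed
next
  case (9 i j)
  then have "i \<noteq> j" using A_diag[of j] by auto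
  with 9 show ?thesis using serre_b[of "Inl i" "Inl j"] by (simp add: lift_qserre v_eq del: qcomm.simps power_Suc)
next
  case (10 i j)
  then have "i \<noteq> j" using A_diag[of j] by auto
  with 10 show ?thesis using serre_b[of "Inr i" "Inr j"] by (simp add: lift_qserre v_eq del: qcomm.simps power_Suc)
next
  case (11 i j)
  then have "i \<noteq> j" using A_diag[of j] by auto
  with 11 show ?thesis using b_b_orthogonal[of "Inl i" "Inr j"] by (simp add: lift_simps)
next
  case (12 i j)
  show ?thesis
  proof (cases "i = j")
    case True
    then show ?thesis
      using 12 serre_b_bar[of "Inl i"] by (simp add: lift_qserre v_eq A_diag del: qcomm.simps power_Suc)
  next
    case False
    with 12 show ?thesis using serre_b[of "Inl i" "Inr j"] by (simp add: lift_qserre v_eq del: qcomm.simps power_Suc)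
  qed
next
  case (13 i j)
  show ?thesis
  proof (cases "i = j")
    case True
    then show ?thesis
      using 13 serre_b_bar[of "Inr i"] by (simp add: lift_qserre v_eq A_diag del: qcomm.simps power_Suc)
  next
    case False
    with 13 show ?thesis using serre_b[of "Inr i" "Inl j"] by (simp add: lift_qserre v_eq del: qcomm.simps power_Suc)
  qed
next
  case (14 i j)
  then show ?thesis using b_b_orthogonal[of "Inl i" "Inl j"] by (cases "i = j") (simp_all add: lift_simps)
next
  case (15 i j)
  then show ?thesis using b_b_orthogonal[of "Inr i" "Inr j"] by (cases "i = j") (simp_all add: lift_simps)
qed

end

context gim_data
begin

abbreviation JU :: "(('i + 'i) uq_gen list \<Rightarrow>\<^sub>0 'k poly fract) set" where
  "JU \<equiv> Idl\<^bsub>free_algebra\<^esub> (uq_rels C \<epsilon>)"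

sublocale U: quantum_group_elements C \<epsilon> c fsm JU
  "\<lambda>j. var (UE j)" "\<lambda>j. var (UF j)" "\<lambda>j. var (UK j)" "\<lambda>j. var (UKinv j)"
proof -
  interpret I: alg_ideal fsm JU by (rule alg_ideal_genideal)
  have rel: "r \<in> JU" if "r \<in> uq_rels C \<epsilon>" for r
    using that genideal_superset by blast
  show "quantum_group_elements C \<epsilon> c fsm JU
    (\<lambda>j. var (UE j)) (\<lambda>j. var (UF j)) (\<lambda>j. var (UK j)) (\<lambda>j. var (UKinv j))"
  proof
    fix j k :: "'i + 'i"
    show "I.eqv (var (UK j) * var (UKinv j)) 1" "I.eqv (var (UKinv j) * var (UK j)) 1"
      "I.eqv (var (UK j) * var (UK k)) (var (UK k) * var (UK j))"
      unfolding I.eqv_def by (intro rel uq_rels.intros)+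
    show "I.qcommute (var (UK j)) (v j powi C j k) (var (UE k))"
      "I.qcommute (var (UK j)) (v j powi (- C j k)) (var (UF k))"
      unfolding I.eqv_def I.qcommute_def fsm_def v_def mult.assoc[symmetric]
      by (intro rel uq_rels.intros)+
    show "I.eqv (var (UE j) * var (UF k)) (var (UF k) * var (UE j))" if "j \<noteq> k"
      using rel[OF uq_rels.intros(6)[of j k]] that by (simp add: I.eqv_def)
    show "I.eqv (var (UE j) * var (UF j) - var (UF j) * var (UE j)) (fsm (h j) (var (UK j) - var (UKinv j)))"
      using rel[OF uq_rels.intros(6)[of j j]] by (simp add: I.eqv_def fsm_def h_def v_def)
    show "free.qcomm (inverse (v j)) (v j ^ N j k) (var (UE j)) (var (UE k)) (Suc (N j k)) \<in> JU"
      if "j \<noteq> k"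
      using rel[OF uq_rels.intros(7)[OF that]] by (simp only: v.qserre_eq_qcomm' v_def[symmetric])
    show "free.qcomm (v j) (inverse (v j) ^ N j k) (var (UF j)) (var (UF k)) (Suc (N j k)) \<in> JU"
      if "j \<noteq> k"
      using rel[OF uq_rels.intros(8)[OF that]] by (simp only: v.qserre_eq_qcomm v_def[symmetric])
  qed
qed

end

text \<open>The converse translation. What the presentation leaves implicit has to be derived: the
  relations of \<open>GLbar\<close> with the other generators, and the commutators in reversed
  order.\<close>

lemma gim_elements_gq:
  fixes A :: "'i::finite \<Rightarrow> 'i \<Rightarrow> int" and c :: "'i \<Rightarrow> 'k::field poly fract"
  assumes gim: "gim A" and sym: "symmetrizer A \<epsilon>"
  shows "gim_elements (cartan_of_gim A) (case_sum \<epsilon> \<epsilon>) (case_sum c c) fsm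
    (Idl\<^bsub>free_algebra\<^esub> (gq_rels A \<epsilon> c)) (\<lambda>j. var (ggen j)) (\<lambda>j. var (lgen j))"
    (is "gim_elements ?C ?\<epsilon> ?c fsm ?J ?b ?l")
proof -
  interpret gim_data ?C ?\<epsilon> ?c by (rule gim_data_of_gim[OF gim sym])
  interpret I: alg_ideal fsm ?J by (rule alg_ideal_genideal)
  have rel: "r \<in> ?J" if "r \<in> gq_rels A \<epsilon> c" for r
    using that genideal_superset by blast
  have A: "A i i = 2" "A i j > 0 \<longleftrightarrow> A j i > 0" "A i j < 0 \<longleftrightarrow> A j i < 0" for i j
    using gim by (auto simp: gim_def)
  have A0: "A i j = 0 \<longleftrightarrow> A j i = 0" for i j using A(2,3)[of i j] by auto
  have v_eq: "v (Inl i) = qi \<epsilon> i" "v (Inr i) = qi \<epsilon> i" for i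
    by (simp_all add: v_def qi_def)
  have inv: "I.eqv (?l j * ?l (bar j)) 1" for j
    unfolding I.eqv_def by (cases j) (auto intro!: rel gq_rels.intros)
  have comm: "I.qcommute (var (GL i)) 1 (var (GL j))" for i j
    unfolding I.qcommute_def I.eqv_def by (auto intro!: rel gq_rels.intros)
  \<comment> \<open>The presentation lists such relations for \<open>GL\<close> only; inverting
    \<open>GL\<close> gives those of \<open>GLbar\<close>.\<close>
  have comm': "I.qcommute (var (GLbar i)) 1 (?l j)" if "\<And>i. I.qcommute (var (GL i)) 1 (?l j)" for i j
    using I.qcommute_inverse[OF that[of i] _ inv[of "Inl i", simplified] inv[of "Inr i", simplified]] by simp
  have 1: "I.qcommute (?l k) 1 (var (GL j))" for k j
    using comm comm'[of "Inl j"] by (cases k) simp_all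
  have 2: "I.qcommute (?l k) 1 (?l j)" for k j
  proof -
    have "I.qcommute (var (GL i)) 1 (?l j)" for i
      using I.qcommute_sym[OF 1[of j i]] by simp
    then show ?thesis using comm'[of j] by (cases k) simp_all
  qed
  have lb: "I.qcommute (var (GL i)) (v (Inl i) powi (?C (Inr i) k - ?C (Inl i) k)) (?b k)" for i k
  proof (cases k)
    case (Inl j)
    have "?C (Inr i) (Inl j) - ?C (Inl i) (Inl j) = - A i j" using A by auto
    then show ?thesis unfolding Inl v_eq I.qcommute_def I.eqv_def fsm_def mult.assoc[symmetric]
      by (auto intro!: rel gq_rels.intros)
  next
    case (Inr j)
    have "?C (Inr i) (Inr j) - ?C (Inl i) (Inr j) = A i j" using A by auto
    then show ?thesis unfolding Inr v_eq I.qcommute_def I.eqv_def fsm_def mult.assoc[symmetric]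
      by (auto intro!: rel gq_rels.intros)
  qed
  have lb': "I.qcommute (var (GLbar i)) (v (Inr i) powi (?C (Inl i) k - ?C (Inr i) k)) (?b k)" for i k
    using I.qcommute_inverse[OF lb _ inv[of "Inl i", simplified] inv[of "Inr i", simplified], of k]
    by (simp add: v_eq flip: power_int_minus) (simp add: v_eq[symmetric])
  have sw: "- x \<in> ?J" if "x \<in> ?J" for x using that by (rule I.minus_in)
  have orth: "?b j * ?b k - ?b k * ?b j \<in> ?J" if "j \<noteq> k" "k \<noteq> bar j" "?C j k = 0" for j k
  proof (cases j)
    case j: (Inl i)
    show ?thesis
    proof (cases k)
      case (Inl i')
      with j that have "A i i' = 0 \<or> A i i' > 0" by (auto split: if_splits)
      then show ?thesis
        using Inl j rel[OF gq_rels.intros(6)[of A i i']] rel[OF gq_rels.intros(14)[of A i i']] by auto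
    next
      case (Inr i')
      with j that have "A i i' = 0 \<or> A i i' < 0" "i \<noteq> i'" by (auto split: if_splits)
      then show ?thesis using Inr j rel[OF gq_rels.intros(8)[of A i i']]
          rel[OF gq_rels.intros(11)[of A i i']] by auto
    qed
  next
    case j: (Inr i)
    show ?thesis
    proof (cases k)
      case (Inr i')
      with j that have "A i i' = 0 \<or> A i i' > 0" by (auto split: if_splits)
      then show ?thesis
        using Inr j rel[OF gq_rels.intros(7)[of A i i']] rel[OF gq_rels.intros(15)[of A i i']] by auto
    next
      case (Inl i')
      \<comment> \<open>Commutators of a barred and an unbarred generator are listed in one order
        only, so the pair is swapped; the sign of the matrix entry is symmetric.\<close>
      with j that have "A i' i = 0 \<or> A i' i < 0" "i' \<noteq> i" using A A0 by (auto split: if_splits)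
      then have "?b k * ?b j - ?b j * ?b k \<in> ?J" using Inl j rel[OF gq_rels.intros(8)[of A i' i]]
          rel[OF gq_rels.intros(11)[of A i' i]] by auto
      from sw[OF this] show ?thesis by simp
    qed
  qed
  have serre: "free.qcomm (v j) (inverse (v j) ^ N j k) (?b j) (?b k) (Suc (N j k)) \<in> ?J"
    if "j \<noteq> k" "k \<noteq> bar j" for j k
  proof (cases "?C j k = 0")
    case True
    then show ?thesis using orth[OF that True] by simp
  next
    case False
    have "qserre (v j) (N j k) (?b j) (?b k) \<in> ?J"
      using that False by (cases j; cases k) (auto simp: v_eq split: if_splits intro!: rel gq_rels.intros)
    then show ?thesis by (simp only: v.qserre_eq_qcomm)
  qed
  have bb: "I.eqv (var (GG i) * var (GGbar i) - var (GGbar i) * var (GG i))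
      (fsm (c i * h (Inl i)) (var (GL i) - var (GLbar i)))" for i
    using rel[OF gq_rels.intros(8)[of A i i]] by (simp add: I.eqv_def fsm_def h_def v_eq)
  have bb': "I.eqv (?b j * ?b (bar j) - ?b (bar j) * ?b j) (fsm (?c j * h j) (?l j - ?l (bar j)))" for j
  proof (cases j)
    case (Inr i)
    then show ?thesis using I.eqv_minus[OF bb[of i]] by (simp add: h_def v_eq free.sm_distribs)
  qed (use bb in simp)
  show ?thesis
  proof
    fix j k :: "'i + 'i"
    show "I.eqv (?l j * ?l (bar j)) 1" by (rule inv)
    show "I.eqv (?l j * ?l k) (?l k * ?l j)" using 2 by (rule I.qcommute_oneD)
    show "I.qcommute (?l j) (v j powi (?C (bar j) k - ?C j k)) (?b k)"
      using lb lb' by (cases j) simp_all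
    show "free.qcomm (v j) (inverse (v j) ^ N j k) (?b j) (?b k) (Suc (N j k)) \<in> ?J"
      if "j \<noteq> k" "k \<noteq> bar j" using that by (rule serre)
    show "I.eqv (?b j * ?b (bar j) - ?b (bar j) * ?b j) (fsm (?c j * h j) (?l j - ?l (bar j)))"
      by (rule bb')
  qed
qed

section \<open>Linear endomorphisms of a free algebra\<close>

text \<open>Operators are made into a type of class \<open>ring_1\<close>, so that
  \<open>lift\<close> and the q-commutator calculus apply to them.\<close>

typedef (overloaded) ('x, 'f) endo =
  "{h :: ('x list \<Rightarrow>\<^sub>0 'f::field) \<Rightarrow> ('x list \<Rightarrow>\<^sub>0 'f).
     (\<forall>x y. h (x + y) = h x + h y) \<and> (\<forall>a x. h (fsm a x) = fsm a (h x))}"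
  morphisms app Endo
  by (rule exI[of _ "\<lambda>x. x"]) simp

setup_lifting type_definition_endo

lemma app_add: "app h (x + y) = app h x + app h y"
  and app_fsm: "app h (fsm a x) = fsm a (app h x)"
  using app[of h] by auto

lemma endo_eqI: "(\<And>x. app h x = app h' x) \<Longrightarrow> h = h'"
  by (simp add: app_inject[symmetric] fun_eq_iff)

instantiation endo :: (type, field) ring_1
begin

lift_definition zero_endo :: "('a, 'b) endo" is "\<lambda>x. 0" by simp
lift_definition one_endo :: "('a, 'b) endo" is "\<lambda>x. x" by simp
lift_definition plus_endo :: "('a, 'b) endo \<Rightarrow> ('a, 'b) endo \<Rightarrow> ('a, 'b) endo"
  is "\<lambda>g h x. g x + h x" by (simp add: free.sm_distribs algebra_simps)
lift_definition minus_endo :: "('a, 'b) endo \<Rightarrow> ('a, 'b) endo \<Rightarrow> ('a, 'b) endo"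
  is "\<lambda>g h x. g x - h x" by (simp add: free.sm_distribs algebra_simps)
lift_definition uminus_endo :: "('a, 'b) endo \<Rightarrow> ('a, 'b) endo"
  is "\<lambda>h x. - h x" by (simp add: free.sm_distribs)
lift_definition times_endo :: "('a, 'b) endo \<Rightarrow> ('a, 'b) endo \<Rightarrow> ('a, 'b) endo"
  is "\<lambda>g h x. g (h x)" by simp

instance
proof
  show "(0 :: ('a, 'b) endo) \<noteq> 1"
    by transfer (metis one_neq_zero)
qed (transfer; simp add: fun_eq_iff algebra_simps)+

end

lift_definition esm :: "'f::field \<Rightarrow> ('x, 'f) endo \<Rightarrow> ('x, 'f) endo"
  is "\<lambda>a h x. fsm a (h x)" by (simp add: free.sm_distribs mult.commute)

lemma app_simps [simp]:
  "app 0 x = 0" "app 1 x = x" "app (g + h) x = app g x + app h x" "app (g - h) x = app g x - app h x"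
  "app (- h) x = - app h x" "app (g * h) x = app g (app h x)" "app (esm a h) x = fsm a (app h x)"
  by (transfer; simp)+

global_interpretation endo: assoc_alg esm
  by unfold_locales (rule endo_eqI; simp add: free.sm_distribs app_fsm)+

lemma app_zero [simp]: "app h 0 = 0"
  using app_add[of h 0 0] by simp

lemma app_sum: "app h (\<Sum>i\<in>I. f i) = (\<Sum>i\<in>I. app h (f i))"
  by (induction I rule: infinite_finite_induct) (auto simp: app_add)

lift_definition lin_endo :: "('x list \<Rightarrow> 'x list \<Rightarrow>\<^sub>0 'f::field) \<Rightarrow> ('x, 'f) endo"
  is "\<lambda>g. free.lin g" by (simp add: free.lin_add free.lin_fsm)

lemma app_lin_endo [simp]: "app (lin_endo g) (word w) = g w"
  by transfer simp

definition left_mult :: "('x list \<Rightarrow>\<^sub>0 'f::field) \<Rightarrow> ('x, 'f) endo" where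
  "left_mult y = Endo (\<lambda>x. y * x)"

lemma app_left_mult [simp]: "app (left_mult y) x = y * x"
  unfolding left_mult_def by (subst Endo_inverse) (simp_all add: distrib_left)

lemma endo_word_eqI: "(\<And>w. app h (word w) = app h' (word w)) \<Longrightarrow> h = h'"
proof (rule endo_eqI)
  fix x assume *: "\<And>w. app h (word w) = app h' (word w)"
  show "app h x = app h' x"
    by (induction x rule: free_algebra_induct) (simp_all add: * app_add app_fsm)
qed

lemma left_mult_simps:
  "left_mult (x - y) = left_mult x - left_mult y" "left_mult (x * y) = left_mult x * left_mult y"
  "left_mult (fsm a x) = esm a (left_mult x)"
  by (rule endo_eqI; simp add: algebra_simps)+

lemma left_mult_qcomm:
  "left_mult (free.qcomm v a x y r) = endo.qcomm v a (left_mult x) (left_mult y) r"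
  by (induction r) (simp_all add: left_mult_simps)

section \<open>The action on a universal Verma module\<close>

text \<open>The free algebra on the \<open>F\<^sub>j\<close> is the Verma module, before passing to the quotient
  by the Serre ideal, whose highest weight vector has \<open>K\<^sub>j\<close>-eigenvalue \<open>\<chi> j\<close>.\<close>

context gim_data
begin

definition weight :: "('i + 'i \<Rightarrow> 'k poly fract) \<Rightarrow> 'i + 'i \<Rightarrow> ('i + 'i) list \<Rightarrow> 'k poly fract" where
  "weight \<chi> j w = \<chi> j * v j powi (- (\<Sum>k\<leftarrow>w. C j k))"

text \<open>The only possible action of \<open>E j\<close>: it kills the highest weight vector, and
  moving it past a leading \<open>F k\<close> produces a Cartan term exactly when
  \<open>j = k\<close>.\<close>

primrec lowering :: "('i + 'i \<Rightarrow> 'k poly fract) \<Rightarrow> 'i + 'i \<Rightarrow> ('i + 'i) list \<Rightarrow>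
    (('i + 'i) list \<Rightarrow>\<^sub>0 'k poly fract)" where
  "lowering \<chi> j [] = 0"
| "lowering \<chi> j (k # w) = var k * lowering \<chi> j w
    + (if j = k then fsm (h j * (weight \<chi> j w - inverse (weight \<chi> j w))) (word w) else 0)"

definition opF :: "'i + 'i \<Rightarrow> ('i + 'i, 'k poly fract) endo" where
  "opF j = left_mult (var j)"

definition opK :: "('i + 'i \<Rightarrow> 'k poly fract) \<Rightarrow> 'i + 'i \<Rightarrow> ('i + 'i, 'k poly fract) endo" where
  "opK \<chi> j = lin_endo (\<lambda>w. fsm (weight \<chi> j w) (word w))"

definition opK' :: "('i + 'i \<Rightarrow> 'k poly fract) \<Rightarrow> 'i + 'i \<Rightarrow> ('i + 'i, 'k poly fract) endo" where
  "opK' \<chi> j = lin_endo (\<lambda>w. fsm (inverse (weight \<chi> j w)) (word w))"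

definition opE :: "('i + 'i \<Rightarrow> 'k poly fract) \<Rightarrow> 'i + 'i \<Rightarrow> ('i + 'i, 'k poly fract) endo" where
  "opE \<chi> j = lin_endo (lowering \<chi> j)"

definition serre_F :: "(('i + 'i) list \<Rightarrow>\<^sub>0 'k poly fract) set" where
  "serre_F = {qserre (v j) (N j k) (var j) (var k) | j k. j \<noteq> k}"

abbreviation IS :: "(('i + 'i) list \<Rightarrow>\<^sub>0 'k poly fract) set" where
  "IS \<equiv> Idl\<^bsub>free_algebra\<^esub> serre_F"

end

locale verma = gim_data C \<epsilon> c
  for C :: "'i::finite + 'i \<Rightarrow> 'i + 'i \<Rightarrow> int" and \<epsilon> and c :: "'i + 'i \<Rightarrow> 'k::field poly fract" +
  fixes \<chi> :: "'i + 'i \<Rightarrow> 'k poly fract"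
  assumes chi_nonzero: "\<chi> j \<noteq> 0"
begin

abbreviation "E \<equiv> opE \<chi>"
abbreviation "K \<equiv> opK \<chi>"
abbreviation "K' \<equiv> opK' \<chi>"

lemma weight_nonzero [simp]: "weight \<chi> j w \<noteq> 0"
  using chi_nonzero by (simp add: weight_def)

lemma weight_Cons: "weight \<chi> j (k # w) = v j powi (- C j k) * weight \<chi> j w"
  by (simp add: weight_def power_int_add[symmetric] power_int_diff power_int_minus field_simps)

lemma op_word [simp]:
  "app (K j) (word w) = fsm (weight \<chi> j w) (word w)"
  "app (K' j) (word w) = fsm (inverse (weight \<chi> j w)) (word w)"
  "app (E j) (word w) = lowering \<chi> j w"
  "app (opF j) x = var j * x"
  by (simp_all add: opK_def opK'_def opE_def opF_def)

lemma K_K': "K j * K' j = 1" and K'_K: "K' j * K j = 1"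
  by (rule endo_word_eqI; simp add: app_fsm)+

lemma K_K: "K j * K k = K k * K j"
  by (rule endo_word_eqI) (simp add: app_fsm mult.commute)

lemma K_F: "K j * opF k = esm (v j powi (- C j k)) (opF k * K j)"
  by (rule endo_word_eqI) (simp add: app_fsm weight_Cons flip: word_Cons)

lemma K'_F: "K' j * opF k = esm (v j powi C j k) (opF k * K' j)"
  by (rule endo_word_eqI) (simp add: app_fsm weight_Cons power_int_minus flip: word_Cons)

lemma E_F: "E j * opF k - opF k * E j = (if j = k then esm (h j) (K j - K' j) else 0)"
  by (rule endo_word_eqI) (simp add: word_Cons[symmetric] free.sm_distribs right_diff_distrib)

lemma K_E_word: "app (K j) (lowering \<chi> k w) = fsm (v j powi C j k * weight \<chi> j w) (lowering \<chi> k w)"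
proof (induction w)
  case (Cons m w)
  have "app (K j) (var m * x) = fsm (v j powi (- C j m)) (var m * app (K j) x)" for x
    using K_F[of j m] by (metis app_simps(6,7) op_word(4))
  then show ?case using Cons
    by (auto simp: app_add app_fsm weight_Cons free.sm_distribs power_int_minus field_simps)
qed simp

lemma K_E: "K j * E k = esm (v j powi C j k) (E k * K j)"
  by (rule endo_word_eqI) (simp add: K_E_word app_fsm)

lemma K'_E: "K' j * E k = esm (v j powi (- C j k)) (E k * K' j)"
proof -
  have "K' j * E k = K' j * (E k * (K j * K' j))" by (simp add: K_K')
  also have "\<dots> = esm (v j powi (- C j k)) (K' j * esm (v j powi C j k) (E k * K j) * K' j)"
    by (simp add: mult.assoc power_int_minus)
  also have "\<dots> = esm (v j powi (- C j k)) (K' j * K j * E k * K' j)"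
    by (simp only: K_E[symmetric] mult.assoc)
  finally show ?thesis by (simp add: K'_K)
qed

end

text \<open>The mixed relations alone, in a form symmetric under exchanging \<open>e\<close> with
  \<open>f\<close> and \<open>k\<close> with \<open>k'\<close>. One computation then treats the
  Serre polynomials of the \<open>F j\<close> and of the \<open>E j\<close>.\<close>

locale double_relations = gim_data C \<epsilon> c + assoc_alg sm
  for C :: "'i::finite + 'i \<Rightarrow> 'i + 'i \<Rightarrow> int" and \<epsilon> and c :: "'i + 'i \<Rightarrow> 'k::field poly fract"
    and sm :: "'k poly fract \<Rightarrow> 'a::ring_1 \<Rightarrow> 'a" +
  fixes e f k k' :: "'i + 'i \<Rightarrow> 'a"
  assumes e_f: "e m * f n - f n * e m = (if m = n then sm (h m) (k m - k' m) else 0)"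
    and k_f: "k m * f n = sm (v m powi (- C m n)) (f n * k m)"
    and k'_f: "k' m * f n = sm (v m powi C m n) (f n * k' m)"
begin

lemma e_f_commute: "m \<noteq> n \<Longrightarrow> e m * f n = f n * e m"
  using e_f[of m n] by simp

text \<open>The exponents \<open>2t - n\<close> for \<open>t \<le> n\<close> are symmetric about
  0.\<close>

lemma sum_reflect_eq_zero:
  "(\<Sum>t\<le>n. inverse (inverse (v i) ^ n * v i ^ (2 * t)) - inverse (v i) ^ n * v i ^ (2 * t)) = 0"
proof -
  have "(\<Sum>t\<le>n. inverse (inverse (v i) ^ n * v i ^ (2 * t))) = (\<Sum>t\<le>n. inverse (v i) ^ n * v i ^ (2 * t))"
  proof (rule sum.reindex_bij_witness[of _ "\<lambda>t. n - t" "\<lambda>t. n - t"])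
    fix t assume "t \<in> {..n}"
    then obtain d where n: "n = t + d" using le_Suc_ex by auto
    have "v i ^ (2 * d) * v i ^ (2 * t) = v i ^ n * v i ^ n"
      by (simp add: n mult_2 add_ac flip: power_add)
    then show "inverse (v i) ^ n * v i ^ (2 * (n - t)) = inverse (inverse (v i) ^ n * v i ^ (2 * t))"
      by (simp add: n power_inverse field_simps)
  qed auto
  then show ?thesis by (simp add: sum_subtractf)
qed

text \<open>For \<open>m = i\<close> the scalar of the rank one computation vanishes. For
  \<open>m = j\<close> the commutator replaces \<open>f j\<close> by a multiple of
  \<open>k j - k' j\<close>; the first q-commutator of the form in \<open>v\<close> kills
  \<open>k j\<close>, and that of the form in \<open>1/v\<close> kills \<open>k' j\<close>.
  Otherwise \<open>e m\<close> commutes with both arguments.\<close>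

theorem e_serre_commute:
  assumes ij: "i \<noteq> j"
  defines "S \<equiv> qcomm (v i) (inverse (v i) ^ N i j) (f i) (f j) (Suc (N i j))"
  shows "e m * S = S * e m"
proof -
  let ?w = "inverse (v i)"
  consider "m = i" | "m = j" | "m \<noteq> i" "m \<noteq> j" by blast
  then have "e m * S - S * e m = 0"
  proof cases
    case 1
    have "e i * S - S * e i = sm (h i * (\<Sum>t\<le>N i j. inverse (?w ^ N i j * v i ^ (2 * t)) - ?w ^ N i j * v i ^ (2 * t)))
        (qcomm (v i) (?w ^ N i j) (f i) (f j) (N i j) * k i)"
      unfolding S_def
      by (rule commutator_qcomm_Cartan[where k' = "k' i"])
        (use ij e_f[of i i] e_f_commute[of i j] k_f[of i i] k'_f[of i i] k_f[of i j] k'_f[of i j]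
         in \<open>simp_all add: C_diag v_powi_C v_powi_minus_C power_int_minus power_inverse\<close>)
    then show ?thesis unfolding sum_reflect_eq_zero 1 by simp
  next
    case 2
    have vji: "v j powi C j i = ?w ^ N i j" using v_powi_sym[of j i] v_powi_C[OF ij] by simp
    have z1: "f i * k j = sm (?w ^ N i j) (k j * f i)"
      using k_f[of j i] by (simp add: power_int_minus vji power_inverse)
    have z2: "f i * k' j = sm (v i ^ N i j) (k' j * f i)"
      using k'_f[of j i] by (simp add: vji power_inverse)
    have "e j * S - S * e j = qcomm (v i) (?w ^ N i j) (f i) (sm (h j) (k j - k' j)) (Suc (N i j))"
      unfolding S_def by (subst commutator_qcomm) (use ij e_f_commute[of j i] e_f[of j j] in simp_all)
    also have "\<dots> = sm (h j) (qcomm (v i) (?w ^ N i j) (f i) (k j) (Suc (N i j))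
        - qcomm (v i) (?w ^ N i j) (f i) (k' j) (Suc (N i j)))"
      by (simp only: qcomm_sm qcomm_diff)
    also have "qcomm (v i) (?w ^ N i j) (f i) (k j) (Suc (N i j)) = 0"
      by (rule qcomm_eq_zero[OF z1])
    also have "qcomm (v i) (?w ^ N i j) (f i) (k' j) (Suc (N i j)) = 0"
      unfolding v.qcomm_symmetric[OF assoc_alg_axioms] by (rule qcomm_eq_zero[OF z2])
    finally show ?thesis using 2 by simp
  next
    case 3
    then show ?thesis
      unfolding S_def by (subst commute_qcomm[of "e m"]) (simp_all add: e_f_commute)
  qed
  then show ?thesis by simp
qed

end

context verma
begin

lemma double_FE: "double_relations C \<epsilon> c esm E opF K K'"
  by unfold_locales (use E_F K_F K'_F in auto)

lemma double_EF: "double_relations C \<epsilon> c esm opF E K' K"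
proof
  fix m n
  show "opF m * E n - E n * opF m = (if m = n then esm (h m) (K' m - K m) else 0)"
    using E_F[of n m] by (auto simp: algebra_simps endo.sm_distribs split: if_splits)
qed (use K'_E K_E in auto)

text \<open>With the roles of \<open>E\<close> and \<open>F\<close> exchanged, this operator
  commutes with every \<open>opF m\<close>. It kills the empty word, from which the
  \<open>opF m\<close> produce all words.\<close>

lemma serre_E_zero:
  assumes "i \<noteq> j"
  shows "endo.qcomm (v i) (inverse (v i) ^ N i j) (E i) (E j) (Suc (N i j)) = 0" (is "?S = 0")
proof (rule endo_word_eqI)
  fix w
  have vacuum: "app (endo.qcomm (v i) a (E i) (E j) r) (word []) = 0" for a r
    by (induction r) simp_all
  show "app ?S (word w) = app 0 (word w)"
  proof (induction w)
    case Nil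
    show ?case unfolding vacuum by simp
  next
    case (Cons m w)
    have "app ?S (var m * word w) = app (?S * opF m) (word w)" by simp
    also have "\<dots> = app (opF m) (app ?S (word w))"
      unfolding double_relations.e_serre_commute[OF double_EF assms, of m, symmetric] by simp
    finally show ?case using Cons by (simp add: word_Cons)
  qed
qed

end

section \<open>Word length\<close>

lemma genideal_induct [consumes 1, case_names zero add fsm gen]:
  fixes R :: "('x list \<Rightarrow>\<^sub>0 'f::field) set"
  assumes x: "x \<in> Idl\<^bsub>free_algebra\<^esub> R"
    and zero: "P 0" and add: "\<And>x y. P x \<Longrightarrow> P y \<Longrightarrow> P (x + y)" and fsm: "\<And>a x. P x \<Longrightarrow> P (fsm a x)"
    and gen: "\<And>a b r. r \<in> R \<Longrightarrow> P (word a * r * word b)"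
  shows "P x"
proof -
  \<comment> \<open>Quantifying over both outer words turns the plain subspace given by
    \<open>P\<close> into a two-sided ideal.\<close>
  define I where "I = {x. \<forall>a b. P (word a * x * word b)}"
  have "alg_ideal fsm I"
  proof
    fix x y assume x: "x \<in> I"
    show "y * x \<in> I"
    proof (induction y rule: free_algebra_induct)
      case (word w)
      have "word a * (word w * x) * word b = word (a @ w) * x * word b" for a b
        by (simp only: word_mult[symmetric] mult.assoc)
      then show ?case using x by (simp add: I_def)
    qed (simp_all add: I_def distrib_left distrib_right add fsm)
    show "x * y \<in> I"
    proof (induction y rule: free_algebra_induct)
      case (word w)
      have "word a * (x * word w) * word b = word a * x * word (w @ b)" for a b
        by (simp only: word_mult[symmetric] mult.assoc)
      then show ?case using x by (simp add: I_def)
    qed (simp_all add: I_def distrib_left distrib_right add fsm)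
  qed (simp_all add: I_def zero distrib_left distrib_right add)
  then have "Idl\<^bsub>free_algebra\<^esub> R \<subseteq> I"
    by (rule genideal_least) (use gen in \<open>auto simp: I_def\<close>)
  with x have "P (word [] * x * word [])" by (auto simp: I_def)
  then show ?thesis by (simp add: word_Nil)
qed

definition lengths_in :: "nat set \<Rightarrow> ('x list \<Rightarrow>\<^sub>0 'f::field) \<Rightarrow> bool" where
  "lengths_in D p \<longleftrightarrow> (\<forall>w\<in>Poly_Mapping.keys p. length w \<in> D)"

lemma lengths_in_zero [simp]: "lengths_in D 0"
  by (simp add: lengths_in_def)

lemma lengths_in_word [simp]: "lengths_in D (word w) \<longleftrightarrow> length w \<in> D"
  by (simp add: lengths_in_def)

lemma lengths_in_var: "lengths_in {1} (var x)"
  by (simp add: var_def)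

lemma lengths_in_add: "lengths_in D p \<Longrightarrow> lengths_in D q \<Longrightarrow> lengths_in D (p + q)"
  using keys_add[of p q] by (auto simp: lengths_in_def)

lemma lengths_in_fsm: "lengths_in D p \<Longrightarrow> lengths_in D (fsm a p)"
  by (auto simp: lengths_in_def in_keys_iff)

lemma lengths_in_diff: "lengths_in D p \<Longrightarrow> lengths_in D q \<Longrightarrow> lengths_in D (p - q)"
  using lengths_in_add[of D p "fsm (-1) q"] lengths_in_fsm[of D q "-1"] by (simp add: free.sm_minus_left)

lemma lengths_in_sum: "(\<And>i. i \<in> I \<Longrightarrow> lengths_in D (f i)) \<Longrightarrow> lengths_in D (\<Sum>i\<in>I. f i)"
  by (induction I rule: infinite_finite_induct) (auto intro: lengths_in_add)

lemma lengths_in_mono: "lengths_in D p \<Longrightarrow> D \<subseteq> D' \<Longrightarrow> lengths_in D' p"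
  by (auto simp: lengths_in_def)

lemma lengths_in_mult:
  "lengths_in D p \<Longrightarrow> lengths_in D' q \<Longrightarrow> (\<And>m n. m \<in> D \<Longrightarrow> n \<in> D' \<Longrightarrow> m + n \<in> D'') \<Longrightarrow> lengths_in D'' (p * q)"
  using keys_mult[of p q] by (fastforce simp: lengths_in_def plus_list_def)

lemma lengths_in_var_mult: "lengths_in {..<n} p \<Longrightarrow> lengths_in {..<Suc n} (var x * p)"
  using lengths_in_var by (rule lengths_in_mult) auto

lemma lengths_in_qcomm:
  assumes "lengths_in {1} x" "lengths_in {1} y"
  shows "lengths_in {Suc r} (free.qcomm v a x y r)"
proof (induction r)
  case (Suc r)
  show ?case unfolding free.qcomm.simps
    by (intro lengths_in_diff lengths_in_fsm lengths_in_mult[OF assms(1) Suc] lengths_in_mult[OF Suc assms(1)]) auto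
qed (use assms in simp)

lemma lin_word: "free.lin word p = p"
  by (induction p rule: free_algebra_induct) (simp_all add: free.lin_add free.lin_fsm)

definition component :: "nat \<Rightarrow> ('x list \<Rightarrow>\<^sub>0 'f::field) \<Rightarrow> ('x list \<Rightarrow>\<^sub>0 'f)" where
  "component n = free.lin (\<lambda>w. if length w = n then word w else 0)"

lemma component_simps:
  "component n (p + q) = component n p + component n q"
  "component n (p - q) = component n p - component n q"
  "component n (fsm a p) = fsm a (component n p)"
  "component n (\<Sum>i\<in>I. f i) = (\<Sum>i\<in>I. component n (f i))"
  by (simp_all add: component_def free.lin_add free.lin_diff free.lin_fsm free.lin_sum)

lemma component_self: "lengths_in {n} p \<Longrightarrow> component n p = p"
proof -
  assume p: "lengths_in {n} p"
  have "component n p = free.lin word p"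
    unfolding component_def free.lin_def by (intro sum.cong) (use p in \<open>auto simp: lengths_in_def\<close>)
  then show ?thesis by (simp only: lin_word)
qed

lemma component_eq_zero: "lengths_in D p \<Longrightarrow> n \<notin> D \<Longrightarrow> component n p = 0"
  unfolding component_def free.lin_def by (intro sum.neutral) (auto simp: lengths_in_def)

lemma lengths_in_diff_component:
  assumes "lengths_in {..<Suc n} p"
  shows "lengths_in {..<n} (p - component n p)"
proof -
  have "p - component n p = free.lin word p - component n p" by (simp only: lin_word)
  also have "\<dots> = (\<Sum>w\<in>Poly_Mapping.keys p. fsm (Poly_Mapping.lookup p w) (if length w = n then 0 else word w))"
    unfolding component_def free.lin_def by (simp only: sum_subtractf[symmetric]) (rule sum.cong, auto)
  also have "lengths_in {..<n} \<dots>"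
    using assms by (intro lengths_in_sum lengths_in_fsm) (auto simp: lengths_in_def[of "{..<Suc n}"] less_Suc_eq)
  finally show ?thesis .
qed

section \<open>Independence of characters\<close>

lemma (in generic_parameter) power_int_inj: "v powi m = v powi n \<Longrightarrow> m = n"
proof (induction m n rule: linorder_wlog)
  case (le m n)
  have "v powi (n - m) = 1" using le(2) by (simp add: power_int_diff)
  then have "v ^ nat (n - m) = 1" using le(1) by (simp add: power_int_def)
  then show ?case using v_power[of "nat (n - m)"] le(1) by (cases "n = m") auto
qed simp

text \<open>Dedekind's elimination argument for characters of a torus, relative to a subspace
  \<open>S\<close>; the elements \<open>u l\<close> play the role of the coefficients.\<close>

lemma (in assoc_alg) independence_of_characters:
  fixes \<Lambda> :: "('i::finite \<Rightarrow> int) set" and u :: "('i \<Rightarrow> int) \<Rightarrow> 'a" and q :: 'f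
  assumes "generic_parameter q"
    and S: "\<And>x y. x \<in> S \<Longrightarrow> y \<in> S \<Longrightarrow> x + y \<in> S" "\<And>a x. x \<in> S \<Longrightarrow> sm a x \<in> S" "0 \<in> S"
    and fin: "finite \<Lambda>"
    and sum: "\<And>s. (\<And>i. s i \<noteq> 0) \<Longrightarrow> (\<Sum>l\<in>\<Lambda>. sm (\<Prod>i\<in>UNIV. s i powi l i) (u l)) \<in> S"
    and l: "l \<in> \<Lambda>"
  shows "u l \<in> S"
proof -
  interpret generic_parameter q by fact
  define X where "X s l = (\<Prod>i\<in>UNIV. s i powi l i)" for s :: "'i \<Rightarrow> 'f" and l
  have X_mult: "X (\<lambda>i. s i * t i) l = X s l * X t l" for s t l
    by (simp add: X_def power_int_mult_distrib prod.distrib)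
  have diff: "x - y \<in> S" if "x \<in> S" "y \<in> S" for x y
    using S(1)[OF that(1) S(2)[OF that(2), of "-1"]] by (simp add: sm_minus_left)
  have "\<forall>l\<in>\<Lambda>. u l \<in> S"
    using fin sum unfolding X_def[symmetric]
  proof (induction \<Lambda> arbitrary: u rule: finite_induct)
    case (insert l0 \<Lambda>)
    have mem: "sm (X t m - X t l0) (u m) \<in> S" if m: "m \<in> \<Lambda>" and t: "\<And>i. t i \<noteq> 0" for m t
    proof -
      have "(\<Sum>l\<in>\<Lambda>. sm (X s l) (sm (X t l - X t l0) (u l))) \<in> S" if s: "\<And>i. s i \<noteq> 0" for s
      proof -
        \<comment> \<open>Evaluating at \<open>s * t\<close> and subtracting the multiple of the
          value at \<open>s\<close> removes the character \<open>l0\<close>.\<close>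
        have "(\<Sum>l\<in>insert l0 \<Lambda>. sm (X (\<lambda>i. s i * t i) l) (u l))
            - sm (X t l0) (\<Sum>l\<in>insert l0 \<Lambda>. sm (X s l) (u l)) \<in> S"
          using s t by (intro diff S(2) insert.prems) auto
        also have "(\<Sum>l\<in>insert l0 \<Lambda>. sm (X (\<lambda>i. s i * t i) l) (u l))
            - sm (X t l0) (\<Sum>l\<in>insert l0 \<Lambda>. sm (X s l) (u l))
            = (\<Sum>l\<in>insert l0 \<Lambda>. sm (X s l) (sm (X t l - X t l0) (u l)))"
          by (simp only: sm_sum_right sum_subtractf[symmetric])
            (rule sum.cong, auto simp: X_mult algebra_simps sm_distribs)
        also have "\<dots> = (\<Sum>l\<in>\<Lambda>. sm (X s l) (sm (X t l - X t l0) (u l)))"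
          using insert.hyps by simp
        finally show ?thesis .
      qed
      from insert.IH[OF this] m show ?thesis by blast
    qed
    have in_S: "u m \<in> S" if m: "m \<in> \<Lambda>" for m
    proof -
      from m insert.hyps have "m \<noteq> l0" by auto
      then obtain i where i: "m i \<noteq> l0 i" by (auto simp: fun_eq_iff)
      \<comment> \<open>A point separating the characters \<open>m\<close> and \<open>l0\<close>:
        they differ in coordinate \<open>i\<close>, and \<open>q\<close> has infinite order.\<close>
      define t where "t j = (if j = i then q else 1)" for j
      have X_t: "X t l = q powi l i" for l
      proof -
        have "X t l = (\<Prod>j\<in>UNIV. if j = i then q powi l i else 1)"
          unfolding X_def t_def by (intro prod.cong) auto
        then show ?thesis by simp
      qed
      have "X t m - X t l0 \<noteq> 0" using i power_int_inj by (auto simp: X_t)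
      moreover have "sm (X t m - X t l0) (u m) \<in> S" by (rule mem[OF m]) (simp add: t_def)
      ultimately show ?thesis using S(2)[of "sm (X t m - X t l0) (u m)" "inverse (X t m - X t l0)"] by simp
    qed
    have X1: "X (\<lambda>_. 1) l = 1" for l by (simp add: X_def)
    have sum_S: "(\<Sum>l\<in>\<Lambda>. u l) \<in> S"
      using in_S by (induction \<Lambda> rule: infinite_finite_induct) (auto intro: S)
    have "(\<Sum>l\<in>insert l0 \<Lambda>. u l) \<in> S" using insert.prems[of "\<lambda>_. 1"] by (simp add: X1)
    then have "u l0 \<in> S" using diff[OF _ sum_S, of "\<Sum>l\<in>insert l0 \<Lambda>. u l"] insert.hyps by simp
    with in_S show ?case by auto
  qed simp
  with l show ?thesis by blast
qed

section \<open>The filtration by word length in the generators \<open>b\<^sub>j\<close>\<close>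

context gim_elements
begin

definition b_word :: "('i + 'i) list \<Rightarrow> 'a" where "b_word w = prod_list (List.map b w)"
definition l_word :: "('i + 'i) list \<Rightarrow> 'a" where "l_word u = prod_list (List.map l u)"

lemma b_word_simps [simp]: "b_word [] = 1" "b_word (j # w) = b j * b_word w" "b_word (w @ w') = b_word w * b_word w'"
  by (simp_all add: b_word_def)

lemma l_word_simps [simp]: "l_word [] = 1" "l_word (j # w) = l j * l_word w" "l_word (w @ w') = l_word w * l_word w'"
  by (simp_all add: l_word_def)

definition expo :: "('i + 'i) list \<Rightarrow> 'i \<Rightarrow> int" where
  "expo u i = int (count_list u (Inl i)) - int (count_list u (Inr i))"

lemma expo_append: "expo (u @ u') i = expo u i + expo u' i"
  by (simp add: expo_def count_list_append)

lemma expo_map_bar: "expo (List.map bar u) i = - expo u i"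
proof -
  have "count_list (List.map bar u) j = count_list u (bar j)" for j
    by (induction u) auto
  then show ?thesis by (simp add: expo_def)
qed

lemma l_commute_l_word: "l j * l_word u \<approx> l_word u * l j"
proof (induction u)
  case (Cons k u)
  have "l j * l k * l_word u \<approx> l k * l j * l_word u" by (intro eqv_mult_right l_l)
  also have "l k * l j * l_word u \<approx> l k * (l_word u * l j)"
    using eqv_mult_left[OF Cons, of "l k"] by (simp add: mult.assoc)
  finally show ?case by (simp add: mult.assoc)
qed simp

text \<open>Exponent zero forces a partner \<open>bar j\<close> of the first letter \<open>j\<close>
  further on; \<open>l j\<close> is moved next to it and both cancel.\<close>

lemma l_word_expo_zero: "(\<And>i. expo u i = 0) \<Longrightarrow> l_word u \<approx> 1"
proof (induction u rule: length_induct)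
  case (1 u)
  show ?case
  proof (cases u)
    case (Cons j u')
    have "bar j \<in> set u'"
    proof (rule ccontr)
      assume "bar j \<notin> set u'"
      then have 0: "count_list u' (bar j) = 0" by simp
      show False
      proof (cases j)
        case (Inl i)
        with 0 "1.prems"[of i] Cons show False by (simp add: expo_def)
      next
        case (Inr i)
        with 0 "1.prems"[of i] Cons show False by (simp add: expo_def)
      qed
    qed
    then obtain p q where u': "u' = p @ bar j # q" by (meson split_list)
    have "expo (p @ q) i = 0" for i
      using "1.prems"[of i] unfolding Cons u' expo_def by (cases j) (auto simp: count_list_append split: if_splits)
    then have IH: "l_word (p @ q) \<approx> 1" using "1.IH"[rule_format, of "p @ q"] by (simp add: Cons u' del: l_word_simps)
    have "l_word u = l j * l_word p * (l (bar j) * l_word q)" by (simp add: Cons u' mult.assoc)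
    also have "\<dots> \<approx> l_word p * l j * (l (bar j) * l_word q)" by (intro eqv_mult_right l_commute_l_word)
    also have "l_word p * l j * (l (bar j) * l_word q) \<approx> l_word p * (1 * l_word q)"
      using eqv_mult_left[OF eqv_mult_right[OF l_l_bar[of j], of "l_word q"], of "l_word p"]
      by (simp add: mult.assoc)
    finally show ?thesis using IH eqv_trans by simp
  qed simp
qed

lemma l_word_cong: 
  assumes "expo u = expo u'"
  shows "l_word u \<approx> l_word u'"
proof -
  let ?m = "List.map bar u'"
  have 1: "l_word (?m @ u') \<approx> 1" "l_word (u @ ?m) \<approx> 1"
    by (rule l_word_expo_zero; simp only: expo_append expo_map_bar assms; simp)+
  have "l_word u \<approx> l_word u * (l_word ?m * l_word u')"
    using eqv_mult_left[OF eqv_sym[OF 1(1)], of "l_word u"] by (simp only: l_word_simps mult_1_right)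
  also have "l_word u * (l_word ?m * l_word u') \<approx> l_word u'"
    using eqv_mult_right[OF 1(2), of "l_word u'"] by (simp add: mult.assoc)
  finally show ?thesis .
qed

lemma l_word_b: "\<exists>s. qcommute (l_word u) s (b j)"
proof (induction u)
  case Nil
  show ?case by (rule exI[of _ 1]) (simp add: qcommute_def)
next
  case (Cons k u)
  then show ?case unfolding l_word_simps using qcommute_mult_left[OF l_b] by blast
qed

text \<open>The strict bound on the length makes step 0 equal to \<open>J\<close>, where the descent
  ends; an element of degree \<open>n\<close> is expected in step \<open>Suc n\<close>.\<close>

inductive_set V :: "nat \<Rightarrow> 'a set" for n where
  V_ideal: "x \<in> J \<Longrightarrow> x \<in> V n"
| V_word: "length w < n \<Longrightarrow> b_word w * l_word u \<in> V n"
| V_add: "x \<in> V n \<Longrightarrow> y \<in> V n \<Longrightarrow> x + y \<in> V n"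
| V_sm: "x \<in> V n \<Longrightarrow> sm a x \<in> V n"

lemma V_eqv: "x \<approx> y \<Longrightarrow> y \<in> V n \<Longrightarrow> x \<in> V n"
  using V_add[OF V_ideal[of "x - y" n], of y] by (simp add: eqv_def)

lemma V_zero_eq: "V 0 = J"
proof
  show "V 0 \<subseteq> J"
  proof
    fix x assume "x \<in> V 0"
    then show "x \<in> J" by induction (auto simp: add_in sm_in)
  qed
qed (auto intro: V_ideal)

lemma V_sum: "(\<And>i. i \<in> I \<Longrightarrow> f i \<in> V n) \<Longrightarrow> (\<Sum>i\<in>I. f i) \<in> V n"
  by (induction I rule: infinite_finite_induct) (auto intro: V_add V_ideal)

lemma V_mono: "x \<in> V n \<Longrightarrow> n \<le> m \<Longrightarrow> x \<in> V m"
  by (induction rule: V.induct) (auto intro: V.intros)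

lemma V_l_word: "x \<in> V n \<Longrightarrow> x * l_word u' \<in> V n"
proof (induction rule: V.induct)
  case (V_word w u)
  then show ?case using V.V_word[of w n "u @ u'"] by (simp add: mult.assoc)
qed (auto intro: V_ideal V_add V_sm mult_right_in simp: distrib_right)

lemma V_b_left: "x \<in> V n \<Longrightarrow> b j * x \<in> V (Suc n)"
proof (induction rule: V.induct)
  case (V_word w u)
  then show ?case using V.V_word[of "j # w" "Suc n" u] by (simp add: mult.assoc)
qed (auto intro: V_ideal V_add V_sm mult_left_in simp: distrib_left)

lemma V_b_right: "x \<in> V n \<Longrightarrow> x * b j \<in> V (Suc n)"
proof (induction rule: V.induct)
  case (V_word w u)
  obtain s where "qcommute (l_word u) s (b j)" using l_word_b by blast
  then have "b_word w * l_word u * b j \<approx> sm s (b_word (w @ [j]) * l_word u)"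
    using eqv_mult_left[OF qcommute_eqv, of "l_word u" s "b j" "b_word w"] by (simp add: mult.assoc)
  moreover have "sm s (b_word (w @ [j]) * l_word u) \<in> V (Suc n)"
    using V_word by (intro V_sm V.V_word) simp
  ultimately show ?case by (rule V_eqv)
qed (auto intro: V_ideal V_add V_sm mult_right_in simp: distrib_right)

lemma V_b_word_left: "x \<in> V n \<Longrightarrow> b_word w * x \<in> V (n + length w)"
  by (induction w) (auto simp: mult.assoc intro: V_b_left)

lemma V_b_word_right: "x \<in> V n \<Longrightarrow> x * b_word w \<in> V (n + length w)"
proof (induction w arbitrary: x n)
  case (Cons j w)
  from Cons.IH[OF V_b_right[OF Cons.prems]] show ?case by (simp add: mult.assoc)
qed simp

lemma lift_b_in_V:
  assumes "lengths_in {..<n} p"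
  shows "lift b p * l_word u \<in> V n"
  unfolding lift_def lin_def sum_distrib_right
  using assms V_word[of _ n u] by (intro V_sum) (auto simp: lengths_in_def b_word_def intro!: V_sm)

text \<open>Replacing letters by the \<open>b j\<close> in an element of the Serre ideal loses one
  degree. A homogeneous Serre polynomial goes to \<open>J\<close>, except for
  \<open>k = bar j\<close>, where it is a commutator of degree 2 that equals a combination of the
  \<open>l j\<close>, of degree 0.\<close>

lemma serre_ideal_in_V:
  assumes "p \<in> IS"
  shows "lift b (component n p) \<in> V n"
  using assms
proof (induction p arbitrary: n rule: genideal_induct)
  case (gen w w' r)
  then obtain j k where jk: "j \<noteq> k" and r: "r = qserre (v j) (N j k) (var j) (var k)"
    by (auto simp: serre_F_def)
  let ?N = "N j k"
  have r': "r = free.qcomm (v j) (inverse (v j) ^ ?N) (var j) (var k) (Suc ?N)"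
    unfolding r v.qserre_eq_qcomm ..
  have len: "lengths_in {length w + (Suc (Suc ?N) + length w')} (word w * r * word w')"
    unfolding mult.assoc r'
    by (intro lengths_in_mult[of "{length w}" _ "{Suc (Suc ?N) + length w'}"]
         lengths_in_mult[of "{Suc (Suc ?N)}" _ "{length w'}"] lengths_in_qcomm lengths_in_var) auto
  have "lift b r \<in> V (Suc (Suc ?N))"
  proof (cases "k = bar j")
    case False
    have "lift b r \<in> J" unfolding r' lift_qcomm lift_var by (rule serre_b[OF jk False])
    then show ?thesis by (rule V_ideal)
  next
    case True
    have "lift b r = b j * b (bar j) - b (bar j) * b j"
      unfolding r' True by (simp add: C_bar_right lift_simps)
    moreover have "l m \<in> V (Suc (Suc ?N))" for m
      using V_word[of "[]" "Suc (Suc ?N)" "[m]"] by simp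
    then have "sm (c j * h j) (l j + sm (-1) (l (bar j))) \<in> V (Suc (Suc ?N))"
      by (intro V_sm V_add)
    then have "b j * b (bar j) - b (bar j) * b j \<in> V (Suc (Suc ?N))"
      using V_eqv[OF b_b_bar] by (simp add: sm_minus_left)
    ultimately show ?thesis by simp
  qed
  then have V: "lift b (word w * r * word w') \<in> V (length w + (Suc (Suc ?N) + length w'))"
    using V_b_word_left[OF V_b_word_right, of "lift b r" "Suc (Suc ?N)" w w']
    by (simp add: lift_simps lift_word b_word_def mult.assoc add_ac)
  \<comment> \<open>The spanning element is homogeneous, so its component is either itself or
    zero.\<close>
  show ?case
  proof (cases "n = length w + (Suc (Suc ?N) + length w')")
    case True
    then show ?thesis using V component_self[of n "word w * r * word w'"] len by simp
  next
    case False
    then have "component n (word w * r * word w') = 0" by (intro component_eq_zero[OF len]) simp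
    then show ?thesis by (simp add: V_ideal)
  qed
qed (simp_all add: component_simps lift_simps V_add V_sm V_ideal component_eq_zero[of "{}"])

definition l_monomial :: "('i \<Rightarrow> int) \<Rightarrow> 'a" where
  "l_monomial m = l_word (SOME u. expo u = m)"

lemma l_word_eqv_l_monomial: "l_word u \<approx> l_monomial (expo u)"
proof -
  have "expo (SOME u'. expo u' = expo u) = expo u" by (rule someI) (rule refl)
  then show ?thesis unfolding l_monomial_def by (intro l_word_cong) simp
qed

text \<open>Collects elements by exponents of the \<open>l j\<close>. The inclusion in
  \<open>range expo\<close> ensures that \<open>l_monomial m\<close> has exponent \<open>m\<close>;
  vanishing of \<open>g\<close> outside \<open>M\<close> allows sums over different index sets to be
  added.\<close>

definition decomposition ::
    "nat \<Rightarrow> 'a \<Rightarrow> ('i \<Rightarrow> int) set \<Rightarrow> (('i \<Rightarrow> int) \<Rightarrow> (('i + 'i) list \<Rightarrow>\<^sub>0 'k poly fract)) \<Rightarrow> bool" where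
  "decomposition n x M g \<longleftrightarrow> finite M \<and> M \<subseteq> range expo \<and> (\<forall>m. m \<notin> M \<longrightarrow> g m = 0) \<and>
    (\<forall>m. lengths_in {..<n} (g m)) \<and> x \<approx> (\<Sum>m\<in>M. lift b (g m) * l_monomial m)"

lemma decomposition_add:
  assumes "decomposition n x M g" "decomposition n y M' g'"
  shows "decomposition n (x + y) (M \<union> M') (\<lambda>m. g m + g' m)"
proof -
  have fin: "finite M" "finite M'" and zero: "\<And>m. m \<notin> M \<Longrightarrow> g m = 0" "\<And>m. m \<notin> M' \<Longrightarrow> g' m = 0"
    using assms by (auto simp: decomposition_def)
  have 1: "(\<Sum>m\<in>M. lift b (g m) * l_monomial m) = (\<Sum>m\<in>M \<union> M'. lift b (g m) * l_monomial m)"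
    by (rule sum.mono_neutral_left) (simp_all add: fin zero)
  have 2: "(\<Sum>m\<in>M'. lift b (g' m) * l_monomial m) = (\<Sum>m\<in>M \<union> M'. lift b (g' m) * l_monomial m)"
    by (rule sum.mono_neutral_left) (simp_all add: fin zero)
  have "x \<approx> (\<Sum>m\<in>M. lift b (g m) * l_monomial m)" "y \<approx> (\<Sum>m\<in>M'. lift b (g' m) * l_monomial m)"
    using assms by (simp_all add: decomposition_def)
  from eqv_add[OF this]
  have "x + y \<approx> (\<Sum>m\<in>M \<union> M'. lift b (g m + g' m) * l_monomial m)"
    unfolding 1 2 by (simp only: lift_add distrib_right sum.distrib)
  then show ?thesis
    using assms by (simp add: decomposition_def lengths_in_add)
qed

lemma decomposition_sm:
  assumes "decomposition n x M g"
  shows "decomposition n (sm a x) M (\<lambda>m. fsm a (g m))"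
proof -
  have "x \<approx> (\<Sum>m\<in>M. lift b (g m) * l_monomial m)"
    using assms by (simp add: decomposition_def)
  from eqv_sm[OF this, of a]
  have "sm a x \<approx> (\<Sum>m\<in>M. lift b (fsm a (g m)) * l_monomial m)"
    by (simp only: lift_fsm sm_mult_left sm_sum_right)
  then show ?thesis
    using assms by (simp add: decomposition_def lengths_in_fsm)
qed

lemma V_decompose: "x \<in> V n \<Longrightarrow> \<exists>M g. decomposition n x M g"
proof (induction rule: V.induct)
  case (V_ideal x)
  then have "decomposition n x {} (\<lambda>_. 0)" by (simp add: decomposition_def eqv_zero_iff)
  then show ?case by blast
next
  case (V_word w u)
  have "b_word w * l_word u \<approx> b_word w * l_monomial (expo u)"
    by (intro eqv_mult_left l_word_eqv_l_monomial)
  then have "decomposition n (b_word w * l_word u) {expo u} (\<lambda>m. if m = expo u then word w else 0)"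
    using V_word by (simp add: decomposition_def lift_word b_word_def)
  then show ?case by blast
qed (blast intro: decomposition_add decomposition_sm)+

end

section \<open>The action modulo the Serre ideal, and its leading terms\<close>

context verma
begin

definition serre_op :: "'i + 'i \<Rightarrow> 'i + 'i \<Rightarrow> ('i + 'i, 'k poly fract) endo" where
  "serre_op i j = endo.qcomm (v i) (inverse (v i) ^ N i j) (opF i) (opF j) (Suc (N i j))"

sublocale IS: alg_ideal fsm IS
  by (rule alg_ideal_genideal)

lemma left_mult_qserre: "left_mult (qserre (v i) (N i j) (var i) (var j)) = serre_op i j"
  unfolding v.qserre_eq_qcomm left_mult_qcomm serre_op_def opF_def ..

lemma serre_op_in_IS: "i \<noteq> j \<Longrightarrow> app (serre_op i j) x \<in> IS"
proof -
  assume "i \<noteq> j"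
  then have "qserre (v i) (N i j) (var i) (var j) \<in> IS"
    using genideal_superset[of serre_F] by (auto simp: serre_F_def)
  then have "app (left_mult (qserre (v i) (N i j) (var i) (var j))) x \<in> IS"
    by (simp add: IS.mult_right_in)
  then show ?thesis by (simp only: left_mult_qserre)
qed

lemma K_var: "app (K m) (var k * x) = fsm (v m powi (- C m k)) (var k * app (K m) x)"
  using arg_cong[OF K_F[of m k], of "\<lambda>g. app g x"] by simp

lemma K'_var: "app (K' m) (var k * x) = fsm (v m powi C m k) (var k * app (K' m) x)"
  using arg_cong[OF K'_F[of m k], of "\<lambda>g. app g x"] by simp

lemma E_var: "app (E m) (var k * x) = var k * app (E m) x
    + (if m = k then fsm (h m) (app (K m) x - app (K' m) x) else 0)"
  using arg_cong[OF E_F[of m k], of "\<lambda>g. app g x"] by (auto simp: algebra_simps split: if_splits)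

text \<open>Hence the action descends to the quotient by \<open>IS\<close>. The operators are moved
  past the letters on the left and then past the Serre polynomial. The three claims are proved
  together, since \<open>E m\<close> creates \<open>K m\<close> and \<open>K' m\<close> when it
  passes a letter.\<close>

lemma ops_preserve_IS:
  assumes "x \<in> IS"
  shows "app (K m) x \<in> IS \<and> app (K' m) x \<in> IS \<and> app (E m) x \<in> IS"
  using assms
proof (induction x rule: genideal_induct)
  case (gen w w' r)
  then obtain i j where ij: "i \<noteq> j" and r: "r = qserre (v i) (N i j) (var i) (var j)"
    by (auto simp: serre_F_def)
  have S: "r * x = app (serre_op i j) x" for x
    using left_mult_qserre[of i j] by (simp add: r flip: app_left_mult)
  have "app (K m) (app (serre_op i j) x) \<in> IS" for x
    using arg_cong[OF endo.qcomm_weight[OF K_F[of m i] K_F[of m j], of "v i" "inverse (v i) ^ N i j" "Suc (N i j)"],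
        of "\<lambda>g. app g x"] serre_op_in_IS[OF ij]
    unfolding serre_op_def[symmetric] by (simp add: IS.sm_in)
  moreover have "app (K' m) (app (serre_op i j) x) \<in> IS" for x
    using arg_cong[OF endo.qcomm_weight[OF K'_F[of m i] K'_F[of m j], of "v i" "inverse (v i) ^ N i j" "Suc (N i j)"],
        of "\<lambda>g. app g x"] serre_op_in_IS[OF ij]
    unfolding serre_op_def[symmetric] by (simp add: IS.sm_in)
  moreover have "app (E m) (app (serre_op i j) x) \<in> IS" for x
    using arg_cong[OF double_relations.e_serre_commute[OF double_FE ij, of m], of "\<lambda>g. app g x"]
      serre_op_in_IS[OF ij]
    unfolding serre_op_def[symmetric] by simp
  ultimately show ?case
  proof (induction w)
    case Nil
    then show ?case by (simp add: word_Nil S)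
  next
    case (Cons k w)
    from Cons.IH[OF Cons.prems] show ?case
      by (auto simp: word_Cons mult.assoc K_var K'_var E_var
          intro!: IS.sm_in IS.mult_left_in IS.add_in IS.diff_in)
  qed
qed (simp_all add: app_add app_fsm IS.add_in IS.sm_in)

primrec op_gen :: "('i + 'i) uq_gen \<Rightarrow> ('i + 'i, 'k poly fract) endo" where
  "op_gen (UE j) = E j"
| "op_gen (UF j) = opF j"
| "op_gen (UK j) = K j"
| "op_gen (UKinv j) = K' j"

abbreviation \<rho> :: "(('i + 'i) uq_gen list \<Rightarrow>\<^sub>0 'k poly fract) \<Rightarrow> ('i + 'i, 'k poly fract) endo" where
  "\<rho> \<equiv> endo.lift op_gen"

lemma \<rho>_IS: "x \<in> IS \<Longrightarrow> app (\<rho> t) x \<in> IS"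
proof (induction t arbitrary: x rule: free_algebra_induct)
  case (word w)
  then show ?case
  proof (induction w arbitrary: x)
    case (Cons g w)
    then have "app (\<rho> (word w)) x \<in> IS" by blast
    then have "app (op_gen g) (app (\<rho> (word w)) x) \<in> IS"
      using ops_preserve_IS by (cases g) (simp_all add: IS.mult_left_in)
    then show ?case by (simp add: word_Cons endo.lift_simps)
  qed (simp add: word_Nil)
qed (simp_all add: endo.lift_simps IS.add_in IS.sm_in)

text \<open>As operators on the free algebra all relations hold exactly, apart from the Serre
  relations of the \<open>F j\<close>, whose values lie in \<open>IS\<close>.\<close>

lemma uq_rel_IS:
  assumes "r \<in> uq_rels C \<epsilon>"
  shows "app (\<rho> r) x \<in> IS"
  using assms
proof cases
  case (1 i)
  then show ?thesis by (simp add: endo.lift_simps K_K' del: app_simps(6))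
next
  case (2 i)
  then show ?thesis by (simp add: endo.lift_simps K'_K del: app_simps(6))
next
  case (3 i j)
  then show ?thesis using K_K[of i j] by (simp add: endo.lift_simps del: app_simps(6))
next
  case (4 i j)
  then show ?thesis using K_E[of i j] by (simp add: endo.lift_simps v_def[symmetric] del: app_simps(6))
next
  case (5 i j)
  then show ?thesis using K_F[of i j] by (simp add: endo.lift_simps v_def[symmetric] del: app_simps(6))
next
  case (6 i j)
  have "\<rho> r = E i * opF j - opF j * E i - (if i = j then esm (h i) (K i - K' i) else 0)"
    unfolding 6 by (simp add: endo.lift_simps h_def v_def)
  also have "\<dots> = 0" using E_F[of i j] by simp
  finally show ?thesis by simp
next
  case (7 i j)
  then show ?thesis using serre_E_zero[of i j]
    unfolding v_def[symmetric] by (simp only: v.qserre_eq_qcomm endo.lift_qcomm endo.lift_var op_gen.simps) simp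
next
  case (8 i j)
  have "\<rho> r = serre_op i j"
    unfolding 8(1) v_def[symmetric] serre_op_def
    by (simp only: v.qserre_eq_qcomm endo.lift_qcomm endo.lift_var op_gen.simps)
  with 8 show ?thesis using serre_op_in_IS[of i j x] by simp
qed

lemma JU_acts_into_IS:
  assumes "t \<in> JU"
  shows "app (\<rho> t) x \<in> IS"
proof -
  have "alg_ideal fsm {t. \<forall>x. app (\<rho> t) x \<in> IS}"
    by unfold_locales (simp_all add: endo.lift_simps IS.add_in \<rho>_IS)
  then have "JU \<subseteq> {t. \<forall>x. app (\<rho> t) x \<in> IS}"
    by (rule genideal_least) (use uq_rel_IS in auto)
  with assms show ?thesis by blast
qed

lemma lowering_length: "lengths_in {..<length w} (lowering \<chi> j w)"
proof (induction w)
  case (Cons k w)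
  then show ?case
    by (auto intro!: lengths_in_add lengths_in_var_mult lengths_in_fsm)
qed simp

lemma app_length:
  assumes "\<And>w. lengths_in {..<Suc (length w)} (app g (word w))" "lengths_in {..<n} x"
  shows "lengths_in {..<n} (app g x)"
proof -
  have "app g x = app g (free.lin word x)" by (simp only: lin_word)
  also have "\<dots> = (\<Sum>w\<in>Poly_Mapping.keys x. fsm (Poly_Mapping.lookup x w) (app g (word w)))"
    by (simp add: free.lin_def app_sum app_fsm)
  also have "lengths_in {..<n} \<dots>"
    using assms(2) by (intro lengths_in_sum lengths_in_fsm lengths_in_mono[OF assms(1)]) (auto simp: lengths_in_def)
  finally show ?thesis .
qed

lemma B_length:
  assumes "lengths_in {..<n} x"
  shows "lengths_in {..<n} (app (\<rho> (U.B j)) x - var j * x)"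
proof -
  have K': "lengths_in {..<n} (app (K' j) x)"
    by (rule app_length[OF _ assms]) (simp add: lengths_in_fsm)
  have "lengths_in {..<n} (app (E (bar j)) (app (K' j) x))"
    by (rule app_length[OF _ K']) (simp add: lengths_in_mono[OF lowering_length] subset_eq)
  then show ?thesis
    by (simp add: U.B_def U.Y_def endo.lift_simps lengths_in_fsm)
qed

text \<open>The \<open>F\<close> part of each \<open>B j\<close> prepends a letter, while the other
  part contains an \<open>E\<close> and lowers the length.\<close>

lemma B_word_length:
  "lengths_in {..<length w} (app (\<rho> (free.lift U.B (word w))) 1 - word w)"
proof (induction w)
  case Nil
  then show ?case by (simp add: word_Nil)
next
  case (Cons j w)
  let ?x = "app (\<rho> (free.lift U.B (word w))) 1"
  have "lengths_in {..<Suc (length w)} ?x"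
    using lengths_in_add[OF lengths_in_mono[OF Cons, of "{..<Suc (length w)}"], of "word w"] by auto
  from B_length[OF this, of j] have 1: "lengths_in {..<Suc (length w)} (app (\<rho> (U.B j)) ?x - var j * ?x)" .
  have 2: "lengths_in {..<Suc (length w)} (var j * (?x - word w))"
    by (rule lengths_in_var_mult[OF Cons])
  show ?case using lengths_in_add[OF 1 2] by (simp add: word_Cons free.lift_simps endo.lift_simps algebra_simps)
qed

lemma component_B:
  assumes "lengths_in {..<Suc n} p"
  shows "component n (app (\<rho> (free.lift U.B p)) 1) = component n p"
proof -
  have "app (\<rho> (free.lift U.B p)) 1 - p = free.lin (\<lambda>w. app (\<rho> (free.lift U.B (word w))) 1 - word w) p"
    by (induction p rule: free_algebra_induct)
      (simp_all add: free.lin_add free.lin_fsm free.lift_simps endo.lift_simps free.sm_distribs algebra_simps)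
  also have "\<dots> = (\<Sum>w\<in>Poly_Mapping.keys p. fsm (Poly_Mapping.lookup p w)
      (app (\<rho> (free.lift U.B (word w))) 1 - word w))"
    by (rule free.lin_def)
  also have "lengths_in {..<n} \<dots>"
    using assms by (intro lengths_in_sum lengths_in_fsm lengths_in_mono[OF B_word_length])
      (auto simp: lengths_in_def)
  finally have "component n (app (\<rho> (free.lift U.B p)) 1 - p) = 0"
    by (rule component_eq_zero) simp
  then show ?thesis by (simp add: component_simps)
qed

lemma L_word_action:
  "app (\<rho> (free.lift U.L (word u))) 1 = fsm (\<Prod>j\<leftarrow>u. \<chi> j / \<chi> (bar j)) 1"
proof (induction u)
  case (Cons j u)
  have "app (K' (bar j)) 1 = fsm (inverse (\<chi> (bar j))) 1" "app (K j) 1 = fsm (\<chi> j) 1"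
    using op_word(1,2)[of _ "[]"] by (simp_all add: weight_def word_Nil)
  then show ?case
    using Cons by (simp add: word_Cons free.lift_simps endo.lift_simps U.L_def app_fsm field_simps)
qed (simp add: word_Nil)

end

section \<open>The isomorphism\<close>

locale gim_setup =
  fixes A :: "'i::finite \<Rightarrow> 'i \<Rightarrow> int" and \<epsilon> :: "'i \<Rightarrow> nat" and c :: "'i \<Rightarrow> 'k::field poly fract"
  assumes gim: "gim A" and symmetrizer: "symmetrizer A \<epsilon>"
begin

sublocale gim_data "cartan_of_gim A" "case_sum \<epsilon> \<epsilon>" "case_sum c c"
  by (rule gim_data_of_gim[OF gim symmetrizer])

abbreviation JG :: "('i gq_gen list \<Rightarrow>\<^sub>0 'k poly fract) set" where
  "JG \<equiv> Idl\<^bsub>free_algebra\<^esub> (gq_rels A \<epsilon> c)"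

sublocale G: gim_elements "cartan_of_gim A" "case_sum \<epsilon> \<epsilon>" "case_sum c c" fsm JG
    "\<lambda>j. var (ggen j)" "\<lambda>j. var (lgen j)"
  by (rule gim_elements_gq[OF gim symmetrizer])

sublocale M: gim_elements_of_gim A \<epsilon> c fsm JU U.B U.L
  by unfold_locales (rule gim)

abbreviation \<Phi> :: "('i gq_gen list \<Rightarrow>\<^sub>0 'k poly fract) \<Rightarrow> (('i + 'i) uq_gen list \<Rightarrow>\<^sub>0 'k poly fract)" where
  "\<Phi> \<equiv> free.lift M.val"

lemma M_val [simp]: "M.val (ggen j) = U.B j" "M.val (lgen j) = U.L j"
  by (cases j; simp)+

lemma \<Phi>_JG:
  assumes "x \<in> JG"
  shows "\<Phi> x \<in> JU"
proof -
  have "alg_ideal fsm {x. \<Phi> x \<in> JU}"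
    by unfold_locales (simp_all add: free.lift_simps U.add_in U.mult_left_in U.mult_right_in)
  then have "JG \<subseteq> {x. \<Phi> x \<in> JU}"
    by (rule genideal_least) (use M.lift_rel_in in auto)
  with assms show ?thesis by blast
qed

lemma \<Phi>_lift_ggen: "\<Phi> (free.lift (\<lambda>j. var (ggen j)) p) = free.lift U.B p"
proof (induction p rule: free_algebra_induct)
  case (word w)
  show ?case by (induction w) (simp_all add: word_Nil word_Cons free.lift_simps)
qed (simp_all add: free.lift_simps)

lemma \<Phi>_l_word: "\<Phi> (G.l_word u) = free.lift U.L (word u)"
  by (induction u) (simp_all add: word_Nil word_Cons free.lift_simps)

lemma prod_char_l_word:
  assumes "\<And>i. s i \<noteq> 0"
  shows "(\<Prod>j\<leftarrow>u. case_sum s (\<lambda>_. 1) j / case_sum s (\<lambda>_. 1) (bar j)) = (\<Prod>i\<in>UNIV. s i powi G.expo u i :: 'k poly fract)"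
proof (induction u)
  case (Cons j u)
  have "(\<Prod>i\<in>UNIV. s i powi G.expo (j # u) i) = (\<Prod>i\<in>UNIV. s i powi G.expo [j] i) * (\<Prod>i\<in>UNIV. s i powi G.expo u i)"
    using G.expo_append[of "[j]" u] assms by (simp add: power_int_add prod.distrib)
  moreover have "(\<Prod>i\<in>UNIV. s i powi G.expo [j] i) = case_sum s (\<lambda>_. 1) j / case_sum s (\<lambda>_. 1) (bar j)"
  proof (cases j)
    case (Inl i)
    have "(\<Prod>i'\<in>UNIV. s i' powi G.expo [j] i') = (\<Prod>i'\<in>UNIV. if i' = i then s i else 1)"
      by (intro prod.cong) (auto simp: G.expo_def Inl)
    then show ?thesis using Inl by simp
  next
    case (Inr i)
    have "(\<Prod>i'\<in>UNIV. s i' powi G.expo [j] i') = (\<Prod>i'\<in>UNIV. if i' = i then 1 / s i else 1)"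
      by (intro prod.cong) (auto simp: G.expo_def Inr power_int_minus divide_inverse)
    then show ?thesis using Inr by simp
  qed
  ultimately show ?case using Cons by simp
qed (simp add: G.expo_def)

lemma leading_term_vanishes:
  assumes x: "x \<in> G.V (Suc n)" and \<Phi>x: "\<Phi> x \<in> JU"
  shows "x \<in> G.V n"
proof -
  let ?\<theta> = "free.lift (\<lambda>j. var (ggen j))"
  obtain D g where "G.decomposition (Suc n) x D g" using G.V_decompose[OF x] by blast
  then have fin: "finite D" and D: "D \<subseteq> range G.expo" and len: "\<And>m. lengths_in {..<Suc n} (g m)"
    and eq: "G.eqv x (\<Sum>m\<in>D. ?\<theta> (g m) * G.l_monomial m)"
    by (auto simp: G.decomposition_def)
  have \<Phi>_sum: "\<Phi> (\<Sum>m\<in>D. ?\<theta> (g m) * G.l_monomial m) \<in> JU"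
  proof -
    have "\<Phi> x - \<Phi> (\<Sum>m\<in>D. ?\<theta> (g m) * G.l_monomial m) \<in> JU"
      using \<Phi>_JG[OF eq[unfolded G.eqv_def]] by (simp only: free.lift_diff)
    from U.diff_in[OF \<Phi>x this] show ?thesis by simp
  qed
  have sum_V: "(\<Sum>m\<in>D. fsm (\<Prod>i\<in>UNIV. s i powi m i) (?\<theta> (component n (g m)))) \<in> G.V n"
    if s: "\<And>i. s i \<noteq> 0" for s :: "'i \<Rightarrow> 'k poly fract"
  proof -
    \<comment> \<open>\<open>L_i\<close> acts on the highest weight vector by the quotient of the
      weights at \<open>i\<close> and its copy; weight 1 on the copy makes this quotient the
      arbitrary nonzero \<open>s i\<close>.\<close>
    interpret verma "cartan_of_gim A" "case_sum \<epsilon> \<epsilon>" "case_sum c c" "case_sum s (\<lambda>_. 1)"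
      by unfold_locales (use s in \<open>auto split: sum.split\<close>)
    have mon: "app (\<rho> (\<Phi> (G.l_monomial m))) 1 = fsm (\<Prod>i\<in>UNIV. s i powi m i) 1" if "m \<in> D" for m
    proof -
      have "G.expo (SOME u. G.expo u = m) = m"
        by (rule someI_ex[of "\<lambda>u. G.expo u = m"]) (use that D in auto)
      then show ?thesis
        unfolding G.l_monomial_def \<Phi>_l_word L_word_action prod_char_l_word[OF s] by simp
    qed
    have "app (\<rho> (\<Phi> (?\<theta> (g m) * G.l_monomial m))) 1 =
        fsm (\<Prod>i\<in>UNIV. s i powi m i) (app (\<rho> (free.lift U.B (g m))) 1)" if "m \<in> D" for m
      by (simp only: free.lift_mult endo.lift_mult app_simps mon[OF that] app_fsm \<Phi>_lift_ggen)
    moreover have "app (\<rho> (\<Phi> (\<Sum>m\<in>D. ?\<theta> (g m) * G.l_monomial m))) 1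
        = (\<Sum>m\<in>D. app (\<rho> (\<Phi> (?\<theta> (g m) * G.l_monomial m))) 1)"
      using fin by (induction D rule: finite_induct) (simp_all add: free.lift_add endo.lift_add)
    ultimately have "app (\<rho> (\<Phi> (\<Sum>m\<in>D. ?\<theta> (g m) * G.l_monomial m))) 1
        = (\<Sum>m\<in>D. fsm (\<Prod>i\<in>UNIV. s i powi m i) (app (\<rho> (free.lift U.B (g m))) 1))"
      by simp
    with JU_acts_into_IS[OF \<Phi>_sum, of 1]
    have "(\<Sum>m\<in>D. fsm (\<Prod>i\<in>UNIV. s i powi m i) (app (\<rho> (free.lift U.B (g m))) 1)) \<in> IS"
      by simp
    \<comment> \<open>The degree \<open>n\<close> part of the action of \<open>B\<close> is the
      leading part of \<open>g m\<close>; substituting the \<open>b j\<close> leads back to the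
      presented algebra, one step lower than expected.\<close>
    from G.serre_ideal_in_V[OF this, of n] show ?thesis
      by (simp only: component_simps component_B[OF len] free.lift_sum free.lift_fsm)
  qed
  \<comment> \<open>Independence is applied relative to the filtration step \<open>G.V n\<close>;
    the element of infinite order is \<open>v\<close> at an arbitrary index.\<close>
  have leading: "?\<theta> (component n (g m)) \<in> G.V n" if "m \<in> D" for m
    by (rule free.independence_of_characters[OF generic_v[of undefined] G.V_add G.V_sm G.V_ideal[OF G.zero_in] fin _ that])
      (use sum_V in auto)
  have "?\<theta> (g m) * G.l_monomial m \<in> G.V n" if "m \<in> D" for m
  proof -
    have "?\<theta> (g m - component n (g m)) * G.l_monomial m \<in> G.V n"
      unfolding G.l_monomial_def by (rule G.lift_b_in_V[OF lengths_in_diff_component[OF len]])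
    moreover have "?\<theta> (component n (g m)) * G.l_monomial m \<in> G.V n"
      unfolding G.l_monomial_def by (rule G.V_l_word[OF leading[OF that]])
    ultimately have "?\<theta> (g m - component n (g m)) * G.l_monomial m + ?\<theta> (component n (g m)) * G.l_monomial m \<in> G.V n"
      by (rule G.V_add)
    then show ?thesis by (simp add: free.lift_diff left_diff_distrib)
  qed
  then show ?thesis by (intro G.V_eqv[OF eq] G.V_sum)
qed

text \<open>Each filtration step is stable under \<open>l j\<close> on the right, and
  \<open>b j\<close> on the right raises it by one, since words in the \<open>l j\<close> q-commute
  with \<open>b j\<close>. Hence letters are appended at the end.\<close>

lemma exists_V: "\<exists>n. x \<in> G.V n"
proof (induction x rule: free_algebra_induct)
  case (word w)
  show ?case
  proof (induction w rule: rev_induct)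
    case Nil
    show ?case using G.V_word[of "[]" 1 "[]"] by (auto simp: word_Nil)
  next
    case (snoc a w)
    then obtain n where n: "word w \<in> G.V n" by blast
    have eq: "word (w @ [a]) = (word w * var a :: 'i gq_gen list \<Rightarrow>\<^sub>0 'k poly fract)"
      by (simp add: word_mult var_def)
    have "a \<in> range ggen \<union> range lgen" by (simp only: range_ggen_lgen UNIV_I)
    then show ?case
    proof
      assume "a \<in> range ggen"
      then show ?thesis unfolding eq using G.V_b_right[OF n] by auto
    next
      assume "a \<in> range lgen"
      then obtain j where "a = lgen j" by blast
      then show ?thesis unfolding eq using G.V_l_word[OF n, of "[j]"] by auto
    qed
  qed
next
  case (add x y)
  then obtain m n where "x \<in> G.V m" "y \<in> G.V n" by blast
  then have "x + y \<in> G.V (max m n)" by (intro G.V_add) (auto elim: G.V_mono)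
  then show ?case by blast
next
  case (fsm a x)
  then show ?case using G.V_sm by blast
qed

text \<open>The hypothesis concerns \<open>x\<close> alone and stays available during the descent
  through the filtration, which ends in step 0, the ideal \<open>JG\<close>.\<close>

lemma \<Phi>_injective:
  assumes "\<Phi> x \<in> JU"
  shows "x \<in> JG"
proof -
  obtain n where "x \<in> G.V n" using exists_V by blast
  then have "x \<in> G.V 0"
    by (induction n) (auto dest: leading_term_vanishes[OF _ assms])
  then show ?thesis by (simp only: G.V_zero_eq)
qed

sublocale GQ: free_ideal JG
  by (rule free_ideal_genideal)

sublocale UQ: free_ideal JU
  by (rule free_ideal_genideal)

lemma uq_of_gim_eq: "uq_of_gim A \<epsilon> x = coset JU (var x)"
  by (simp add: uq_of_gim_def uq_def gen_class_def coset_def)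

lemma Uq_of_gim_eq: "Uq_of_gim A \<epsilon> = UQ.Q"
  by (simp add: Uq_of_gim_def Uq_def presented_algebra_def)

lemma gim_B_eq: "gim_B A \<epsilon> c j = coset JU (U.B j)"
  unfolding gim_B_def uq_of_gim_eq Uq_of_gim_eq
  by (simp add: U.B_def U.Y_def free.sm_minus_left)

lemma gim_L_eq: "gim_L A \<epsilon> j = coset JU (U.L j)"
  unfolding gim_L_def uq_of_gim_eq Uq_of_gim_eq by (simp add: U.L_def)

lemma gq_eq: "gq A \<epsilon> c x = coset JG (var x)"
  by (simp add: gq_def gen_class_def coset_def)

lemma quantum_gim_algebra_eq:
  "quantum_gim_algebra A \<epsilon> c = generated_subalgebra UQ.Q (range (\<lambda>x. coset JU (M.val x)))"
proof -
  have 1: "gim_B A \<epsilon> c = (\<lambda>x. coset JU (M.val x)) \<circ> ggen" "gim_L A \<epsilon> = (\<lambda>x. coset JU (M.val x)) \<circ> lgen"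
    by (rule ext, simp only: gim_B_eq gim_L_eq M_val comp_def)+
  have "range (gim_B A \<epsilon> c) \<union> range (gim_L A \<epsilon>) = (\<lambda>x. coset JU (M.val x)) ` (range ggen \<union> range lgen)"
    unfolding 1 image_comp[symmetric] image_Un ..
  then have "range (gim_B A \<epsilon> c) \<union> range (gim_L A \<epsilon>) = range (\<lambda>x. coset JU (M.val x))"
    by (simp only: range_ggen_lgen)
  then show ?thesis by (simp add: quantum_gim_algebra_def Uq_of_gim_eq)
qed

text \<open>No value is prescribed on \<open>GLbar\<close>, but a ring homomorphism must send it to
  the inverse of the image of \<open>GL\<close>.\<close>

lemma generators_agree:
  assumes "\<phi> \<in> ring_hom GQ.Q UQ.Q" "\<psi> \<in> ring_hom GQ.Q UQ.Q"
    and L: "\<And>i. \<phi> (gq A \<epsilon> c (GL i)) = gim_L A \<epsilon> (Inl i)" "\<And>i. \<psi> (gq A \<epsilon> c (GL i)) = gim_L A \<epsilon> (Inl i)"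
  shows "\<phi> (gq A \<epsilon> c (GLbar i)) = \<psi> (gq A \<epsilon> c (GLbar i))"
proof -
  interpret UQ: Ring.ring UQ.Q by (rule UQ.ring_Q)
  have inv: "\<zeta> (gq A \<epsilon> c (GLbar i)) = gim_L A \<epsilon> (Inr i)"
    if \<zeta>: "\<zeta> \<in> ring_hom GQ.Q UQ.Q" "\<zeta> (gq A \<epsilon> c (GL i)) = gim_L A \<epsilon> (Inl i)" for \<zeta>
  proof -
    let ?x = "\<zeta> (gq A \<epsilon> c (GLbar i))"
    have x: "?x \<in> carrier UQ.Q"
      using ring_hom_closed[OF \<zeta>(1)] by (simp add: gq_eq GQ.Q_carrier)
    have "gq A \<epsilon> c (GLbar i) \<otimes>\<^bsub>GQ.Q\<^esub> gq A \<epsilon> c (GL i) = \<one>\<^bsub>GQ.Q\<^esub>"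
      using G.l_l_bar[of "Inr i"] by (simp add: gq_eq GQ.Q_one GQ.coset_eq_iff)
    then have "?x \<otimes>\<^bsub>UQ.Q\<^esub> gim_L A \<epsilon> (Inl i) = \<one>\<^bsub>UQ.Q\<^esub>"
      using ring_hom_mult[OF \<zeta>(1), of "gq A \<epsilon> c (GLbar i)" "gq A \<epsilon> c (GL i)"] ring_hom_one[OF \<zeta>(1)] \<zeta>(2)
      by (simp add: gq_eq GQ.Q_carrier)
    moreover have "gim_L A \<epsilon> (Inl i) \<otimes>\<^bsub>UQ.Q\<^esub> gim_L A \<epsilon> (Inr i) = \<one>\<^bsub>UQ.Q\<^esub>"
      using U.L_L_bar[of "Inl i"] by (simp add: gim_L_eq UQ.Q_one UQ.coset_eq_iff)
    ultimately show ?thesis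
      by (rule UQ.inv_unique[OF _ _ _ x]) (simp_all add: gim_L_eq UQ.Q_carrier)
  qed
  show ?thesis by (simp only: inv[OF assms(1) L(1)] inv[OF assms(2) L(2)])
qed

end

theorem theorem12p4:
  fixes A :: "'i::finite \<Rightarrow> 'i \<Rightarrow> int"
    and \<epsilon> :: "'i \<Rightarrow> nat"
    and c :: "'i \<Rightarrow> 'k::{alg_closed_field, field_char_0} poly fract"
  assumes "gim A"
    and "symmetrizer A \<epsilon>"
    and "unoriented A"
    and "\<And>i. c i \<noteq> 0"
  shows "\<exists>!\<phi>. \<phi> \<in> algebra_iso (Gq A \<epsilon> c) (quantum_gim_algebra A \<epsilon> c) \<and>
    \<phi> \<in> extensional (carrier (Gq A \<epsilon> c)) \<and>
    (\<forall>i. \<phi> (gq A \<epsilon> c (GL i)) = gim_L A \<epsilon> (Inl i) \<and>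
         \<phi> (gq A \<epsilon> c (GG i)) = gim_B A \<epsilon> c (Inl i) \<and>
         \<phi> (gq A \<epsilon> c (GGbar i)) = gim_B A \<epsilon> c (Inr i))"
proof -
  interpret gim_setup A \<epsilon> c by unfold_locales (fact assms)+
  let ?P = "\<lambda>\<phi>. \<phi> \<in> algebra_iso (Gq A \<epsilon> c) (quantum_gim_algebra A \<epsilon> c) \<and>
    \<phi> \<in> extensional (carrier (Gq A \<epsilon> c)) \<and>
    (\<forall>i. \<phi> (gq A \<epsilon> c (GL i)) = gim_L A \<epsilon> (Inl i) \<and>
         \<phi> (gq A \<epsilon> c (GG i)) = gim_B A \<epsilon> c (Inl i) \<and>
         \<phi> (gq A \<epsilon> c (GGbar i)) = gim_B A \<epsilon> c (Inr i))"
  show ?thesis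
  proof (rule ex_ex1I)
    have Gq: "Gq A \<epsilon> c = presented_algebra (gq_rels A \<epsilon> c)" by (simp add: Gq_def)
    obtain \<phi> where "\<phi> \<in> algebra_iso (Gq A \<epsilon> c) (quantum_gim_algebra A \<epsilon> c)"
      "\<phi> \<in> extensional (carrier (Gq A \<epsilon> c))" and \<phi>: "\<And>p. \<phi> (coset JG p) = coset JU (\<Phi> p)"
      using algebra_iso_generated_subalgebra[of "gq_rels A \<epsilon> c" M.val "uq_rels (cartan_of_gim A) (case_sum \<epsilon> \<epsilon>)"]
        M.lift_rel_in \<Phi>_injective
      unfolding quantum_gim_algebra_eq Gq by (auto simp: presented_algebra_def)
    moreover have "\<phi> (gq A \<epsilon> c x) = coset JU (M.val x)" for x
      by (simp add: gq_eq \<phi>)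
    ultimately show "\<exists>\<phi>. ?P \<phi>"
      by (intro exI[of _ \<phi>]) (simp add: gim_L_eq gim_B_eq)
  next
    let ?N = "quantum_gim_algebra A \<epsilon> c"
    have Gq: "Gq A \<epsilon> c = GQ.Q" by (simp add: Gq_def presented_algebra_def)
    have N: "carrier ?N \<subseteq> carrier UQ.Q" "monoid.mult ?N = monoid.mult UQ.Q" "ring.add ?N = ring.add UQ.Q"
      "monoid.one ?N = monoid.one UQ.Q" "module.smult ?N = module.smult UQ.Q"
      unfolding quantum_gim_algebra_eq UQ.carrier_generated_subalgebra UQ.Q_carrier
      by (auto simp: generated_subalgebra_def)
    \<comment> \<open>Both maps are regarded as homomorphisms into all of U_q, where inverses are
      known to be unique.\<close>
    have hom: "\<phi> \<in> ring_hom GQ.Q UQ.Q" if "\<phi> \<in> algebra_iso GQ.Q ?N" for \<phi>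
      using that N by (auto simp: algebra_iso_def ring_iso_def ring_hom_def)
    have smult: "\<phi> (a \<odot>\<^bsub>GQ.Q\<^esub> x) = a \<odot>\<^bsub>UQ.Q\<^esub> \<phi> x"
      if "\<phi> \<in> algebra_iso GQ.Q ?N" "x \<in> carrier GQ.Q" for \<phi> a x
      using that N by (simp add: algebra_iso_def)
    fix \<phi> \<psi>
    assume \<phi>: "?P \<phi>" and \<psi>: "?P \<psi>"
    have homs: "\<phi> \<in> ring_hom GQ.Q UQ.Q" "\<psi> \<in> ring_hom GQ.Q UQ.Q"
      using hom \<phi> \<psi> unfolding Gq by blast+
    have gen: "\<phi> (coset JG (var x)) = \<psi> (coset JG (var x))" for x
      unfolding gq_eq[symmetric] using \<phi> \<psi> generators_agree[OF homs] by (cases x) simp_all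
    have "\<phi> X = \<psi> X" if "X \<in> carrier GQ.Q" for X
      by (rule GQ.Q_hom_eqI[OF homs _ _ gen that]) (use smult \<phi> \<psi> in \<open>auto simp: Gq\<close>)
    with \<phi> \<psi> show "\<phi> = \<psi>" unfolding Gq by (metis extensionalityI)
  qed
qed

end
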